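(* Let $M_n$ denote the length of the largest interval after $n$ steps of Kakutani's interval-splitting process, and let $\sigma^2 := 16\log 2 - 10$. There exists a constant $C\in[0,\infty)$ such that for every $n\in\mathbb N=\{1,2,\dots\}$, \[ \sup_{x\in\mathbb R}\left|\Pr\left(\sqrt{\frac{n^3}{\sigma^2}}\left(M_n-\frac{2}{n}\right)\le x\right)-\Phi(x)\right|\le \frac{C}{\sqrt n}. \]
   Context: Kakutani's interval-splitting process: let $U_1,U_2,\dots$ be i.i.d. uniform random variables on $[0,1]$. At time $0$ the partition of $[0,1]$ consists of the single interval $[0,1]$. Given the partition at time $n\in\mathbb Z_+$ (which consists of $n+1$ intervals, whose lengths are a.s. distinct), let $[a,b]$ be the interval of maximal length; the partition at time $n+1$ is obtained by replacing $[a,b]$ by the two intervals $[a,a+U_{n+1}(b-a)]$ and $[a+U_{n+1}(b-a),b]$. Write $L_{n,1},\dots,L_{n,n+1}$ for the lengths of the $n+1$ intervals at time $n$ (in left-to-right order), $M_n:=\max_i L_{n,i}$ and $m_n:=\min_i L_{n,i}$. $\Phi$ is the standard normal distribution function. *)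

theory Defs
  imports "HOL-Probability.Probability"
begin

text \<open>Kakutani's interval-splitting process, driven by a sequence u of splitting
  values (u (n+1) is used at step n+1).  The state at time n is the list of the
  n+1 interval lengths in left-to-right order.  The interval to split is the
  (first) one of maximal length; ties occur only with probability 0.\<close>

fun kakutani_lengths :: "(nat \<Rightarrow> real) \<Rightarrow> nat \<Rightarrow> real list" where
  "kakutani_lengths u 0 = [1]"
| "kakutani_lengths u (Suc n) =
     (let ls = kakutani_lengths u n;
          i = (LEAST i. i < length ls \<and> ls ! i = Max (set ls))
      in take i ls @ [u (Suc n) * (ls ! i), (1 - u (Suc n)) * (ls ! i)] @ drop (Suc i) ls)"

definition kakutani_max :: "(nat \<Rightarrow> real) \<Rightarrow> nat \<Rightarrow> real" where
  "kakutani_max u n = Max (set (kakutani_lengths u n))"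

definition Phi :: "real \<Rightarrow> real" where
  "Phi x = measure (density lborel std_normal_density) {..x}"

end

theory Submission
  imports Defs "HOL-Real_Asymp.Real_Asymp"
begin

text \<open>
  The largest interval is at most \<open>t\<close> after \<open>n\<close> steps iff at most \<open>n\<close> splits are needed to bring
  all intervals below \<open>t\<close>. The order of the splits does not matter for their number, so the number
  of final pieces of an interval of length \<open>x = 1 / t\<close> (with threshold 1) satisfies a
  distributional recursion: its centred characteristic function \<open>f\<close> solves \<open>x f(x) = (f * f)(x)\<close>
  for \<open>x > 1\<close>, with an explicit \<open>f\<close> on \<open>[0, 1]\<close>. Every exponential solves the same equation
  exactly, and the Gaussian guess \<open>g\<close> built from the mean \<open>2 x\<close> and the variance \<open>(8 ln 2 - 5) x\<close>
  (for \<open>x \<ge> 2\<close>) solves it up to an error of third order in the frequency, because mean and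
  variance satisfy the moment recursions. A Gronwall argument for the averaged equation, combined
  with exponential decay of \<open>|f|\<close> from an explicit supersolution, bounds \<open>f - g\<close>; Esseen's
  smoothing inequality then gives a Berry--Esseen bound for the number of splits, which is
  inverted to obtain the one for the largest interval.
\<close>

section \<open>Integrals over sets\<close>

lemma set_integrable_bounded:
  fixes f :: "'a \<Rightarrow> 'b::{banach, second_countable_topology}"
  assumes "A \<in> sets M" "emeasure M A < \<infinity>" "f \<in> borel_measurable M"
    and "\<And>x. x \<in> A \<Longrightarrow> norm (f x) \<le> B"
  shows "set_integrable M A f"
  unfolding set_integrable_def using assms by (intro integrableI_bounded_set_indicator) auto

lemma set_integrable_Icc_bounded:
  fixes f :: "real \<Rightarrow> 'b::{banach, second_countable_topology}"
  assumes "f \<in> borel_measurable borel" "\<And>x. x \<in> {a..b} \<Longrightarrow> norm (f x) \<le> B"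
  shows "set_integrable lborel {a..b} f"
  using assms by (intro set_integrable_bounded) (auto simp: emeasure_lborel_Icc_eq)

lemma set_integral_sum:
  fixes f :: "'i \<Rightarrow> 'a \<Rightarrow> 'b::{banach, second_countable_topology}"
  assumes "\<And>i. i \<in> I \<Longrightarrow> set_integrable M A (f i)"
  shows "(LINT x:A|M. (\<Sum>i\<in>I. f i x)) = (\<Sum>i\<in>I. LINT x:A|M. f i x)"
  using assms unfolding set_lebesgue_integral_def set_integrable_def
  by (simp add: scaleR_sum_right)

lemma set_integral_nonneg:
  fixes f :: "'a \<Rightarrow> real"
  assumes "\<And>x. x \<in> A \<Longrightarrow> 0 \<le> f x"
  shows "0 \<le> (LINT x:A|M. f x)"
  unfolding set_lebesgue_integral_def
  using assms by (intro integral_nonneg_AE AE_I2) (auto simp: indicator_def)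

lemma norm_set_integral_le:
  fixes f :: "'a \<Rightarrow> 'b::{banach, second_countable_topology}"
  assumes "set_integrable M A h" "\<And>x. x \<in> A \<Longrightarrow> norm (f x) \<le> h x"
  shows "norm (LINT x:A|M. f x) \<le> (LINT x:A|M. h x)"
proof -
  have "norm (LINT x:A|M. f x) \<le> (LINT x|M. norm (indicator A x *\<^sub>R f x))"
    unfolding set_lebesgue_integral_def by (rule integral_norm_bound)
  also have "\<dots> \<le> (LINT x|M. indicator A x *\<^sub>R h x)"
  proof (rule integral_mono')
    show "integrable M (\<lambda>x. indicator A x *\<^sub>R h x)"
      using assms(1) by (simp add: set_integrable_def)
    show "norm (indicator A x *\<^sub>R f x) \<le> indicator A x *\<^sub>R h x" for x
      using assms(2)[of x] by (cases "x \<in> A") auto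
    show "0 \<le> indicator A x *\<^sub>R h x" for x
      using order_trans[OF norm_ge_zero assms(2)[of x]] by (cases "x \<in> A") auto
  qed
  finally show ?thesis
    by (simp add: set_lebesgue_integral_def)
qed

lemma set_integral_sums:
  fixes f :: "nat \<Rightarrow> 'a \<Rightarrow> 'b::{banach, second_countable_topology}"
  assumes finite_A: "A \<in> sets M" "emeasure M A < \<infinity>"
    and measurable_f: "\<And>k. f k \<in> borel_measurable M" and measurable_s: "s \<in> borel_measurable M"
    and pointwise_sums: "\<And>x. x \<in> A \<Longrightarrow> (\<lambda>k. f k x) sums s x"
    and partial_sums_bounded: "\<And>n x. x \<in> A \<Longrightarrow> norm (\<Sum>k<n. f k x) \<le> B"
  shows "(\<lambda>k. LINT x:A|M. f k x) sums (LINT x:A|M. s x)"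
proof -
  have [measurable]: "A \<in> sets M" "f k \<in> borel_measurable M" "s \<in> borel_measurable M" for k
    by fact+
  have "set_integrable M A (f k)" for k
  proof (rule set_integrable_bounded[OF finite_A measurable_f])
    fix x assume "x \<in> A"
    have "norm (f k x) = norm ((\<Sum>i<Suc k. f i x) - (\<Sum>i<k. f i x))"
      by simp
    also have "\<dots> \<le> B + B"
      by (intro order_trans[OF norm_triangle_ineq4] add_mono partial_sums_bounded \<open>x \<in> A\<close>)
    finally show "norm (f k x) \<le> B + B" .
  qed
  then have partial_sums_eq: "(\<Sum>k<n. LINT x:A|M. f k x) = (LINT x:A|M. (\<Sum>k<n. f k x))" for n
    by (intro set_integral_sum[symmetric])
  have "(\<lambda>n. LINT x|M. indicator A x *\<^sub>R (\<Sum>k<n. f k x)) \<longlonglongrightarrow> (LINT x|M. indicator A x *\<^sub>R s x)"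
  proof (rule integral_dominated_convergence[where w = "\<lambda>x. indicator A x *\<^sub>R B"])
    show "integrable M (\<lambda>x. indicator A x *\<^sub>R B)"
      using finite_A by simp
    show "AE x in M. (\<lambda>n. indicator A x *\<^sub>R (\<Sum>k<n. f k x)) \<longlonglongrightarrow> indicator A x *\<^sub>R s x"
      using pointwise_sums by (intro AE_I2) (auto simp: indicator_def sums_def)
    show "AE x in M. norm (indicator A x *\<^sub>R (\<Sum>k<n. f k x)) \<le> indicator A x *\<^sub>R B" for n
      using partial_sums_bounded by (intro AE_I2) (auto simp: indicator_def)
  qed measurable
  then show ?thesis
    unfolding sums_def partial_sums_eq by (simp add: set_lebesgue_integral_def)
qed

lemma set_integral_reflect_Icc:
  fixes f :: "real \<Rightarrow> 'b::{banach, second_countable_topology}"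
  shows "(LBINT y:{a..b}. f (c - y)) = (LBINT y:{c - b..c - a}. f y)"
  unfolding set_lebesgue_integral_def
  by (subst lborel_integral_real_affine[where c = "-1" and t = c])
     (auto intro!: Bochner_Integration.integral_cong simp: indicator_def)

lemma set_integral_Icc_combine:
  fixes f :: "real \<Rightarrow> 'b::{banach, second_countable_topology}"
  assumes "a \<le> b" "b \<le> c" "set_integrable lborel {a..c} f"
  shows "(LBINT y:{a..c}. f y) = (LBINT y:{a..b}. f y) + (LBINT y:{b..c}. f y)"
proof -
  have "AE y in lborel. y \<noteq> b"
    by (rule AE_lborel_singleton)
  then have "(LBINT y:{a..b} \<union> {b..c}. f y) = (LBINT y:{a..b}. f y) + (LBINT y:{b..c}. f y)"
    using assms by (intro set_integral_Un_AE set_integrable_subset[OF assms(3)]) (auto elim: AE_mp)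
  then show ?thesis
    using assms by (simp add: ivl_disj_un_two_touch)
qed

lemma set_integral_FTC_Icc:
  fixes f F :: "real \<Rightarrow> real"
  assumes "a \<le> b" "\<And>y. a \<le> y \<Longrightarrow> y \<le> b \<Longrightarrow> (F has_real_derivative f y) (at y)"
    and "continuous_on {a..b} f"
  shows "(LBINT y:{a..b}. f y) = F b - F a"
  unfolding set_lebesgue_integral_def
proof (rule integral_FTC_atLeastAtMost[OF \<open>a \<le> b\<close>])
  show "(F has_vector_derivative f y) (at y within {a..b})" if "a \<le> y" "y \<le> b" for y
    using assms(2)[OF that]
    by (simp add: has_real_derivative_iff_has_vector_derivative has_vector_derivative_at_within)
qed fact

lemma set_integral_powr:
  fixes A :: real
  assumes "0 < a" "a \<le> b" "A \<noteq> 0"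
  shows "(LBINT y:{a..b}. y powr (A - 1)) = (b powr A - a powr A) / A"
proof -
  have "(LBINT y:{a..b}. y powr (A - 1)) = b powr A / A - a powr A / A"
    using assms
    by (intro set_integral_FTC_Icc)
       (auto intro!: derivative_eq_intros continuous_intros simp: field_simps powr_diff)
  then show ?thesis
    by (simp add: diff_divide_distrib)
qed

section \<open>Convolution on the half line\<close>

definition causal_conv ::
    "(real \<Rightarrow> 'a) \<Rightarrow> (real \<Rightarrow> 'a) \<Rightarrow> real \<Rightarrow>
      'a::{banach, real_normed_algebra, second_countable_topology}" where
  "causal_conv f g x = (LBINT y:{0..x}. f y * g (x - y))"

lemma set_integrable_causal_conv:
  fixes f g :: "real \<Rightarrow> 'a::{banach, real_normed_algebra, second_countable_topology}"
  assumes [measurable]: "f \<in> borel_measurable borel" "g \<in> borel_measurable borel"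
    and f_le: "\<And>y. y \<in> {0..x} \<Longrightarrow> norm (f y) \<le> B" and g_le: "\<And>y. y \<in> {0..x} \<Longrightarrow> norm (g y) \<le> B"
  shows "set_integrable lborel {0..x} (\<lambda>y. f y * g (x - y))"
proof (rule set_integrable_Icc_bounded)
  fix y assume y_in: "y \<in> {0..x}"
  have "0 \<le> B"
    using f_le[OF y_in] norm_ge_zero[of "f y"] by linarith
  then show "norm (f y * g (x - y)) \<le> B * B"
    using f_le[OF y_in] g_le[of "x - y"] y_in
    by (intro order_trans[OF norm_mult_ineq mult_mono]) auto
qed measurable

lemma norm_causal_conv_le:
  fixes f g :: "real \<Rightarrow> 'a::{banach, real_normed_algebra, second_countable_topology}"
  assumes [measurable]: "f \<in> borel_measurable borel" "g \<in> borel_measurable borel"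
    and "\<And>y. y \<in> {0..x} \<Longrightarrow> norm (f y) \<le> B" "\<And>y. y \<in> {0..x} \<Longrightarrow> norm (g y) \<le> B"
  shows "norm (causal_conv f g x) \<le> causal_conv (\<lambda>y. norm (f y)) (\<lambda>y. norm (g y)) x"
  unfolding causal_conv_def
  using assms by (intro norm_set_integral_le set_integrable_causal_conv norm_mult_ineq) auto

lemma causal_conv_commute:
  fixes f g :: "real \<Rightarrow> 'a::{banach, real_normed_field, second_countable_topology}"
  shows "causal_conv f g x = causal_conv g f x"
  unfolding causal_conv_def
  using set_integral_reflect_Icc[where f = "\<lambda>y. f y * g (x - y)" and a = 0 and b = x and c = x]
  by (simp add: mult.commute)

lemma causal_conv_square_diff:
  fixes f g :: "real \<Rightarrow> 'a::{banach, real_normed_field, second_countable_topology}"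
  assumes f_bounded: "f \<in> borel_measurable borel" "\<And>y. y \<in> {0..x} \<Longrightarrow> norm (f y) \<le> B"
    and g_bounded: "g \<in> borel_measurable borel" "\<And>y. y \<in> {0..x} \<Longrightarrow> norm (g y) \<le> B"
  shows "causal_conv f f x - causal_conv g g x = causal_conv (\<lambda>y. f y - g y) (\<lambda>y. f y + g y) x"
proof -
  have integrable: "set_integrable lborel {0..x} (\<lambda>y. f y * f (x - y))"
    "set_integrable lborel {0..x} (\<lambda>y. g y * g (x - y))"
    "set_integrable lborel {0..x} (\<lambda>y. f y * g (x - y))"
    "set_integrable lborel {0..x} (\<lambda>y. g y * f (x - y))"
    using f_bounded g_bounded by (intro set_integrable_causal_conv[where B = B]; blast)+
  have "causal_conv (\<lambda>y. f y - g y) (\<lambda>y. f y + g y) x =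
      (LBINT y:{0..x}. (f y * f (x - y) - g y * g (x - y)) + (f y * g (x - y) - g y * f (x - y)))"
    by (simp add: causal_conv_def algebra_simps)
  also have "\<dots> = (causal_conv f f x - causal_conv g g x) + (causal_conv f g x - causal_conv g f x)"
    using integrable by (simp add: causal_conv_def)
  finally show ?thesis
    by (simp add: causal_conv_commute[of g f])
qed

lemma mult_le_mult_add_errors:
  fixes a b u v d e K :: real
  assumes a_le: "a \<le> u + d" and b_le: "b \<le> v + e" and "0 \<le> d" "0 \<le> e"
    and b_range: "0 \<le> b" "b \<le> K" and u_range: "0 \<le> u" "u \<le> K"
  shows "a * b \<le> u * v + (K * e + K * d)"
proof -
  have "a * b \<le> u * b + d * b"
    using mult_right_mono[OF a_le b_range(1)] by (simp add: distrib_right)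
  also have "u * b \<le> u * v + u * e"
    using mult_left_mono[OF b_le u_range(1)] by (simp add: distrib_left)
  also have "u * e \<le> K * e"
    using u_range \<open>0 \<le> e\<close> by (intro mult_right_mono)
  also have "d * b \<le> K * d"
    using mult_left_mono[OF b_range(2) \<open>0 \<le> d\<close>] by (simp add: mult.commute)
  finally show ?thesis by simp
qed

lemma causal_conv_le_add_error:
  fixes F G b :: "real \<Rightarrow> real"
  assumes [measurable]: "F \<in> borel_measurable borel" "G \<in> borel_measurable borel"
    "b \<in> borel_measurable borel"
    and F_range: "\<And>y. y \<in> {0..x} \<Longrightarrow> 0 \<le> F y \<and> F y \<le> K"
    and G_range: "\<And>y. y \<in> {0..x} \<Longrightarrow> 0 \<le> G y \<and> G y \<le> K"
    and b_range: "\<And>y. y \<in> {0..x} \<Longrightarrow> 0 \<le> b y \<and> b y \<le> K" and F_le: "\<And>y. y \<in> {0..x} \<Longrightarrow> F y \<le> G y + b y"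
  shows "causal_conv F F x \<le> causal_conv G G x + 2 * K * (LBINT y:{0..x}. b y)"
proof -
  have integrable_b: "set_integrable lborel {0..x} b" "set_integrable lborel {0..x} (\<lambda>y. b (x - y))"
    using b_range by (auto intro!: set_integrable_Icc_bounded[where B = K])
  have integrable_GG: "set_integrable lborel {0..x} (\<lambda>y. G y * G (x - y))"
    using G_range by (intro set_integrable_causal_conv[where B = K]) auto
  have "causal_conv F F x \<le> (LBINT y:{0..x}. G y * G (x - y) + (K * b (x - y) + K * b y))"
    unfolding causal_conv_def
  proof (rule set_integral_mono)
    show "set_integrable lborel {0..x} (\<lambda>y. F y * F (x - y))"
      using F_range by (intro set_integrable_causal_conv[where B = K]) auto
    show "set_integrable lborel {0..x} (\<lambda>y. G y * G (x - y) + (K * b (x - y) + K * b y))"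
      using integrable_GG integrable_b by (intro set_integral_add set_integrable_mult_right)
    show "F y * F (x - y) \<le> G y * G (x - y) + (K * b (x - y) + K * b y)" if "y \<in> {0..x}" for y
      using F_range[of "x - y"] G_range[of y] b_range[of y] b_range[of "x - y"] that
      by (intro mult_le_mult_add_errors F_le) auto
  qed
  also have "\<dots> = causal_conv G G x + 2 * K * (LBINT y:{0..x}. b y)"
    using integrable_GG integrable_b
      set_integral_reflect_Icc[where f = b and a = 0 and b = x and c = x]
    by (simp add: causal_conv_def)
  finally show ?thesis .
qed

section \<open>Averaged integral inequalities\<close>

context
  fixes b :: "real \<Rightarrow> real" and x0 X A E B :: real
  assumes x0_pos: "0 < x0" and exponent_pos: "0 < A"
    and measurable_b [measurable]: "b \<in> borel_measurable borel"
    and b_nonneg: "\<And>y. 0 \<le> y \<Longrightarrow> 0 \<le> b y"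
    and b_eq_0: "\<And>y. 0 \<le> y \<Longrightarrow> y \<le> x0 \<Longrightarrow> b y = 0"
    and b_bounded: "\<And>y. 0 \<le> y \<Longrightarrow> y \<le> X \<Longrightarrow> b y \<le> B"
    and averaged: "\<And>x. x0 < x \<Longrightarrow> x \<le> X \<Longrightarrow> x * b x \<le> A * (LBINT y:{0..x}. b y) + E"
begin

lemma gronwall_averaged_step:
  assumes "0 \<le> s" and b_le_power: "\<And>y. x0 < y \<Longrightarrow> y \<le> X \<Longrightarrow> b y \<le> s * y powr (A - 1)"
    and x_range: "x0 < x" "x \<le> X"
  shows "x * b x \<le> s * (x powr A - x0 powr A) + E"
proof -
  have "(LBINT y:{0..x}. b y) = (LBINT y:{x0..x}. b y)"
  proof -
    have "indicator {0..x} y *\<^sub>R b y = indicator {x0..x} y *\<^sub>R b y" for y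
      using b_eq_0[of y] x0_pos by (cases "y < x0") (auto simp: indicator_def)
    then show ?thesis
      by (simp only: set_lebesgue_integral_def)
  qed
  also have "\<dots> \<le> (LBINT y:{x0..x}. s * y powr (A - 1))"
  proof (rule set_integral_mono)
    show "set_integrable lborel {x0..x} b"
      using b_bounded b_nonneg x_range x0_pos
      by (intro set_integrable_Icc_bounded[where B = B]) auto
    show "set_integrable lborel {x0..x} (\<lambda>y. s * y powr (A - 1))"
      using x0_pos by (intro borel_integrable_atLeastAtMost') (auto intro!: continuous_intros)
    show "b y \<le> s * y powr (A - 1)" if "y \<in> {x0..x}" for y
      using that b_le_power[of y] b_eq_0[of x0] x_range x0_pos \<open>0 \<le> s\<close> by (cases "y = x0") auto
  qed
  also have "\<dots> = s * (x powr A - x0 powr A) / A"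
    using x0_pos exponent_pos x_range by (simp add: set_integral_powr)
  finally have "A * (LBINT y:{0..x}. b y) \<le> s * (x powr A - x0 powr A)"
    using exponent_pos by (simp add: field_simps)
  then show ?thesis
    using averaged[OF x_range] by linarith
qed

lemma bdd_above_quotient_powr: "bdd_above ((\<lambda>y. b y / y powr (A - 1)) ` {x0<..X})"
proof -
  have "b y / y powr (A - 1) \<le> B * (x0 powr (1 - A) + X powr (1 - A))"
    if y_range: "x0 < y" "y \<le> X" for y
  proof -
    have "y powr (1 - A) \<le> x0 powr (1 - A) + X powr (1 - A)"
    proof (cases "A \<ge> 1")
      case True
      then have "y powr (1 - A) \<le> x0 powr (1 - A)"
        using y_range x0_pos by (intro powr_mono2') auto
      then show ?thesis by (simp add: add_increasing2)
    next
      case False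
      then have "y powr (1 - A) \<le> X powr (1 - A)"
        using y_range x0_pos by (intro powr_mono2) auto
      then show ?thesis by (simp add: add_increasing)
    qed
    then have "b y * y powr (1 - A) \<le> B * (x0 powr (1 - A) + X powr (1 - A))"
      using b_bounded[of y] b_nonneg[of y] y_range x0_pos by (intro mult_mono) auto
    then show ?thesis
      using y_range x0_pos by (simp add: powr_diff)
  qed
  then show ?thesis
    by (intro bdd_aboveI[where M = "B * (x0 powr (1 - A) + X powr (1 - A))"]) auto
qed

lemma quotient_powr_le_improved:
  assumes "0 \<le> s" "\<And>y. x0 < y \<Longrightarrow> y \<le> X \<Longrightarrow> b y \<le> s * y powr (A - 1)"
    and gap_nonneg: "0 \<le> s * x0 powr A - E" and x_range: "x0 < x" "x \<le> X"
  shows "b x / x powr (A - 1) \<le> s - (s * x0 powr A - E) / X powr A"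
proof -
  have "b x / x powr (A - 1) = x * b x / x powr A"
    using x_range x0_pos by (simp add: powr_diff)
  also have "\<dots> \<le> (s * (x powr A - x0 powr A) + E) / x powr A"
    using assms by (intro divide_right_mono gronwall_averaged_step) auto
  also have "\<dots> = s - (s * x0 powr A - E) / x powr A"
    using x_range x0_pos by (simp add: field_simps)
  also have "\<dots> \<le> s - (s * x0 powr A - E) / X powr A"
    using gap_nonneg x_range x0_pos exponent_pos
    by (intro diff_left_mono divide_left_mono powr_mono2) auto
  finally show ?thesis .
qed

lemma gronwall_averaged:
  assumes x_range: "x0 < x" "x \<le> X"
  shows "b x \<le> E / x0 powr A * x powr (A - 1)"
proof -
  define s where "s = (SUP y\<in>{x0<..X}. b y / y powr (A - 1))"
  have quotient_le: "b y / y powr (A - 1) \<le> s" if "x0 < y" "y \<le> X" for y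
    unfolding s_def using that by (intro cSUP_upper bdd_above_quotient_powr) auto
  then have b_le_power: "b y \<le> s * y powr (A - 1)" if "x0 < y" "y \<le> X" for y
    using that x0_pos by (simp add: pos_divide_le_eq)
  have "0 \<le> b x / x powr (A - 1)"
    using b_nonneg x_range x0_pos by (intro divide_nonneg_nonneg) auto
  then have "0 \<le> s"
    using quotient_le[OF x_range] by linarith
  have "s * x0 powr A \<le> E"
  proof (rule ccontr)
    assume "\<not> s * x0 powr A \<le> E"
    then have gap_pos: "0 < s * x0 powr A - E" by simp
    have "s \<le> s - (s * x0 powr A - E) / X powr A"
      using quotient_powr_le_improved[OF \<open>0 \<le> s\<close> b_le_power less_imp_le[OF gap_pos]] x_range
      by (subst s_def) (intro cSUP_least, auto)
    moreover have "0 < (s * x0 powr A - E) / X powr A"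
      using gap_pos x_range x0_pos by auto
    ultimately show False by linarith
  qed
  then have "s * x powr (A - 1) \<le> E / x0 powr A * x powr (A - 1)"
    using x0_pos by (intro mult_right_mono) (auto simp: field_simps)
  then show ?thesis
    using b_le_power[OF x_range] by linarith
qed

end

lemma causal_conv_comparison:
  fixes F G :: "real \<Rightarrow> real"
  assumes "0 < x0" "0 < K"
    and [measurable]: "F \<in> borel_measurable borel" "G \<in> borel_measurable borel"
    and F_range: "\<And>y. 0 \<le> y \<Longrightarrow> 0 \<le> F y \<and> F y \<le> K" and G_range: "\<And>y. 0 \<le> y \<Longrightarrow> 0 \<le> G y \<and> G y \<le> K"
    and subsolution: "\<And>x. x0 < x \<Longrightarrow> x * F x \<le> causal_conv F F x"
    and supersolution: "\<And>x. x0 < x \<Longrightarrow> causal_conv G G x \<le> x * G x"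
    and initial: "\<And>y. 0 \<le> y \<Longrightarrow> y \<le> x0 \<Longrightarrow> F y \<le> G y"
    and "0 \<le> x"
  shows "F x \<le> G x"
proof (cases "x \<le> x0")
  case False
  define b where "b y = max 0 (F y - G y)" for y
  have b_bounds: "0 \<le> b y" "F y \<le> G y + b y" for y
    by (auto simp: b_def)
  have b_le_K: "b y \<le> K" if "0 \<le> y" for y
    using F_range[OF that] G_range[OF that] \<open>0 < K\<close> by (simp add: b_def)
  have [measurable]: "b \<in> borel_measurable borel"
    unfolding b_def[abs_def] by measurable
  have "b x \<le> 0 / x0 powr (2 * K) * x powr (2 * K - 1)"
  proof (rule gronwall_averaged[where X = x and B = K])
    show "b y = 0" if "0 \<le> y" "y \<le> x0" for y
      using initial[OF that] by (simp add: b_def)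
    fix y assume y_range: "x0 < y" "y \<le> x"
    have "y * F y \<le> causal_conv F F y"
      using y_range by (intro subsolution)
    also have "\<dots> \<le> causal_conv G G y + 2 * K * (LBINT u:{0..y}. b u)"
      using F_range G_range b_bounds b_le_K by (intro causal_conv_le_add_error) auto
    also have "causal_conv G G y \<le> y * G y"
      using y_range by (intro supersolution)
    finally have "y * (F y - G y) \<le> 2 * K * (LBINT u:{0..y}. b u)"
      by (simp add: right_diff_distrib)
    moreover have "0 \<le> 2 * K * (LBINT u:{0..y}. b u)"
      using \<open>0 < K\<close> b_bounds(1) by (intro mult_nonneg_nonneg set_integral_nonneg) auto
    ultimately show "y * b y \<le> 2 * K * (LBINT u:{0..y}. b u) + 0"
      by (simp add: b_def max_def)
  qed (use assms b_bounds b_le_K False in auto)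
  then show ?thesis
    using b_bounds(2)[of x] by simp
qed (use assms in auto)

section \<open>Subprobability generating functions\<close>

lemma fps_nth_mult_nonneg:
  fixes F G :: "real fps"
  assumes "\<And>k. 0 \<le> fps_nth F k" "\<And>k. 0 \<le> fps_nth G k"
  shows "0 \<le> fps_nth (F * G) k"
  unfolding fps_mult_nth using assms by (intro sum_nonneg mult_nonneg_nonneg)

lemma sum_fps_nth_mult_le:
  fixes F G :: "real fps"
  assumes "\<And>k. 0 \<le> fps_nth F k" "\<And>k. 0 \<le> fps_nth G k"
  shows "(\<Sum>k\<le>n. fps_nth (F * G) k) \<le> (\<Sum>k\<le>n. fps_nth F k) * (\<Sum>k\<le>n. fps_nth G k)"
proof -
  have "(\<Sum>k\<le>n. fps_nth (F * G) k) = (\<Sum>(i, j)\<in>{(i, j). i + j \<le> n}. fps_nth F i * fps_nth G j)"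
    by (simp add: fps_mult_nth atLeast0AtMost sum.triangle_reindex_eq)
  also have "\<dots> \<le> (\<Sum>(i, j)\<in>{..n} \<times> {..n}. fps_nth F i * fps_nth G j)"
    using assms by (intro sum_mono2) auto
  also have "\<dots> = (\<Sum>k\<le>n. fps_nth F k) * (\<Sum>k\<le>n. fps_nth G k)"
    by (simp add: sum_product sum.cartesian_product)
  finally show ?thesis .
qed

lemma sum_fps_nth_mult_le_1:
  fixes F G :: "real fps"
  assumes "\<And>k. 0 \<le> fps_nth F k" "\<And>k. 0 \<le> fps_nth G k"
    and "(\<Sum>k\<le>n. fps_nth F k) \<le> 1" "(\<Sum>k\<le>n. fps_nth G k) \<le> 1"
  shows "(\<Sum>k\<le>n. fps_nth (F * G) k) \<le> 1"
proof -
  have "(\<Sum>k\<le>n. fps_nth F k) * (\<Sum>k\<le>n. fps_nth G k) \<le> 1"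
    using assms by (intro mult_le_one sum_nonneg) auto
  then show ?thesis
    using sum_fps_nth_mult_le[OF assms(1,2), of n] by linarith
qed

definition subprob_fps :: "real fps \<Rightarrow> bool" where
  "subprob_fps F \<longleftrightarrow> (\<forall>k. 0 \<le> fps_nth F k) \<and> (\<forall>n. (\<Sum>k\<le>n. fps_nth F k) \<le> 1)"

lemma subprob_fps_nonneg: "subprob_fps F \<Longrightarrow> 0 \<le> fps_nth F k"
  by (simp add: subprob_fps_def)

lemma subprob_fps_sum_le_1: "subprob_fps F \<Longrightarrow> (\<Sum>k\<le>n. fps_nth F k) \<le> 1"
  by (simp add: subprob_fps_def)

lemma subprob_fps_sum_lessThan_le_1:
  assumes "subprob_fps F"
  shows "(\<Sum>k<n. fps_nth F k) \<le> 1"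
proof -
  have "(\<Sum>k<n. fps_nth F k) \<le> (\<Sum>k\<le>n. fps_nth F k)"
    using assms by (intro sum_mono2) (auto simp: subprob_fps_nonneg)
  then show ?thesis
    using subprob_fps_sum_le_1[OF assms, of n] by linarith
qed

lemma subprob_fps_nth_le_1:
  assumes "subprob_fps F"
  shows "fps_nth F k \<le> 1"
  using subprob_fps_sum_lessThan_le_1[OF assms, of "Suc k"] sum_nonneg[of "{..<k}" "fps_nth F"]
    subprob_fps_nonneg[OF assms] by simp

lemma subprob_fps_1: "subprob_fps 1"
  by (simp add: subprob_fps_def sum.delta)

lemma subprob_fps_mult: "subprob_fps F \<Longrightarrow> subprob_fps G \<Longrightarrow> subprob_fps (F * G)"
  by (simp add: subprob_fps_def fps_nth_mult_nonneg sum_fps_nth_mult_le_1)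

lemma subprob_fps_prod_list: "(\<And>F. F \<in> set Fs \<Longrightarrow> subprob_fps F) \<Longrightarrow> subprob_fps (prod_list Fs)"
  by (induction Fs) (auto intro: subprob_fps_1 subprob_fps_mult)

definition gen_fun :: "real fps \<Rightarrow> 'a \<Rightarrow> 'a::{real_normed_field, banach}" where
  "gen_fun F z = (\<Sum>k. fps_nth F k *\<^sub>R z ^ k)"

context
  fixes z :: "'a::{real_normed_field, banach}"
  assumes norm_z_le_1: "norm z \<le> 1"
begin

lemma norm_gen_fun_term_le:
  assumes "subprob_fps F"
  shows "norm (fps_nth F k *\<^sub>R z ^ k) \<le> fps_nth F k"
  using norm_z_le_1 power_le_one[of "norm z" k] subprob_fps_nonneg[OF assms, of k]
  by (simp add: norm_power mult_left_le)

lemma norm_gen_fun_partial_sum_le_1: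
  assumes "subprob_fps F"
  shows "norm (\<Sum>k<n. fps_nth F k *\<^sub>R z ^ k) \<le> 1"
  by (rule order_trans[OF sum_norm_le subprob_fps_sum_lessThan_le_1[OF assms]])
     (rule norm_gen_fun_term_le[OF assms])

lemma summable_norm_gen_fun:
  assumes "subprob_fps F"
  shows "summable (\<lambda>k. norm (fps_nth F k *\<^sub>R z ^ k))"
proof (rule summableI_nonneg_bounded)
  show "(\<Sum>k<n. norm (fps_nth F k *\<^sub>R z ^ k)) \<le> 1" for n
    by (rule order_trans[OF sum_mono subprob_fps_sum_lessThan_le_1[OF assms]])
       (rule norm_gen_fun_term_le[OF assms])
qed simp

lemma gen_fun_sums:
  assumes "subprob_fps F"
  shows "(\<lambda>k. fps_nth F k *\<^sub>R z ^ k) sums gen_fun F z"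
  unfolding gen_fun_def
  by (rule summable_sums[OF summable_norm_cancel[OF summable_norm_gen_fun[OF assms]]])

lemma norm_gen_fun_le_1:
  assumes "subprob_fps F"
  shows "norm (gen_fun F z) \<le> 1"
  by (rule LIMSEQ_le_const2[OF tendsto_norm[OF gen_fun_sums[OF assms, unfolded sums_def]]])
     (use norm_gen_fun_partial_sum_le_1[OF assms] in blast)

lemma gen_fun_mult:
  assumes "subprob_fps F" "subprob_fps G"
  shows "gen_fun (F * G) z = gen_fun F z * gen_fun G z"
proof (rule sums_unique2)
  show "(\<lambda>k. fps_nth (F * G) k *\<^sub>R z ^ k) sums gen_fun (F * G) z"
    by (intro gen_fun_sums subprob_fps_mult assms)
  have "fps_nth (F * G) k *\<^sub>R z ^ k =
      (\<Sum>i\<le>k. (fps_nth F i *\<^sub>R z ^ i) * (fps_nth G (k - i) *\<^sub>R z ^ (k - i)))" for k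
    unfolding fps_mult_nth scaleR_sum_left atLeast0AtMost
    by (intro sum.cong) (auto simp: power_add[symmetric])
  then show "(\<lambda>k. fps_nth (F * G) k *\<^sub>R z ^ k) sums (gen_fun F z * gen_fun G z)"
    using Cauchy_product_sums[OF summable_norm_gen_fun[OF assms(1)]
      summable_norm_gen_fun[OF assms(2)]]
    by (simp add: gen_fun_def)
qed

end

lemma gen_fun_1: "gen_fun 1 z = 1"
  unfolding gen_fun_def by (subst suminf_finite[of "{0}"]) auto

section \<open>The number of splits of an interval\<close>

text \<open>\<open>split_prob k x\<close> is the probability that exactly \<open>k\<close> splits are needed until all pieces of an
  interval of length \<open>x\<close> have length at most 1.\<close>

fun split_prob :: "nat \<Rightarrow> real \<Rightarrow> real" where
  "split_prob 0 x = (if x \<le> 1 then 1 else 0)"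
| "split_prob (Suc k) x = (if x \<le> 1 then 0 else
     (LBINT y:{0..x}. (\<Sum>i\<le>k. split_prob i y * split_prob (k - i) (x - y))) / x)"

declare split_prob.simps(2) [simp del]

definition split_fps :: "real \<Rightarrow> real fps" where
  "split_fps x = Abs_fps (\<lambda>k. split_prob k x)"

lemma fps_nth_split_fps [simp]: "fps_nth (split_fps x) k = split_prob k x"
  by (simp add: split_fps_def)

lemma fps_nth_split_fps_mult:
  "fps_nth (split_fps y * split_fps z) k = (\<Sum>i\<le>k. split_prob i y * split_prob (k - i) z)"
  by (simp add: fps_mult_nth atLeast0AtMost)

lemma split_fps_le_1: "x \<le> 1 \<Longrightarrow> split_fps x = 1"
  by (auto simp: fps_eq_iff split_prob.simps gr0_conv_Suc)

lemma split_prob_Suc: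
  "1 < x \<Longrightarrow> x * split_prob (Suc k) x = (LBINT y:{0..x}. fps_nth (split_fps y * split_fps (x - y)) k)"
  by (simp add: split_prob.simps fps_nth_split_fps_mult)

lemma measurable_set_integral_Icc:
  fixes f :: "real \<Rightarrow> real \<Rightarrow> 'b::{banach, second_countable_topology}"
  assumes [measurable]: "case_prod f \<in> borel_measurable (borel \<Otimes>\<^sub>M borel)"
  shows "(\<lambda>x. LBINT y:{0..x}. f x y) \<in> borel_measurable borel"
proof -
  have "(\<lambda>x. \<integral>y. (if 0 \<le> y \<and> y \<le> x then f x y else 0) \<partial>lborel) \<in> borel_measurable borel"
    by (rule lborel.borel_measurable_lebesgue_integral) measurable
  also have "(\<lambda>x. \<integral>y. (if 0 \<le> y \<and> y \<le> x then f x y else 0) \<partial>lborel) = (\<lambda>x. LBINT y:{0..x}. f x y)"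
    by (auto simp: set_lebesgue_integral_def indicator_def
        intro!: Bochner_Integration.integral_cong)
  finally show ?thesis .
qed

lemma measurable_split_prob [measurable]: "split_prob k \<in> borel_measurable borel"
proof (induction k rule: less_induct)
  case (less k)
  show ?case
  proof (cases k)
    case (Suc j)
    have [measurable]: "(\<lambda>(x, y). \<Sum>i\<le>j. split_prob i y * split_prob (j - i) (x - y))
        \<in> borel_measurable (borel \<Otimes>\<^sub>M borel)"
      unfolding case_prod_beta
    proof (rule borel_measurable_sum)
      fix i assume "i \<in> {..j}"
      then have [measurable]: "split_prob i \<in> borel_measurable borel"
        "split_prob (j - i) \<in> borel_measurable borel"
        using less Suc by auto
      show "(\<lambda>p. split_prob i (snd p) * split_prob (j - i) (fst p - snd p)) \<in>
          borel_measurable (borel \<Otimes>\<^sub>M borel)"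
        by measurable
    qed
    note [measurable] = measurable_set_integral_Icc[OF this]
    show ?thesis
      unfolding Suc split_prob.simps[abs_def] by measurable
  qed simp
qed

lemma split_prob_nonneg: "0 \<le> split_prob k x"
proof (induction k arbitrary: x rule: less_induct)
  case (less k)
  then show ?case
    by (cases k) (auto simp: split_prob.simps less_Suc_eq_le
        intro!: divide_nonneg_nonneg set_integral_nonneg sum_nonneg mult_nonneg_nonneg)
qed

lemma measurable_fps_nth_split_fps_mult [measurable (raw)]:
  assumes [measurable]: "f \<in> borel_measurable N" "g \<in> borel_measurable N"
  shows "(\<lambda>\<omega>. fps_nth (split_fps (f \<omega>) * split_fps (g \<omega>)) k) \<in> borel_measurable N"
  unfolding fps_nth_split_fps_mult by measurable

lemma sum_split_prob_le_1: "(\<Sum>k\<le>n. split_prob k x) \<le> 1"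
proof (induction n arbitrary: x)
  case (Suc n)
  show ?case
  proof (cases "x \<le> 1")
    case False
    let ?c = "\<lambda>y. fps_nth (split_fps y * split_fps (x - y))"
    have nonneg: "0 \<le> ?c y k" for y k
      by (intro fps_nth_mult_nonneg) (auto simp: split_prob_nonneg)
    have sum_le: "(\<Sum>k\<le>n. ?c y k) \<le> 1" for y
      using Suc by (intro sum_fps_nth_mult_le_1) (auto simp: split_prob_nonneg)
    have integrable: "set_integrable lborel {0..x} (\<lambda>y. ?c y k)" if "k \<le> n" for k
    proof (rule set_integrable_Icc_bounded[where B = 1])
      show "norm (?c y k) \<le> 1" for y
        using order_trans[OF member_le_sum[of k "{..n}" "?c y"] sum_le] nonneg that by simp
    qed measurable
    have "x * (\<Sum>k\<le>Suc n. split_prob k x) = (\<Sum>k\<le>n. LBINT y:{0..x}. ?c y k)"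
      using False by (subst sum.atMost_Suc_shift) (simp add: sum_distrib_left split_prob_Suc)
    also have "\<dots> = (LBINT y:{0..x}. (\<Sum>k\<le>n. ?c y k))"
      using integrable by (intro set_integral_sum[symmetric]) auto
    also have "\<dots> \<le> (LBINT y:{0..x}. 1)"
    proof (rule set_integral_mono)
      show "set_integrable lborel {0..x} (\<lambda>y. \<Sum>k\<le>n. ?c y k)"
        using nonneg sum_le
        by (intro set_integrable_Icc_bounded[where B = 1]) (auto simp: sum_nonneg)
      show "set_integrable lborel {0..x} (\<lambda>y. 1::real)"
        by (intro set_integrable_Icc_bounded[where B = 1]) auto
    qed (rule sum_le)
    also have "\<dots> = x * 1"
      using False by (simp add: set_integral_const)
    finally show ?thesis
      using False by (subst (asm) mult_le_cancel_left_pos) auto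
  qed (simp add: fps_nth_split_fps[symmetric] split_fps_le_1 sum.delta del: fps_nth_split_fps)
qed auto

lemma subprob_fps_split_fps: "subprob_fps (split_fps x)"
  by (simp add: subprob_fps_def split_prob_nonneg sum_split_prob_le_1)

lemma set_integrable_fps_nth_split_fps_mult:
  "set_integrable lborel {a..b} (\<lambda>y. fps_nth (split_fps y * split_fps (x - y)) k)"
  by (rule set_integrable_Icc_bounded[where B = 1])
     (auto simp: subprob_fps_nonneg subprob_fps_nth_le_1 subprob_fps_mult subprob_fps_split_fps)

context
  fixes z :: "'a::{real_normed_field, banach, second_countable_topology}"
  assumes norm_z_le_1: "norm z \<le> 1"
begin

lemma measurable_gen_fun_split_fps [measurable]:
  "(\<lambda>x. gen_fun (split_fps x) z) \<in> borel_measurable borel"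
  unfolding gen_fun_def by simp

lemma gen_fun_split_fps_convolution:
  assumes "1 < x"
  shows "of_real x * gen_fun (split_fps x) z =
    z * causal_conv (\<lambda>y. gen_fun (split_fps y) z) (\<lambda>y. gen_fun (split_fps y) z) x"
proof (rule sums_unique2)
  let ?F = "\<lambda>y. split_fps y * split_fps (x - y)"
  have subprob: "subprob_fps (?F y)" for y
    by (intro subprob_fps_mult subprob_fps_split_fps)
  have "(\<lambda>k. of_real x * (split_prob (Suc k) x *\<^sub>R z ^ Suc k)) sums
      (of_real x * gen_fun (split_fps x) z)"
    using gen_fun_sums[OF norm_z_le_1 subprob_fps_split_fps, of x] assms
    by (intro sums_mult iffD2[OF sums_Suc_iff[of "\<lambda>k. split_prob k x *\<^sub>R z ^ k"]]) simp
  then show "(\<lambda>k. z * ((x * split_prob (Suc k) x) *\<^sub>R z ^ k)) sums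
      (of_real x * gen_fun (split_fps x) z)"
    by (simp add: scaleR_conv_of_real mult_ac)
  have "(\<lambda>k. LBINT y:{0..x}. fps_nth (?F y) k *\<^sub>R z ^ k) sums (LBINT y:{0..x}. gen_fun (?F y) z)"
  proof (rule set_integral_sums)
    show "(\<lambda>y. gen_fun (?F y) z) \<in> borel_measurable lborel"
      by (simp add: gen_fun_mult[OF norm_z_le_1] subprob_fps_split_fps)
  qed (auto simp: emeasure_lborel_Icc_eq
      intro: gen_fun_sums[OF norm_z_le_1 subprob]
        norm_gen_fun_partial_sum_le_1[OF norm_z_le_1 subprob])
  moreover have "(LBINT y:{0..x}. fps_nth (?F y) k *\<^sub>R z ^ k) =
      (x * split_prob (Suc k) x) *\<^sub>R z ^ k" for k
  proof -
    have "(LBINT y:{0..x}. fps_nth (?F y) k *\<^sub>R z ^ k) =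
        (LBINT y:{0..x}. fps_nth (?F y) k) *\<^sub>R z ^ k"
      using integral_scaleR_left[OF
        set_integrable_fps_nth_split_fps_mult[unfolded set_integrable_def]]
      by (simp add: set_lebesgue_integral_def)
    then show ?thesis
      using assms by (simp add: split_prob_Suc)
  qed
  ultimately have "(\<lambda>k. (x * split_prob (Suc k) x) *\<^sub>R z ^ k) sums
      (LBINT y:{0..x}. gen_fun (?F y) z)"
    by simp
  from sums_mult[OF this, of z] show "(\<lambda>k. z * ((x * split_prob (Suc k) x) *\<^sub>R z ^ k))
      sums (z * causal_conv (\<lambda>y. gen_fun (split_fps y) z) (\<lambda>y. gen_fun (split_fps y) z) x)"
    by (simp add: causal_conv_def gen_fun_mult[OF norm_z_le_1] subprob_fps_split_fps)
qed

end

lemma split_prob_sums_1: "(\<lambda>k. split_prob k x) sums 1"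
proof -
  let ?G = "\<lambda>y. gen_fun (split_fps y) (1::real)"
  have split_prob_sums: "(\<lambda>k. split_prob k y) sums ?G y" for y
    using gen_fun_sums[of "1::real" "split_fps y"] by (simp add: subprob_fps_split_fps)
  have G_range: "0 \<le> ?G y" "?G y \<le> 1" for y
    using sums_le[OF _ sums_zero split_prob_sums[of y]] split_prob_nonneg
      norm_gen_fun_le_1[of "1::real" "split_fps y"] subprob_fps_split_fps by auto
  have "1 \<le> ?G x"
  proof (cases "0 \<le> x")
    case True
    show ?thesis
    proof (rule causal_conv_comparison[where F = "\<lambda>_. 1" and G = ?G and ?x0.0 = 1 and K = 1])
      show "causal_conv ?G ?G x \<le> x * ?G x" if "1 < x" for x
        using gen_fun_split_fps_convolution[of "1::real" x] that by simp
      show "x * 1 \<le> causal_conv (\<lambda>_. 1) (\<lambda>_. 1) x" if "1 < x" for x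
        using that by (simp add: causal_conv_def set_integral_const)
      show "?G \<in> borel_measurable borel"
        by (rule measurable_gen_fun_split_fps) simp
    qed (use True G_range in \<open>auto simp: split_fps_le_1 gen_fun_1\<close>)
  qed (simp add: split_fps_le_1 gen_fun_1)
  then have "?G x = 1"
    using G_range(2)[of x] by linarith
  then show ?thesis
    using split_prob_sums[of x] by simp
qed

section \<open>The Kakutani process as an iterated splitting step\<close>

definition max_index :: "real list \<Rightarrow> nat" where
  "max_index ls = (LEAST i. i < length ls \<and> ls ! i = Max (set ls))"

definition kakutani_step :: "real \<Rightarrow> real list \<Rightarrow> real list" where
  "kakutani_step w ls = take (max_index ls) ls @
     [w * ls ! max_index ls, (1 - w) * ls ! max_index ls] @ drop (Suc (max_index ls)) ls"

lemma kakutani_lengths_Suc: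
  "kakutani_lengths u (Suc n) = kakutani_step (u (Suc n)) (kakutani_lengths u n)"
  by (simp add: kakutani_step_def max_index_def Let_def)

declare kakutani_lengths.simps(2) [simp del]

lemma max_index:
  assumes "ls \<noteq> []"
  shows max_index_less: "max_index ls < length ls"
    and nth_max_index: "ls ! max_index ls = Max (set ls)"
proof -
  have "\<exists>i. i < length ls \<and> ls ! i = Max (set ls)"
    using Max_in[of "set ls"] assms by (auto simp: in_set_conv_nth)
  from LeastI_ex[OF this] show "max_index ls < length ls" "ls ! max_index ls = Max (set ls)"
    by (auto simp: max_index_def)
qed

lemma length_kakutani_step: "ls \<noteq> [] \<Longrightarrow> length (kakutani_step w ls) = Suc (length ls)"
  using max_index_less[of ls] by (simp add: kakutani_step_def)

lemma nth_kakutani_step: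
  assumes "ls \<noteq> []" "j \<le> length ls"
  shows "kakutani_step w ls ! j =
    (if j < max_index ls then ls ! j
     else if j = max_index ls then w * Max (set ls)
     else if j = Suc (max_index ls) then (1 - w) * Max (set ls)
     else ls ! (j - 1))"
proof -
  have "kakutani_step w ls ! j = ls ! (j - 1)" if "Suc (max_index ls) < j"
  proof -
    have "Suc (j - 2) = j - 1"
      using that by simp
    then show ?thesis
      using that max_index_less[OF assms(1)] assms(2)
      by (auto simp: kakutani_step_def nth_append nth_Cons' min_def)
  qed
  then show ?thesis
    using max_index[OF assms(1)] by (auto simp: kakutani_step_def nth_append nth_Cons' min_def)
qed

lemma kakutani_step_decompose:
  assumes "ls \<noteq> []"
  obtains as bs where "ls = as @ Max (set ls) # bs"
    "\<And>w. kakutani_step w ls = as @ [w * Max (set ls), (1 - w) * Max (set ls)] @ bs"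
  using max_index[OF assms] id_take_nth_drop[of "max_index ls" ls]
  by (intro that[of "take (max_index ls) ls" "drop (Suc (max_index ls)) ls"])
     (simp_all add: kakutani_step_def)

lemma kakutani_step_le:
  assumes "w \<in> {0..1}" "0 \<le> t" "\<And>l. l \<in> set ls \<Longrightarrow> l \<le> t" "ls \<noteq> []" "l \<in> set (kakutani_step w ls)"
  shows "l \<le> t"
proof -
  have "v * Max (set ls) \<le> t" if "v \<in> {0..1}" for v
  proof -
    have "v * Max (set ls) \<le> v * t"
      using assms(3,4) that by (intro mult_left_mono) auto
    also have "\<dots> \<le> t"
      using that \<open>0 \<le> t\<close> by (simp add: mult_left_le_one_le)
    finally show ?thesis .
  qed
  then have "w * Max (set ls) \<le> t" "(1 - w) * Max (set ls) \<le> t"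
    using assms(1) by simp_all
  then show ?thesis
    using assms(3,5) in_set_takeD[of l "max_index ls" ls] in_set_dropD[of l "Suc (max_index ls)" ls]
    by (auto simp: kakutani_step_def nth_max_index[OF assms(4)])
qed

lemma length_kakutani_lengths [simp]: "length (kakutani_lengths u n) = Suc n"
proof (induction n)
  case (Suc n)
  then have "kakutani_lengths u n \<noteq> []" by auto
  then show ?case
    by (simp add: kakutani_lengths_Suc length_kakutani_step Suc)
qed simp

lemma kakutani_lengths_nonempty [simp]: "kakutani_lengths u n \<noteq> []"
  using length_kakutani_lengths[of u n] by (metis list.size(3) nat.distinct(1))

lemma kakutani_lengths_cong:
  assumes "\<And>i. 1 \<le> i \<Longrightarrow> i \<le> n \<Longrightarrow> u i = v i"
  shows "kakutani_lengths u n = kakutani_lengths v n"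
  using assms by (induction n) (simp_all add: kakutani_lengths_Suc)

subsection \<open>Measurability\<close>

context
  fixes L :: "'a \<Rightarrow> real list" and N :: "'a measure" and n :: nat
  assumes length_L: "\<And>\<omega>. length (L \<omega>) = n"
    and measurable_nth: "\<And>j. j < n \<Longrightarrow> (\<lambda>\<omega>. L \<omega> ! j) \<in> borel_measurable N"
begin

lemma measurable_Max_set: "(\<lambda>\<omega>. Max (set (L \<omega>))) \<in> borel_measurable N"
proof -
  have "set (L \<omega>) = (\<lambda>j. L \<omega> ! j) ` {..<n}" for \<omega>
    by (auto simp: set_conv_nth length_L)
  then show ?thesis
    using measurable_nth by (simp only:) (intro borel_measurable_Max, auto)
qed

lemma measurable_max_index: "(\<lambda>\<omega>. max_index (L \<omega>)) \<in> measurable N (count_space UNIV)"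
  unfolding max_index_def length_L
proof (rule measurable_Least)
  fix i
  note [measurable] = measurable_Max_set measurable_nth[of i]
  show "(\<lambda>\<omega>. i < n \<and> L \<omega> ! i = Max (set (L \<omega>))) \<in> measurable N (count_space UNIV)"
    by (cases "i < n") simp_all
qed

lemma measurable_nth_kakutani_step:
  assumes [measurable]: "W \<in> borel_measurable N" and "0 < n" "j \<le> n"
  shows "(\<lambda>\<omega>. kakutani_step (W \<omega>) (L \<omega>) ! j) \<in> borel_measurable N"
proof -
  have nonempty: "L \<omega> \<noteq> []" for \<omega>
    using length_L[of \<omega>] \<open>0 < n\<close> by auto
  have "kakutani_step (W \<omega>) (L \<omega>) ! j =
      (if j < max_index (L \<omega>) then if j < n then L \<omega> ! j else 0
       else if j = max_index (L \<omega>) then W \<omega> * Max (set (L \<omega>))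
       else if j = Suc (max_index (L \<omega>)) then (1 - W \<omega>) * Max (set (L \<omega>))
       else L \<omega> ! (j - 1))" for \<omega>
    using max_index_less[OF nonempty[of \<omega>]] nth_kakutani_step[OF nonempty[of \<omega>], of j "W \<omega>"] \<open>j \<le> n\<close>
    by (simp add: length_L)
  moreover have [measurable]: "(\<lambda>\<omega>. L \<omega> ! (j - 1)) \<in> borel_measurable N"
    "(\<lambda>\<omega>. if j < n then L \<omega> ! j else 0) \<in> borel_measurable N"
    using \<open>0 < n\<close> \<open>j \<le> n\<close> measurable_nth[of j] by (cases "j < n"; auto intro!: measurable_nth)+
  note [measurable] = measurable_Max_set measurable_max_index
  ultimately show ?thesis
    by simp
qed

end

lemma measurable_nth_kakutani_lengths:
  assumes "\<And>i. 1 \<le> i \<Longrightarrow> i \<le> n \<Longrightarrow> U i \<in> borel_measurable N" "j \<le> n"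
  shows "(\<lambda>\<omega>. kakutani_lengths (\<lambda>i. U i \<omega>) n ! j) \<in> borel_measurable N"
  using assms
proof (induction n arbitrary: j)
  case (Suc n)
  then show ?case
    unfolding kakutani_lengths_Suc by (intro measurable_nth_kakutani_step[where n = "Suc n"]) auto
qed simp

section \<open>The number of splits that remain\<close>

text \<open>Different intervals are split independently, so the generating functions of their numbers of
  splits multiply, irrespective of the order in which the intervals are split.\<close>

definition remaining_fps :: "real \<Rightarrow> real list \<Rightarrow> real fps" where
  "remaining_fps t ls = prod_list (map (\<lambda>l. split_fps (l / t)) ls)"

definition finish_prob :: "real \<Rightarrow> nat \<Rightarrow> real list \<Rightarrow> real" where
  "finish_prob t n ls = (\<Sum>k\<le>n. fps_nth (remaining_fps t ls) k)"

lemma subprob_fps_remaining_fps: "subprob_fps (remaining_fps t ls)"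
  unfolding remaining_fps_def by (rule subprob_fps_prod_list) (auto simp: subprob_fps_split_fps)

lemma finish_prob_nonneg: "0 \<le> finish_prob t n ls"
  unfolding finish_prob_def by (intro sum_nonneg subprob_fps_nonneg subprob_fps_remaining_fps)

lemma finish_prob_le_1: "finish_prob t n ls \<le> 1"
  unfolding finish_prob_def by (rule subprob_fps_sum_le_1[OF subprob_fps_remaining_fps])

lemma finish_prob_eq_1:
  assumes "0 < t" "\<And>l. l \<in> set ls \<Longrightarrow> l \<le> t"
  shows "finish_prob t n ls = 1"
proof -
  have "remaining_fps t ls = 1"
    using assms(2) unfolding remaining_fps_def
    by (induction ls) (use \<open>0 < t\<close> in \<open>auto simp: split_fps_le_1\<close>)
  then show ?thesis
    by (simp add: finish_prob_def sum.delta)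
qed

lemma remaining_fps_decompose:
  assumes "ls \<noteq> []"
  obtains F where "subprob_fps F" "remaining_fps t ls = F * split_fps (Max (set ls) / t)"
    "\<And>w. remaining_fps t (kakutani_step w ls) =
      F * (split_fps (w * (Max (set ls) / t)) * split_fps ((1 - w) * (Max (set ls) / t)))"
proof -
  obtain as bs where ls_eq: "ls = as @ Max (set ls) # bs"
    and step_eq: "\<And>w. kakutani_step w ls = as @ [w * Max (set ls), (1 - w) * Max (set ls)] @ bs"
    using kakutani_step_decompose[OF assms] by blast
  show thesis
  proof (rule that)
    show "subprob_fps (remaining_fps t as * remaining_fps t bs)"
      by (intro subprob_fps_mult subprob_fps_remaining_fps)
    show "remaining_fps t ls =
        remaining_fps t as * remaining_fps t bs * split_fps (Max (set ls) / t)"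
      by (subst ls_eq) (simp add: remaining_fps_def mult_ac)
  qed (simp add: step_eq remaining_fps_def mult_ac)
qed

lemma remaining_fps_nth_0:
  assumes "0 < t" "ls \<noteq> []" "t < Max (set ls)"
  shows "fps_nth (remaining_fps t ls) 0 = 0"
  using remaining_fps_decompose[OF assms(2), of t] assms(1,3)
  by (metis fps_mult_nth_0 fps_nth_split_fps
      less_divide_eq_1_pos linorder_not_less mult_zero_right split_prob.simps(1))

lemma finish_prob_0:
  assumes "0 < t" "ls \<noteq> []"
  shows "finish_prob t 0 ls = (if Max (set ls) \<le> t then 1 else 0)"
proof (cases "Max (set ls) \<le> t")
  case True
  then show ?thesis
    using assms by (simp add: finish_prob_eq_1)
next
  case False
  then have "fps_nth (remaining_fps t ls) 0 = 0"
    by (intro remaining_fps_nth_0 assms) (simp only: not_le)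
  then show ?thesis
    using False by (simp only: finish_prob_def if_False) simp
qed

lemma split_prob_Suc_unit:
  assumes "1 < x"
  shows "split_prob (Suc k) x =
      (LBINT w:{0..1}. fps_nth (split_fps (w * x) * split_fps ((1 - w) * x)) k)"
proof -
  have "(LBINT y:{0..x}. fps_nth (split_fps y * split_fps (x - y)) k) =
      x * (LBINT w:{0..1}. fps_nth (split_fps (w * x) * split_fps (x - w * x)) k)"
    unfolding set_lebesgue_integral_def using assms
    by (subst lborel_integral_real_affine[where c = x and t = 0])
       (auto intro!: Bochner_Integration.integral_cong
           simp: indicator_def zero_le_mult_iff mult.commute)
  then show ?thesis
    using split_prob_Suc[OF assms, of k] assms by (simp add: left_diff_distrib)
qed

lemma set_integrable_remaining_fps_step:
  assumes "ls \<noteq> []"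
  shows "set_integrable lborel {a..b} (\<lambda>w. fps_nth (remaining_fps t (kakutani_step w ls)) k)"
proof (rule set_integrable_Icc_bounded[where B = 1])
  obtain F where step_eq: "\<And>w. remaining_fps t (kakutani_step w ls) =
      F * (split_fps (w * (Max (set ls) / t)) * split_fps ((1 - w) * (Max (set ls) / t)))"
    using remaining_fps_decompose[OF assms] by blast
  show "(\<lambda>w. fps_nth (remaining_fps t (kakutani_step w ls)) k) \<in> borel_measurable borel"
    unfolding step_eq fps_mult_nth by simp
qed (simp add: subprob_fps_nonneg subprob_fps_nth_le_1 subprob_fps_remaining_fps)

lemma remaining_fps_nth_Suc:
  assumes "0 < t" "ls \<noteq> []" "t < Max (set ls)"
  shows "fps_nth (remaining_fps t ls) (Suc n) =
    (LBINT w:{0..1}. fps_nth (remaining_fps t (kakutani_step w ls)) n)"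
proof -
  define x where "x = Max (set ls) / t"
  obtain F where remaining_eq: "remaining_fps t ls = F * split_fps x"
    and step_eq: "\<And>w. remaining_fps t (kakutani_step w ls) =
        F * (split_fps (w * x) * split_fps ((1 - w) * x))"
    unfolding x_def using remaining_fps_decompose[OF assms(2)] by blast
  let ?G = "\<lambda>w. split_fps (w * x) * split_fps ((1 - w) * x)"
  have "1 < x"
    using assms by (simp add: x_def)
  have integrable_G: "set_integrable lborel {0..1} (\<lambda>w. fps_nth (?G w) k)" for k
    by (rule set_integrable_Icc_bounded[where B = 1], measurable)
       (simp add: subprob_fps_nonneg subprob_fps_nth_le_1 subprob_fps_mult subprob_fps_split_fps)
  have "fps_nth (remaining_fps t ls) (Suc n) = (\<Sum>i\<le>n. fps_nth F i * split_prob (Suc (n - i)) x)"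
    using \<open>1 < x\<close> by (simp add: remaining_eq fps_mult_nth atLeast0AtMost Suc_diff_le)
  also have "\<dots> = (\<Sum>i\<le>n. LBINT w:{0..1}. fps_nth F i * fps_nth (?G w) (n - i))"
    using \<open>1 < x\<close> by (simp add: split_prob_Suc_unit)
  also have "\<dots> = (LBINT w:{0..1}. \<Sum>i\<le>n. fps_nth F i * fps_nth (?G w) (n - i))"
    by (intro set_integral_sum[symmetric] set_integrable_mult_right integrable_G)
  also have "\<dots> = (LBINT w:{0..1}. fps_nth (remaining_fps t (kakutani_step w ls)) n)"
    unfolding step_eq by (subst fps_mult_nth[of F]) (simp add: atLeast0AtMost)
  finally show ?thesis .
qed

lemma finish_prob_Suc:
  assumes "0 < t" "ls \<noteq> []"
  shows "finish_prob t (Suc n) ls = (LBINT w:{0..1}. finish_prob t n (kakutani_step w ls))"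
proof (cases "Max (set ls) \<le> t")
  case True
  then have all_le_t: "l \<le> t" if "l \<in> set ls" for l
    using that by (metis List.finite_set Max_ge order_trans)
  have "finish_prob t n (kakutani_step w ls) = 1" if "w \<in> {0..1}" for w
    using kakutani_step_le[OF that _ all_le_t assms(2)] assms(1) by (intro finish_prob_eq_1) auto
  then have "(LBINT w:{0..1}. finish_prob t n (kakutani_step w ls)) =
      (LBINT w:{0..1::real}. (1::real))"
    by (intro set_lebesgue_integral_cong) auto
  then show ?thesis
    using finish_prob_eq_1[OF assms(1) all_le_t] by (simp add: set_integral_const)
next
  case False
  then have Max_gt_t: "t < Max (set ls)" by (simp only: not_le)
  have "finish_prob t (Suc n) ls = (\<Sum>k\<le>n. fps_nth (remaining_fps t ls) (Suc k))"
    unfolding finish_prob_def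
    by (simp add: sum.atMost_Suc_shift remaining_fps_nth_0[OF assms Max_gt_t] del: sum.atMost_Suc)
  also have "\<dots> = (LBINT w:{0..1}. finish_prob t n (kakutani_step w ls))"
    unfolding finish_prob_def remaining_fps_nth_Suc[OF assms Max_gt_t]
    by (intro set_integral_sum[symmetric] set_integrable_remaining_fps_step assms)
  finally show ?thesis .
qed

lemma measurable_prod_split_fps:
  fixes m :: nat
  assumes "\<And>j. j < m \<Longrightarrow> h j \<in> borel_measurable N"
  shows "(\<lambda>\<omega>. fps_nth (\<Prod>j<m. split_fps (h j \<omega>)) k) \<in> borel_measurable N"
  using assms
proof (induction m arbitrary: k)
  case (Suc m)
  have [measurable]: "(\<lambda>\<omega>. fps_nth (\<Prod>j<m. split_fps (h j \<omega>)) k) \<in> borel_measurable N"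
    "h m \<in> borel_measurable N" for k
    using Suc by auto
  show ?case
    unfolding prod.lessThan_Suc fps_mult_nth[of "prod _ _"] fps_nth_split_fps by measurable
qed simp

lemma measurable_finish_prob_kakutani_lengths:
  assumes "\<And>i. 1 \<le> i \<Longrightarrow> i \<le> n \<Longrightarrow> U i \<in> borel_measurable N"
  shows "(\<lambda>\<omega>. finish_prob t k (kakutani_lengths (\<lambda>i. U i \<omega>) n)) \<in> borel_measurable N"
proof -
  have "remaining_fps t (kakutani_lengths (\<lambda>i. U i \<omega>) n) =
      (\<Prod>j<Suc n. split_fps (kakutani_lengths (\<lambda>i. U i \<omega>) n ! j / t))" for \<omega>
    unfolding remaining_fps_def prod.list_conv_set_nth by (simp add: lessThan_atLeast0)
  moreover have "(\<lambda>\<omega>. kakutani_lengths (\<lambda>i. U i \<omega>) n ! j / t) \<in> borel_measurable N"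
    if "j < Suc n" for j
    using that assms by (intro borel_measurable_divide measurable_nth_kakutani_lengths) auto
  ultimately show ?thesis
    unfolding finish_prob_def
    by (simp only:) (intro borel_measurable_sum measurable_prod_split_fps, auto)
qed

section \<open>The law of the largest interval\<close>

abbreviation uniform01 :: "real measure" where
  "uniform01 \<equiv> density lborel (indicator {0..1})"

lemma prob_space_uniform01: "prob_space uniform01"
  by (rule prob_spaceI) (simp add: emeasure_density nn_integral_indicator)

lemma integral_uniform01:
  fixes f :: "real \<Rightarrow> real"
  assumes "f \<in> borel_measurable borel"
  shows "integral\<^sup>L uniform01 f = (LBINT w:{0..1}. f w)"
proof -
  have "uniform01 = density lborel (\<lambda>x. ennreal (indicator {0..1} x))"
    by (simp add: ennreal_indicator)
  then show ?thesis
    using assms by (simp add: integral_density set_lebesgue_integral_def)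
qed

lemma integral_finish_prob_last_split:
  assumes "0 < t"
  shows "(\<integral>w. finish_prob t m (kakutani_lengths (u(Suc k := w)) (Suc k)) \<partial>uniform01) =
    finish_prob t (Suc m) (kakutani_lengths u k)"
proof -
  have unchanged: "kakutani_lengths (u(Suc k := w)) k = kakutani_lengths u k" for w
    by (rule kakutani_lengths_cong) auto
  have "(\<integral>w. finish_prob t m (kakutani_lengths (u(Suc k := w)) (Suc k)) \<partial>uniform01) =
      (LBINT w:{0..1}. finish_prob t m (kakutani_lengths (u(Suc k := w)) (Suc k)))"
    by (intro integral_uniform01
      measurable_finish_prob_kakutani_lengths[where U = "\<lambda>i w. (u(Suc k := w)) i"]) auto
  also have "\<dots> = (LBINT w:{0..1}. finish_prob t m (kakutani_step w (kakutani_lengths u k)))"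
    by (simp add: kakutani_lengths_Suc unchanged)
  also have "\<dots> = finish_prob t (Suc m) (kakutani_lengths u k)"
    using assms by (simp add: finish_prob_Suc)
  finally show ?thesis .
qed

lemma integral_finish_prob_kakutani_lengths:
  assumes "0 < t"
  shows "(\<integral>u. finish_prob t m (kakutani_lengths u k) \<partial>(\<Pi>\<^sub>M i\<in>{1..k}. uniform01)) =
      finish_prob t (m + k) [1]"
proof (induction k arbitrary: m)
  case 0
  interpret prob_space "\<Pi>\<^sub>M i\<in>{}::nat set. uniform01"
    by (intro prob_space_PiM prob_space_uniform01)
  show ?case using prob_space by simp
next
  case (Suc k)
  interpret product_prob_space "\<lambda>_. uniform01" "{1..k}"
    unfolding product_prob_space_def product_prob_space_axioms_def product_sigma_finite_def
    by (auto intro!: prob_space_uniform01 prob_space_imp_sigma_finite)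
  interpret Q: prob_space "\<Pi>\<^sub>M i\<in>insert (Suc k) {1..k}. uniform01"
    by (intro prob_space_PiM prob_space_uniform01)
  have insert: "{1..Suc k} = insert (Suc k) {1..k}" by auto
  have "integrable (\<Pi>\<^sub>M i\<in>insert (Suc k) {1..k}. uniform01)
      (\<lambda>u. finish_prob t m (kakutani_lengths u (Suc k)))"
  proof (rule Q.integrable_const_bound[where B = 1])
    have "(\<lambda>u. u i) \<in> measurable (\<Pi>\<^sub>M i\<in>insert (Suc k) {1..k}. uniform01) uniform01"
      if "1 \<le> i" "i \<le> Suc k" for i
      using that by (intro measurable_component_singleton) auto
    then show "(\<lambda>u. finish_prob t m (kakutani_lengths u (Suc k))) \<in>
        borel_measurable (\<Pi>\<^sub>M i\<in>insert (Suc k) {1..k}. uniform01)"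
      by (intro measurable_finish_prob_kakutani_lengths[where U = "\<lambda>i u. u i"]) simp
  qed (auto simp: finish_prob_nonneg finish_prob_le_1)
  then have "(\<integral>u. finish_prob t m (kakutani_lengths u (Suc k)) \<partial>(\<Pi>\<^sub>M i\<in>{1..Suc k}. uniform01)) =
      (\<integral>u. (\<integral>w. finish_prob t m (kakutani_lengths (u(Suc k := w)) (Suc k)) \<partial>uniform01)
        \<partial>(\<Pi>\<^sub>M i\<in>{1..k}. uniform01))"
    unfolding insert by (intro product_integral_insert) auto
  also have "\<dots> = (\<integral>u. finish_prob t (Suc m) (kakutani_lengths u k) \<partial>(\<Pi>\<^sub>M i\<in>{1..k}. uniform01))"
    by (simp only: integral_finish_prob_last_split[OF assms])
  finally show ?case
    using Suc.IH[of "Suc m"] by simp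
qed

locale kakutani_process = prob_space M for M :: "'a measure" +
  fixes U :: "nat \<Rightarrow> 'a \<Rightarrow> real"
  assumes indep_splits: "indep_vars (\<lambda>_. borel) U {1..}"
    and distributed_split: "1 \<le> i \<Longrightarrow> distributed M lborel (U i) (indicator {0..1})"
begin

definition max_length :: "nat \<Rightarrow> 'a \<Rightarrow> real" where
  "max_length n \<omega> = kakutani_max (\<lambda>i. U i \<omega>) n"

lemma measurable_split: "1 \<le> i \<Longrightarrow> U i \<in> borel_measurable M"
  using distributed_measurable[OF distributed_split] by simp

lemma measurable_max_length [measurable]: "max_length n \<in> borel_measurable M"
  unfolding max_length_def[abs_def] kakutani_max_def
  by (rule measurable_Max_set[where n = "Suc n"])
     (auto intro!: measurable_nth_kakutani_lengths measurable_split)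

lemma distr_splits:
  assumes "1 \<le> n"
  shows "distr M (\<Pi>\<^sub>M i\<in>{1..n}. borel) (\<lambda>\<omega>. \<lambda>i\<in>{1..n}. U i \<omega>) = (\<Pi>\<^sub>M i\<in>{1..n}. uniform01)"
proof -
  have distr_split: "distr M borel (U i) = uniform01" if "1 \<le> i" for i
    using distributed_distr_eq_density[OF distributed_split[OF that]]
      distr_cong[of M M borel lborel "U i" "U i"] by simp
  have "indep_vars (\<lambda>_. borel) U {1..n}"
    using indep_splits by (rule indep_vars_subset) auto
  then have "distr M (\<Pi>\<^sub>M i\<in>{1..n}. borel) (\<lambda>\<omega>. \<lambda>i\<in>{1..n}. U i \<omega>) =
      (\<Pi>\<^sub>M i\<in>{1..n}. distr M borel (U i))"
    using assms measurable_split by (subst (asm) indep_vars_iff_distr_eq_PiM') auto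
  also have "\<dots> = (\<Pi>\<^sub>M i\<in>{1..n}. uniform01)"
    by (intro PiM_cong distr_split) auto
  finally show ?thesis .
qed

lemma prob_max_length_le:
  assumes "0 < t" "1 \<le> n"
  shows "prob {\<omega> \<in> space M. max_length n \<omega> \<le> t} = (\<Sum>k\<le>n. split_prob k (1 / t))"
proof -
  let ?P = "\<Pi>\<^sub>M i\<in>{1..n}. (borel :: real measure)"
  let ?V = "\<lambda>\<omega>. \<lambda>i\<in>{1..n}. U i \<omega>"
  have "prob {\<omega> \<in> space M. max_length n \<omega> \<le> t} =
      (\<integral>\<omega>. indicator {\<omega> \<in> space M. max_length n \<omega> \<le> t} \<omega> \<partial>M)"
    by (simp add: Int_def conj_commute conj_left_commute)
  also have "\<dots> = (\<integral>\<omega>. finish_prob t 0 (kakutani_lengths (?V \<omega>) n) \<partial>M)"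
  proof (rule Bochner_Integration.integral_cong[OF refl])
    fix \<omega> assume "\<omega> \<in> space M"
    have "kakutani_lengths (?V \<omega>) n = kakutani_lengths (\<lambda>i. U i \<omega>) n"
      by (rule kakutani_lengths_cong) simp
    then show "indicator {\<omega> \<in> space M. max_length n \<omega> \<le> t} \<omega> =
        finish_prob t 0 (kakutani_lengths (?V \<omega>) n)"
      using assms \<open>\<omega> \<in> space M\<close> by (simp add: finish_prob_0 max_length_def kakutani_max_def)
  qed
  also have "\<dots> = (\<integral>u. finish_prob t 0 (kakutani_lengths u n) \<partial>(distr M ?P ?V))"
  proof (rule integral_distr[symmetric])
    show "?V \<in> measurable M ?P"
      using measurable_split by (intro measurable_restrict) auto
    show "(\<lambda>u. finish_prob t 0 (kakutani_lengths u n)) \<in> borel_measurable ?P"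
      by (rule measurable_finish_prob_kakutani_lengths[where U = "\<lambda>i u. u i"])
         (auto intro: measurable_component_singleton)
  qed
  also have "\<dots> = finish_prob t n [1]"
    unfolding distr_splits[OF assms(2)]
    using integral_finish_prob_kakutani_lengths[OF assms(1), where m = 0] by simp
  also have "\<dots> = (\<Sum>k\<le>n. split_prob k (1 / t))"
    by (simp add: finish_prob_def remaining_fps_def)
  finally show ?thesis .
qed

end

section \<open>Mean and variance of the number of pieces\<close>

text \<open>The mean (after subtracting \<open>2 * x\<close>) and the variance of the number of final pieces of an
  interval of length \<open>x\<close> that is split until all pieces have length at most 1.\<close>

definition var_rate :: real where
  "var_rate = 8 * ln 2 - 5"

definition transient_var :: "real \<Rightarrow> real" where
  "transient_var x = 2 + 2 * x - 4 * x\<^sup>2 + 8 * x * ln x"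

definition dev_mean :: "real \<Rightarrow> real" where
  "dev_mean x = (if x \<le> 1 then 1 - 2 * x else 0)"

definition dev_var :: "real \<Rightarrow> real" where
  "dev_var x = (if x \<le> 1 then 0 else if x \<le> 2 then transient_var x else var_rate * x)"

lemma measurable_dev_mean [measurable]: "dev_mean \<in> borel_measurable borel"
  unfolding dev_mean_def[abs_def] by measurable

lemma measurable_dev_var [measurable]: "dev_var \<in> borel_measurable borel"
  unfolding dev_var_def[abs_def] transient_var_def by measurable

lemma transient_var_ge:
  assumes "1 \<le> x" "x \<le> 2"
  shows "2 * (x - 1) / (x + 1) \<le> transient_var x"
proof -
  have "0 \<le> (x - 1) * (2 * (2 * x - 1) * (2 - x)) / (x + 1)"
    using assms by (intro divide_nonneg_nonneg mult_nonneg_nonneg) auto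
  also have "\<dots> = 2 + 2 * x - 4 * x\<^sup>2 + 8 * x * (2 * (x - 1) / (x + 1)) - 2 * (x - 1) / (x + 1)"
    using assms by (simp add: divide_simps) (simp add: power2_eq_square algebra_simps)
  finally have "2 * (x - 1) / (x + 1) \<le> 2 + 2 * x - 4 * x\<^sup>2 + 8 * x * (2 * (x - 1) / (x + 1))"
    by simp
  also have "8 * x * (2 * (x - 1) / (x + 1)) \<le> 8 * x * ln x"
  proof (rule mult_left_mono)
    show "2 * (x - 1) / (x + 1) \<le> ln x"
      using ln_inverse_approx_ge[of 1 x] assms by (cases "x = 1") (auto simp: add.commute)
  qed (use assms in auto)
  finally show ?thesis by (simp add: transient_var_def)
qed

lemma transient_var_le:
  assumes "1 \<le> x" "x \<le> 2"
  shows "transient_var x \<le> 6"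
proof -
  have "8 * x * ln x \<le> 8 * x * (x - 1)"
    using assms ln_le_minus_one[of x] by (intro mult_left_mono) auto
  then have "transient_var x \<le> 6 - 2 * (2 - x) * (2 * x + 1)"
    by (simp add: transient_var_def power2_eq_square algebra_simps)
  moreover have "0 \<le> 2 * (2 - x) * (2 * x + 1)"
    using assms by (intro mult_nonneg_nonneg) auto
  ultimately show ?thesis by linarith
qed

lemma transient_var_2: "transient_var 2 = 2 * var_rate"
  by (simp add: transient_var_def var_rate_def)

lemma var_rate_bounds: "1 / 3 \<le> var_rate" "var_rate \<le> 3"
  using transient_var_ge[of 2] transient_var_le[of 2] by (simp_all add: transient_var_2)

lemma var_rate_pos: "0 < var_rate"
  using var_rate_bounds by simp

lemma dev_var_nonneg: "0 \<le> dev_var x"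
proof (cases "1 < x \<and> x \<le> 2")
  case True
  then have "0 \<le> 2 * (x - 1) / (x + 1)" by auto
  also have "\<dots> \<le> transient_var x"
    using True by (intro transient_var_ge) auto
  finally show ?thesis
    using True by (simp add: dev_var_def)
next
  case False
  then show ?thesis using var_rate_pos by (auto simp: dev_var_def)
qed

lemma dev_var_ge:
  assumes "3 / 2 \<le> x" "x \<le> 2"
  shows "2 / 5 \<le> dev_var x"
proof -
  have "2 / 5 \<le> 2 * (x - 1) / (x + 1)"
    using assms by (simp add: field_simps)
  also have "\<dots> \<le> transient_var x"
    using assms by (intro transient_var_ge) auto
  finally show ?thesis
    using assms by (simp add: dev_var_def)
qed

lemma abs_dev_var_diff_linear_le:
  assumes "0 \<le> x"
  shows "\<bar>dev_var x - var_rate * x\<bar> \<le> 6"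
proof (cases "x \<le> 2")
  case True
  have "0 \<le> var_rate * x" "var_rate * x \<le> 3 * 2"
    using assms True var_rate_bounds by (intro mult_nonneg_nonneg mult_mono; simp)+
  moreover have "dev_var x \<le> 6"
    using True transient_var_le[of x] by (simp add: dev_var_def)
  ultimately show ?thesis
    using dev_var_nonneg[of x] by linarith
qed (simp add: dev_var_def)

lemma abs_dev_mean_le: "0 \<le> x \<Longrightarrow> \<bar>dev_mean x\<bar> \<le> 1"
  by (auto simp: dev_mean_def)

lemma set_integrable_dev_mean:
  "set_integrable lborel {0..x} dev_mean" "set_integrable lborel {0..x} (\<lambda>y. dev_mean (x - y))"
  "set_integrable lborel {0..x} (\<lambda>y. (dev_mean y)\<^sup>2)"
  "set_integrable lborel {0..x} (\<lambda>y. (dev_mean (x - y))\<^sup>2)"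
  "set_integrable lborel {0..x} (\<lambda>y. dev_mean y * dev_mean (x - y))"
  by (rule set_integrable_Icc_bounded[where B = 1];
      auto simp: abs_mult abs_square_le_1 abs_dev_mean_le intro!: mult_le_one)+

lemma dev_var_le: "dev_var x \<le> 6 + 3 * \<bar>x\<bar>"
proof (cases "0 \<le> x")
  case True
  then have "var_rate * x \<le> 3 * x"
    using var_rate_bounds by (intro mult_right_mono) auto
  then show ?thesis
    using abs_dev_var_diff_linear_le[OF True] True by linarith
qed (simp add: dev_var_def)

lemma set_integrable_dev_var:
  "set_integrable lborel {a..b} dev_var" "set_integrable lborel {a..b} (\<lambda>y. dev_var (x - y))"
proof -
  have "norm (dev_var y) \<le> 6 + 3 * (\<bar>a\<bar> + \<bar>b\<bar>)" if "y \<in> {a..b}" for y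
    using that dev_var_le[of y] dev_var_nonneg[of y] by auto
  then show "set_integrable lborel {a..b} dev_var"
    by (intro set_integrable_Icc_bounded) auto
  have "norm (dev_var (x - y)) \<le> 6 + 3 * (\<bar>x\<bar> + (\<bar>a\<bar> + \<bar>b\<bar>))" if "y \<in> {a..b}" for y
  proof -
    have "\<bar>x - y\<bar> \<le> \<bar>x\<bar> + (\<bar>a\<bar> + \<bar>b\<bar>)"
      using that by auto
    then show ?thesis
      using dev_var_le[of "x - y"] dev_var_nonneg[of "x - y"] by simp
  qed
  then show "set_integrable lborel {a..b} (\<lambda>y. dev_var (x - y))"
    by (intro set_integrable_Icc_bounded) auto
qed

subsection \<open>The moment recursions\<close>

lemma integral_dev_mean:
  assumes "1 < x"
  shows "(LBINT y:{0..x}. dev_mean y) = 0"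
proof -
  have "(LBINT y:{0..x}. dev_mean y) = (LBINT y:{0..1}. 1 - 2 * y)"
    unfolding set_lebesgue_integral_def using assms
    by (intro Bochner_Integration.integral_cong) (auto simp: indicator_def dev_mean_def)
  also have "\<dots> = (1 - 1\<^sup>2) - (0 - 0\<^sup>2)"
    by (rule set_integral_FTC_Icc) (auto intro!: derivative_eq_intros continuous_intros)
  finally show ?thesis by simp
qed

lemma integral_dev_mean_square:
  assumes "1 < x"
  shows "(LBINT y:{0..x}. (dev_mean y)\<^sup>2) = 1 / 3"
proof -
  have "(LBINT y:{0..x}. (dev_mean y)\<^sup>2) = (LBINT y:{0..1}. (1 - 2 * y)\<^sup>2)"
    unfolding set_lebesgue_integral_def using assms
    by (intro Bochner_Integration.integral_cong) (auto simp: indicator_def dev_mean_def)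
  also have "\<dots> = (1 - 2 * 1\<^sup>2 + 4 * 1 ^ 3 / 3) - (0 - 2 * 0\<^sup>2 + 4 * 0 ^ 3 / 3)"
    by (rule set_integral_FTC_Icc)
       (auto intro!: derivative_eq_intros continuous_intros simp: power2_eq_square algebra_simps)
  finally show ?thesis by simp
qed

lemma causal_conv_dev_mean:
  assumes "1 < x"
  shows "causal_conv dev_mean dev_mean x =
    (if x \<le> 2 then ((1 - 2 * x) + 2 * x - 4 / 3) -
        ((1 - 2 * x) * (x - 1) + 2 * x * (x - 1)\<^sup>2 - 4 * (x - 1) ^ 3 / 3) else 0)"
proof -
  have cutoff: "causal_conv dev_mean dev_mean x =
      (LBINT y:{x - 1..1}. (1 - 2 * y) * (1 - 2 * (x - y)))"
    unfolding causal_conv_def set_lebesgue_integral_def using assms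
    by (intro Bochner_Integration.integral_cong) (auto simp: indicator_def dev_mean_def)
  show ?thesis
  proof (cases "x \<le> 2")
    case True
    have "(LBINT y:{x - 1..1}. (1 - 2 * y) * (1 - 2 * (x - y))) =
        ((1 - 2 * x) * 1 + 2 * x * 1\<^sup>2 - 4 * 1 ^ 3 / 3) -
        ((1 - 2 * x) * (x - 1) + 2 * x * (x - 1)\<^sup>2 - 4 * (x - 1) ^ 3 / 3)"
      using True
      by (intro set_integral_FTC_Icc)
         (auto intro!: derivative_eq_intros continuous_intros simp: power2_eq_square algebra_simps)
    then show ?thesis using True cutoff by simp
  next
    case False
    then show ?thesis using cutoff by (simp add: set_lebesgue_integral_def)
  qed
qed

lemma integral_dev_var_le_2:
  assumes "1 \<le> x" "x \<le> 2"
  shows "(LBINT y:{0..x}. dev_var y) = 2 * x - x\<^sup>2 - 4 * x ^ 3 / 3 + 4 * x\<^sup>2 * ln x + 1 / 3"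
proof -
  have "(LBINT y:{0..x}. dev_var y) = (LBINT y:{1..x}. transient_var y)"
    unfolding set_lebesgue_integral_def using assms
    by (intro Bochner_Integration.integral_cong)
       (auto simp: indicator_def dev_var_def transient_var_def)
  also have "\<dots> = (2 * x - x\<^sup>2 - 4 * x ^ 3 / 3 + 4 * x\<^sup>2 * ln x) -
      (2 * 1 - 1\<^sup>2 - 4 * 1 ^ 3 / 3 + 4 * 1\<^sup>2 * ln 1)"
    unfolding transient_var_def using assms
    by (intro set_integral_FTC_Icc)
       (auto intro!: derivative_eq_intros continuous_intros simp: power2_eq_square field_simps)
  finally show ?thesis by simp
qed

lemma integral_dev_var_ge_2:
  assumes "2 \<le> x"
  shows "(LBINT y:{0..x}. dev_var y) = 16 * ln 2 - 31 / 3 + var_rate * (x\<^sup>2 - 4) / 2"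
proof -
  have "(LBINT y:{0..x}. dev_var y) = (LBINT y:{0..2}. dev_var y) + (LBINT y:{2..x}. dev_var y)"
    using assms by (intro set_integral_Icc_combine set_integrable_dev_var) auto
  also have "(LBINT y:{2..x}. dev_var y) = (LBINT y:{2..x}. var_rate * y)"
    by (rule set_lebesgue_integral_cong) (auto simp: dev_var_def transient_var_2)
  also have "\<dots> = var_rate * x\<^sup>2 / 2 - var_rate * 2\<^sup>2 / 2"
    using assms by (intro set_integral_FTC_Icc)
       (auto intro!: derivative_eq_intros continuous_intros simp: power2_eq_square field_simps)
  finally show ?thesis
    by (simp add: integral_dev_var_le_2 field_simps)
qed

lemma dev_var_recursion:
  assumes "1 < x"
  shows "x * dev_var x =
    2 * (LBINT y:{0..x}. dev_var y) + 2 / 3 + 2 * causal_conv dev_mean dev_mean x"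
proof (cases "x \<le> 2")
  case True
  then have dev_var_x: "dev_var x = transient_var x"
    using assms by (simp add: dev_var_def)
  show ?thesis
    using assms True
    by (simp add: dev_var_x causal_conv_dev_mean integral_dev_var_le_2 transient_var_def
        field_simps power2_eq_square power3_eq_cube)
next
  case False
  then have dev_var_x: "dev_var x = var_rate * x"
    by (simp add: dev_var_def)
  show ?thesis
    using assms False
    by (simp add: dev_var_x causal_conv_dev_mean integral_dev_var_ge_2 var_rate_def
        field_simps power2_eq_square)
qed

definition mean_excess :: "real \<Rightarrow> real \<Rightarrow> real" where
  "mean_excess x y = dev_mean y + dev_mean (x - y)"

definition var_excess :: "real \<Rightarrow> real \<Rightarrow> real" where
  "var_excess x y = dev_var y + dev_var (x - y) - dev_var x"

lemma measurable_excess [measurable]: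
  "mean_excess x \<in> borel_measurable borel" "var_excess x \<in> borel_measurable borel"
  unfolding mean_excess_def[abs_def] var_excess_def[abs_def] by measurable

lemma abs_mean_excess_le:
  assumes "y \<in> {0..x}"
  shows "\<bar>mean_excess x y\<bar> \<le> 2"
  using assms abs_dev_mean_le[of y] abs_dev_mean_le[of "x - y"] by (simp add: mean_excess_def)

lemma abs_var_excess_le:
  assumes "y \<in> {0..x}"
  shows "\<bar>var_excess x y\<bar> \<le> 18"
proof -
  have "var_excess x y = (dev_var y - var_rate * y) + (dev_var (x - y) - var_rate * (x - y)) -
      (dev_var x - var_rate * x)"
    by (simp add: var_excess_def algebra_simps)
  then show ?thesis
    using abs_dev_var_diff_linear_le[of y] abs_dev_var_diff_linear_le[of "x - y"]
      abs_dev_var_diff_linear_le[of x] assms by simp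
qed

lemma excess_eq_0:
  assumes "2 < y" "2 < x - y"
  shows "mean_excess x y = 0" "var_excess x y = 0"
  using assms
  by (simp_all add: mean_excess_def var_excess_def dev_mean_def dev_var_def algebra_simps)

lemma integral_mean_excess:
  assumes "1 < x"
  shows "(LBINT y:{0..x}. mean_excess x y) = 0"
  unfolding mean_excess_def
  using set_integrable_dev_mean[of x] integral_dev_mean[OF assms]
    set_integral_reflect_Icc[where f = dev_mean and c = x and a = 0 and b = x] by simp

lemma integral_var_excess:
  assumes "1 < x"
  shows "(LBINT y:{0..x}. var_excess x y + (mean_excess x y)\<^sup>2) = 0"
proof -
  have "(LBINT y:{0..x}. var_excess x y + (mean_excess x y)\<^sup>2) =
     (LBINT y:{0..x}. (dev_var y + dev_var (x - y) - dev_var x) +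
        ((dev_mean y)\<^sup>2 + (dev_mean (x - y))\<^sup>2 + 2 * (dev_mean y * dev_mean (x - y))))"
    by (simp add: var_excess_def mean_excess_def power2_sum mult.assoc)
  also have "\<dots> =
      ((LBINT y:{0..x}. dev_var y) + (LBINT y:{0..x}. dev_var (x - y)) -
          (LBINT y:{0..x}. dev_var x)) +
      ((LBINT y:{0..x}. (dev_mean y)\<^sup>2) + (LBINT y:{0..x}. (dev_mean (x - y))\<^sup>2) +
        2 * causal_conv dev_mean dev_mean x)"
    unfolding causal_conv_def
    using set_integrable_dev_mean[of x] set_integrable_dev_var
      set_integrable_Icc_bounded[of "\<lambda>_. dev_var x" 0 x "\<bar>dev_var x\<bar>"]
    by simp
  also have "\<dots> = 2 * (LBINT y:{0..x}. dev_var y) - x * dev_var x + 2 / 3 +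
      2 * causal_conv dev_mean dev_mean x"
    using set_integral_reflect_Icc[where f = dev_var and c = x and a = 0 and b = x]
      set_integral_reflect_Icc[where f = "\<lambda>y. (dev_mean y)\<^sup>2" and c = x and a = 0 and b = x]
      integral_dev_mean_square[OF assms] assms
    by (simp add: set_integral_const)
  finally show ?thesis
    using dev_var_recursion[OF assms] by simp
qed

section \<open>The Gaussian approximation of the convolution equation\<close>

lemma norm_exp_diff_quadratic_le:
  fixes z :: complex
  shows "norm (exp z - (1 + z + z\<^sup>2 / 2)) \<le> exp \<bar>Re z\<bar> * norm z ^ 3"
proof -
  have "norm (exp z - (\<Sum>k\<le>2. z ^ k / fact k)) \<le> exp \<bar>Re z\<bar> * norm z ^ Suc 2 / fact 2"
    by (rule Taylor_exp)
  also have "\<dots> \<le> exp \<bar>Re z\<bar> * norm z ^ 3"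
    by (simp add: divide_le_eq)
  finally show ?thesis
    by (simp add: numeral_2_eq_2)
qed

abbreviation gauss_exponent :: "real \<Rightarrow> real \<Rightarrow> real \<Rightarrow> complex" where
  "gauss_exponent \<theta> a b \<equiv> \<i> * of_real (\<theta> * a) - of_real (\<theta>\<^sup>2 * b / 2)"

definition quadratic_expansion :: "real \<Rightarrow> real \<Rightarrow> real \<Rightarrow> complex" where
  "quadratic_expansion \<theta> a b = 1 + \<i> * of_real (\<theta> * a) - of_real (\<theta>\<^sup>2 / 2 * (b + a\<^sup>2))"

definition quadratic_remainder :: "real \<Rightarrow> real \<Rightarrow> real \<Rightarrow> complex" where
  "quadratic_remainder \<theta> a b = exp (gauss_exponent \<theta> a b) - quadratic_expansion \<theta> a b"

definition remainder_const :: "real \<Rightarrow> real \<Rightarrow> real" where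
  "remainder_const A B = exp (B / 2) * (A + B / 2) ^ 3 + (B\<^sup>2 / 8 + A * B / 2)"

lemma quadratic_remainder_eq:
  fixes \<theta> a b :: real
  defines "z \<equiv> gauss_exponent \<theta> a b"
  shows "quadratic_remainder \<theta> a b = (exp z - (1 + z + z\<^sup>2 / 2)) +
    (of_real (\<theta> ^ 4 * b\<^sup>2 / 8) - \<i> * of_real (\<theta> ^ 3 * a * b / 2))"
  unfolding quadratic_remainder_def quadratic_expansion_def z_def[symmetric]
  by (simp add: z_def complex_eq_iff power2_eq_square field_simps eval_nat_numeral)

context
  fixes \<theta> a b A B :: real
  assumes \<theta>_le_1: "\<bar>\<theta>\<bar> \<le> 1" and a_le: "\<bar>a\<bar> \<le> A" and b_le: "\<bar>b\<bar> \<le> B"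
begin

lemma abs_Re_gauss_exponent_le: "\<bar>Re (gauss_exponent \<theta> a b)\<bar> \<le> B / 2"
proof -
  have "\<theta>\<^sup>2 * \<bar>b\<bar> \<le> 1 * B"
    using \<theta>_le_1 b_le by (intro mult_mono) (auto simp: abs_square_le_1)
  then show ?thesis
    by (simp add: abs_mult)
qed

lemma norm_gauss_exponent_le: "norm (gauss_exponent \<theta> a b) \<le> \<bar>\<theta>\<bar> * (A + B / 2)"
proof -
  have "norm (gauss_exponent \<theta> a b) \<le>
      norm (\<i> * of_real (\<theta> * a)) + norm (complex_of_real (\<theta>\<^sup>2 * b / 2))"
    by (rule norm_triangle_ineq4)
  also have "\<dots> = \<bar>\<theta>\<bar> * \<bar>a\<bar> + \<theta>\<^sup>2 * \<bar>b\<bar> / 2"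
    by (simp add: norm_mult norm_power)
  also have "\<theta>\<^sup>2 \<le> \<bar>\<theta>\<bar>"
    using power_decreasing[of 1 2 "\<bar>\<theta>\<bar>"] \<theta>_le_1 by simp
  then have "\<bar>\<theta>\<bar> * \<bar>a\<bar> + \<theta>\<^sup>2 * \<bar>b\<bar> / 2 \<le> \<bar>\<theta>\<bar> * A + \<bar>\<theta>\<bar> * B / 2"
    using a_le b_le by (intro add_mono divide_right_mono mult_mono) auto
  finally show ?thesis
    by (simp add: distrib_left)
qed

lemma norm_quadratic_remainder_le:
  "norm (quadratic_remainder \<theta> a b) \<le> remainder_const A B * \<bar>\<theta>\<bar> ^ 3"
proof -
  define z where "z = gauss_exponent \<theta> a b"
  have "0 \<le> A"
    using a_le by linarith
  have \<theta>_power_le: "\<bar>\<theta>\<bar> ^ 4 \<le> \<bar>\<theta>\<bar> ^ 3"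
    using power_decreasing[of 3 4 "\<bar>\<theta>\<bar>"] \<theta>_le_1 by simp
  have "exp \<bar>Re z\<bar> * norm z ^ 3 \<le> exp (B / 2) * (\<bar>\<theta>\<bar> * (A + B / 2)) ^ 3"
    unfolding z_def using abs_Re_gauss_exponent_le norm_gauss_exponent_le
    by (intro mult_mono power_mono) auto
  then have "norm (exp z - (1 + z + z\<^sup>2 / 2)) \<le> exp (B / 2) * (A + B / 2) ^ 3 * \<bar>\<theta>\<bar> ^ 3"
    using norm_exp_diff_quadratic_le[of z] by (simp add: power_mult_distrib mult_ac)
  moreover have "norm (of_real (\<theta> ^ 4 * b\<^sup>2 / 8) - \<i> * of_real (\<theta> ^ 3 * a * b / 2)) \<le>
      \<bar>\<theta>\<bar> ^ 3 * B\<^sup>2 / 8 + \<bar>\<theta>\<bar> ^ 3 * (A * B) / 2"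
  proof (rule order_trans[OF norm_triangle_ineq4 add_mono])
    have "\<bar>\<theta>\<bar> ^ 4 * \<bar>b\<bar>\<^sup>2 \<le> \<bar>\<theta>\<bar> ^ 3 * B\<^sup>2"
      using \<theta>_power_le b_le by (intro mult_mono power_mono) auto
    then show "norm (complex_of_real (\<theta> ^ 4 * b\<^sup>2 / 8)) \<le> \<bar>\<theta>\<bar> ^ 3 * B\<^sup>2 / 8"
      by (simp only: norm_of_real abs_divide abs_mult power_abs)
    have "\<bar>\<theta>\<bar> ^ 3 * (\<bar>a\<bar> * \<bar>b\<bar>) \<le> \<bar>\<theta>\<bar> ^ 3 * (A * B)"
      using a_le b_le \<open>0 \<le> A\<close> by (intro mult_mono) auto
    then show "norm (\<i> * complex_of_real (\<theta> ^ 3 * a * b / 2)) \<le> \<bar>\<theta>\<bar> ^ 3 * (A * B) / 2"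
      by (simp add: norm_mult norm_power abs_mult mult.assoc)
  qed
  ultimately show ?thesis
    unfolding quadratic_remainder_eq z_def[symmetric] remainder_const_def
    by (rule order_trans[OF norm_triangle_mono]) (simp add: algebra_simps)
qed

end

definition gauss_approx :: "real \<Rightarrow> real \<Rightarrow> complex" where
  "gauss_approx \<theta> x = exp (gauss_exponent \<theta> (dev_mean x) (dev_var x))"

lemma measurable_gauss_approx [measurable]: "gauss_approx \<theta> \<in> borel_measurable borel"
  unfolding gauss_approx_def[abs_def] by measurable

lemma norm_gauss_approx: "norm (gauss_approx \<theta> x) = exp (- \<theta>\<^sup>2 * dev_var x / 2)"
  by (simp add: gauss_approx_def)

lemma norm_gauss_approx_le_1: "norm (gauss_approx \<theta> x) \<le> 1"
  using dev_var_nonneg[of x] by (simp add: norm_gauss_approx)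

lemma gauss_approx_eq_exp:
  assumes "2 < x"
  shows "gauss_approx \<theta> x = of_real (exp (- \<theta>\<^sup>2 * var_rate * x / 2))"
  using assms
  by (simp add: gauss_approx_def dev_mean_def dev_var_def exp_of_real[symmetric] mult.assoc)

abbreviation excess_expansion :: "real \<Rightarrow> real \<Rightarrow> real \<Rightarrow> complex" where
  "excess_expansion \<theta> x y \<equiv> quadratic_expansion \<theta> (mean_excess x y) (var_excess x y)"

abbreviation excess_remainder :: "real \<Rightarrow> real \<Rightarrow> real \<Rightarrow> complex" where
  "excess_remainder \<theta> x y \<equiv> quadratic_remainder \<theta> (mean_excess x y) (var_excess x y)"

lemma gauss_approx_mult:
  assumes "1 < x"
  shows "gauss_approx \<theta> y * gauss_approx \<theta> (x - y) =
    gauss_approx \<theta> x * (excess_expansion \<theta> x y + excess_remainder \<theta> x y)"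
proof -
  have "gauss_approx \<theta> y * gauss_approx \<theta> (x - y) = gauss_approx \<theta> x *
      exp (gauss_exponent \<theta> (mean_excess x y) (var_excess x y))"
    using assms unfolding gauss_approx_def exp_add[symmetric]
    by (intro arg_cong[where f = exp])
       (simp add: mean_excess_def var_excess_def dev_mean_def field_simps)
  then show ?thesis
    by (simp add: quadratic_remainder_def)
qed

lemma set_integrable_excess:
  "set_integrable lborel {0..x} (\<lambda>y. of_real (mean_excess x y) :: complex)"
  "set_integrable lborel {0..x} (\<lambda>y. of_real (var_excess x y + (mean_excess x y)\<^sup>2) :: complex)"
proof -
  show "set_integrable lborel {0..x} (\<lambda>y. of_real (mean_excess x y) :: complex)"
    using abs_mean_excess_le by (intro set_integrable_Icc_bounded[where B = 2]) auto
  have "\<bar>var_excess x y + (mean_excess x y)\<^sup>2\<bar> \<le> 18 + 2\<^sup>2" if "y \<in> {0..x}" for y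
    using abs_var_excess_le[OF that] power_mono[OF abs_mean_excess_le[OF that], of 2]
    by (intro order_trans[OF abs_triangle_ineq add_mono]) auto
  then show "set_integrable lborel {0..x}
      (\<lambda>y. of_real (var_excess x y + (mean_excess x y)\<^sup>2) :: complex)"
    by (intro set_integrable_Icc_bounded[where B = "18 + 2\<^sup>2"])
       (auto simp del: of_real_add of_real_power)
qed

lemma integral_excess_expansion:
  assumes "1 < x"
  shows "set_integrable lborel {0..x} (\<lambda>y. excess_expansion \<theta> x y)"
    and "(LBINT y:{0..x}. excess_expansion \<theta> x y) = of_real x"
proof -
  have integrable: "set_integrable lborel {0..x} (\<lambda>y. 1 :: complex)"
    "set_integrable lborel {0..x} (\<lambda>y. \<i> * of_real (\<theta> * mean_excess x y))"
    "set_integrable lborel {0..x}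
      (\<lambda>y. complex_of_real (\<theta>\<^sup>2 / 2 * (var_excess x y + (mean_excess x y)\<^sup>2)))"
    unfolding of_real_mult
    by (intro set_integrable_mult_right set_integrable_excess
      set_integrable_Icc_bounded[where B = 1]; simp)+
  then show "set_integrable lborel {0..x} (\<lambda>y. excess_expansion \<theta> x y)"
    unfolding quadratic_expansion_def by (intro set_integral_add set_integral_diff)
  have "(LBINT y:{0..x}. excess_expansion \<theta> x y) =
      (LBINT y:{0..x}. 1) + (LBINT y:{0..x}. \<i> * of_real (\<theta> * mean_excess x y)) -
      (LBINT y:{0..x}. complex_of_real (\<theta>\<^sup>2 / 2 * (var_excess x y + (mean_excess x y)\<^sup>2)))"
    unfolding quadratic_expansion_def
    using integrable by (simp only: set_integral_add set_integral_diff)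
  also have "\<dots> = of_real x"
    using assms integral_mean_excess[OF assms] integral_var_excess[OF assms]
    by (simp only: set_integral_mult_right set_integral_complex_of_real)
       (simp add: set_integral_const scaleR_conv_of_real)
  finally show "(LBINT y:{0..x}. excess_expansion \<theta> x y) = of_real x" .
qed

definition residual_const :: real where
  "residual_const = 4 * remainder_const 2 18"

lemma residual_const_pos: "0 < residual_const"
  by (simp add: residual_const_def remainder_const_def add_pos_pos)

lemma norm_excess_remainder_le:
  assumes "\<bar>\<theta>\<bar> \<le> 1" "y \<in> {0..x}"
  shows "norm (excess_remainder \<theta> x y) \<le> remainder_const 2 18 * \<bar>\<theta>\<bar> ^ 3"
  using assms(1) abs_mean_excess_le[OF assms(2)] abs_var_excess_le[OF assms(2)]
  by (rule norm_quadratic_remainder_le)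

lemma excess_remainder_eq_0: "2 < y \<Longrightarrow> 2 < x - y \<Longrightarrow> excess_remainder \<theta> x y = 0"
  by (simp add: excess_eq_0 quadratic_remainder_def quadratic_expansion_def)

lemma set_integrable_excess_remainder:
  assumes "\<bar>\<theta>\<bar> \<le> 1"
  shows "set_integrable lborel {0..x} (excess_remainder \<theta> x)"
proof (rule set_integrable_Icc_bounded)
  show "excess_remainder \<theta> x \<in> borel_measurable borel"
    unfolding quadratic_remainder_def quadratic_expansion_def by measurable
qed (rule norm_excess_remainder_le[OF assms])

text \<open>The remainder vanishes unless one of the two parts has length at most 2, so its integral is
  bounded uniformly in \<open>x\<close>.\<close>

lemma norm_integral_excess_remainder_le:
  assumes "\<bar>\<theta>\<bar> \<le> 1"
  shows "norm (LBINT y:{0..x}. excess_remainder \<theta> x y) \<le> residual_const * \<bar>\<theta>\<bar> ^ 3"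
proof -
  let ?K = "remainder_const 2 18 * \<bar>\<theta>\<bar> ^ 3"
  let ?near = "\<lambda>y. indicator {0..2} y + indicator {x - 2..x} y :: real"
  have K_nonneg: "0 \<le> ?K"
    using residual_const_pos by (simp add: residual_const_def)
  have integrable_near: "integrable lborel (\<lambda>y. ?K * ?near y)"
    by (intro integrable_mult_right Bochner_Integration.integrable_add)
       (auto simp: integrable_indicator_iff emeasure_lborel_Icc_eq)
  have "norm (LBINT y:{0..x}. excess_remainder \<theta> x y) \<le> (LBINT y:{0..x}. ?K * ?near y)"
  proof (rule norm_set_integral_le)
    show "set_integrable lborel {0..x} (\<lambda>y. ?K * ?near y)"
      using integrable_mult_indicator[OF _ integrable_near, of "{0..x}"]
      by (simp add: set_integrable_def)
    fix y assume y_in: "y \<in> {0..x}"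
    show "norm (excess_remainder \<theta> x y) \<le> ?K * ?near y"
    proof (cases "2 < y \<and> 2 < x - y")
      case True
      then show ?thesis
        using K_nonneg by (simp add: excess_remainder_eq_0)
    next
      case False
      then have "1 \<le> ?near y"
        using y_in by (auto simp: indicator_def)
      from mult_left_mono[OF this K_nonneg] show ?thesis
        using norm_excess_remainder_le[OF assms y_in] by linarith
    qed
  qed
  also have "\<dots> \<le> (LBINT y. ?K * ?near y)"
    unfolding set_lebesgue_integral_def using K_nonneg
    by (intro integral_mono' integrable_near) (auto simp: indicator_def)
  also have "\<dots> = ?K * 4"
    by (subst integral_mult_right_zero, subst Bochner_Integration.integral_add)
       (auto simp: integrable_indicator_iff emeasure_lborel_Icc_eq)
  finally show ?thesis
    by (simp add: residual_const_def mult_ac)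
qed

lemma gauss_approx_residual:
  assumes "\<bar>\<theta>\<bar> \<le> 1" "1 < x"
  shows "norm (causal_conv (gauss_approx \<theta>) (gauss_approx \<theta>) x - of_real x * gauss_approx \<theta> x)
     \<le> residual_const * \<bar>\<theta>\<bar> ^ 3 * norm (gauss_approx \<theta> x)"
proof -
  let ?R = "LBINT y:{0..x}. excess_remainder \<theta> x y"
  have "causal_conv (gauss_approx \<theta>) (gauss_approx \<theta>) x = gauss_approx \<theta> x * (of_real x + ?R)"
    unfolding causal_conv_def gauss_approx_mult[OF assms(2)] set_integral_mult_right
      set_integral_add(2)[OF integral_excess_expansion(1)[OF assms(2)]
        set_integrable_excess_remainder[OF assms(1)]]
      integral_excess_expansion(2)[OF assms(2)] ..
  then have "causal_conv (gauss_approx \<theta>) (gauss_approx \<theta>) x - of_real x * gauss_approx \<theta> x =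
      ?R * gauss_approx \<theta> x"
    by (simp only: distrib_left mult.commute add_diff_cancel_left')
  then have "norm (causal_conv (gauss_approx \<theta>) (gauss_approx \<theta>) x - of_real x * gauss_approx \<theta> x) =
      norm ?R * norm (gauss_approx \<theta> x)"
    by (simp only: norm_mult)
  also have "\<dots> \<le> residual_const * \<bar>\<theta>\<bar> ^ 3 * norm (gauss_approx \<theta> x)"
    by (intro mult_right_mono norm_integral_excess_remainder_le assms) simp
  finally show ?thesis .
qed

section \<open>The characteristic function of the number of pieces\<close>

definition count_char :: "real \<Rightarrow> real \<Rightarrow> complex" where
  "count_char \<theta> x = cis (\<theta> * (1 - 2 * x)) * gen_fun (split_fps x) (cis \<theta>)"

lemma measurable_count_char [measurable]: "count_char \<theta> \<in> borel_measurable borel"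
proof -
  have [measurable]: "(\<lambda>x. gen_fun (split_fps x) (cis \<theta>)) \<in> borel_measurable borel"
    by (rule measurable_gen_fun_split_fps) simp
  show ?thesis
    unfolding count_char_def[abs_def] cis_conv_exp[of "_ * _"] by measurable
qed

lemma norm_count_char_le_1: "norm (count_char \<theta> x) \<le> 1"
  using norm_gen_fun_le_1[of "cis \<theta>" "split_fps x"]
  by (simp add: count_char_def norm_mult subprob_fps_split_fps)

lemma count_char_eq_gauss_approx: "x \<le> 1 \<Longrightarrow> count_char \<theta> x = gauss_approx \<theta> x"
  by (simp add: count_char_def split_fps_le_1 gen_fun_1 gauss_approx_def dev_mean_def dev_var_def
      cis_conv_exp)

lemma count_char_convolution:
  assumes "1 < x"
  shows "of_real x * count_char \<theta> x = causal_conv (count_char \<theta>) (count_char \<theta>) x"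
proof -
  let ?G = "\<lambda>y. gen_fun (split_fps y) (cis \<theta>)"
  have "count_char \<theta> y * count_char \<theta> (x - y) =
      (cis (\<theta> * (1 - 2 * x)) * cis \<theta>) * (?G y * ?G (x - y))" for y
  proof -
    have "cis (\<theta> * (1 - 2 * y)) * cis (\<theta> * (1 - 2 * (x - y))) = cis (\<theta> * (1 - 2 * x)) * cis \<theta>"
      by (simp add: cis_mult algebra_simps)
    moreover have "count_char \<theta> y * count_char \<theta> (x - y) =
        (cis (\<theta> * (1 - 2 * y)) * cis (\<theta> * (1 - 2 * (x - y)))) * (?G y * ?G (x - y))"
      by (simp only: count_char_def mult_ac)
    ultimately show ?thesis by simp
  qed
  then have "causal_conv (count_char \<theta>) (count_char \<theta>) x =
      (cis (\<theta> * (1 - 2 * x)) * cis \<theta>) * causal_conv ?G ?G x"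
    by (simp only: causal_conv_def set_integral_mult_right)
  also have "\<dots> = cis (\<theta> * (1 - 2 * x)) * (of_real x * ?G x)"
    using gen_fun_split_fps_convolution[of "cis \<theta>" x] assms by simp
  finally show ?thesis
    by (simp add: count_char_def mult_ac)
qed

definition char_error :: "real \<Rightarrow> real \<Rightarrow> complex" where
  "char_error \<theta> x = count_char \<theta> x - gauss_approx \<theta> x"

lemma measurable_char_error [measurable]: "char_error \<theta> \<in> borel_measurable borel"
  unfolding char_error_def[abs_def] by measurable

lemma char_error_eq_0: "x \<le> 1 \<Longrightarrow> char_error \<theta> x = 0"
  by (simp add: char_error_def count_char_eq_gauss_approx)

lemma norm_char_error_le_2: "norm (char_error \<theta> x) \<le> 2"
  using norm_triangle_ineq4[of "count_char \<theta> x" "gauss_approx \<theta> x"]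
    norm_count_char_le_1[of \<theta> x] norm_gauss_approx_le_1[of \<theta> x]
  by (simp add: char_error_def)

lemma char_error_convolution:
  assumes "1 < x"
  shows "of_real x * char_error \<theta> x =
    causal_conv (char_error \<theta>) (\<lambda>y. count_char \<theta> y + gauss_approx \<theta> y) x +
    (causal_conv (gauss_approx \<theta>) (gauss_approx \<theta>) x - of_real x * gauss_approx \<theta> x)"
proof -
  have "causal_conv (count_char \<theta>) (count_char \<theta>) x -
      causal_conv (gauss_approx \<theta>) (gauss_approx \<theta>) x =
      causal_conv (char_error \<theta>) (\<lambda>y. count_char \<theta> y + gauss_approx \<theta> y) x"
    unfolding char_error_def
    by (rule causal_conv_square_diff[where B = 1])
       (simp_all add: norm_count_char_le_1 norm_gauss_approx_le_1)
  then show ?thesis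
    by (simp add: count_char_convolution[OF assms, symmetric] char_error_def algebra_simps)
qed

text \<open>Weighting with \<open>exp (\<rho> * x)\<close> reduces the error recursion to an averaged Gronwall inequality.\<close>

context
  fixes \<theta> c \<rho> :: real
  assumes \<theta>_le_1: "\<bar>\<theta>\<bar> \<le> 1" and c_pos: "0 < c" and \<rho>_nonneg: "0 \<le> \<rho>"
    and count_char_decay: "\<And>y. 0 \<le> y \<Longrightarrow> norm (count_char \<theta> y) \<le> c * exp (- \<rho> * y)"
    and gauss_approx_decay: "\<And>y. 0 \<le> y \<Longrightarrow> norm (gauss_approx \<theta> y) \<le> c * exp (- \<rho> * y)"
begin

abbreviation weighted_error :: "real \<Rightarrow> real" where
  "weighted_error x \<equiv> norm (char_error \<theta> x) * exp (\<rho> * x)"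

lemma weighted_error_le: "x \<le> X \<Longrightarrow> weighted_error x \<le> 2 * exp (\<rho> * X)"
  using norm_char_error_le_2[of \<theta> x] \<rho>_nonneg by (intro mult_mono) (auto intro: mult_left_mono)

lemma set_integrable_weighted_error:
  "set_integrable lborel {0..x} weighted_error"
  using weighted_error_le by (intro set_integrable_Icc_bounded[where B = "2 * exp (\<rho> * x)"]) auto

lemma norm_causal_conv_char_error_le:
  "norm (causal_conv (char_error \<theta>) (\<lambda>y. count_char \<theta> y + gauss_approx \<theta> y) x) \<le>
    exp (- \<rho> * x) * (2 * c * (LBINT y:{0..x}. weighted_error y))"
proof -
  have "norm (causal_conv (char_error \<theta>) (\<lambda>y. count_char \<theta> y + gauss_approx \<theta> y) x) \<le>
      (LBINT y:{0..x}. 2 * c * exp (- \<rho> * x) * weighted_error y)"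
    unfolding causal_conv_def
  proof (rule norm_set_integral_le)
    fix y assume "y \<in> {0..x}"
    then have sum_le: "norm (count_char \<theta> (x - y) + gauss_approx \<theta> (x - y)) \<le>
        c * exp (- \<rho> * (x - y)) + c * exp (- \<rho> * (x - y))"
      by (intro norm_triangle_mono count_char_decay gauss_approx_decay) auto
    have "norm (char_error \<theta> y * (count_char \<theta> (x - y) + gauss_approx \<theta> (x - y))) \<le>
        norm (char_error \<theta> y) * (c * exp (- \<rho> * (x - y)) + c * exp (- \<rho> * (x - y)))"
      unfolding norm_mult by (intro mult_left_mono sum_le) simp
    also have "exp (- \<rho> * (x - y)) = exp (- \<rho> * x) * exp (\<rho> * y)"
      by (simp add: exp_add[symmetric] algebra_simps)
    finally show "norm (char_error \<theta> y * (count_char \<theta> (x - y) + gauss_approx \<theta> (x - y))) \<le>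
        2 * c * exp (- \<rho> * x) * weighted_error y"
      by (simp add: algebra_simps)
  qed (intro set_integrable_mult_right set_integrable_weighted_error)
  then show ?thesis
    unfolding set_integral_mult_right by (simp only: mult_ac)
qed

lemma weighted_error_recursion:
  assumes "1 < x"
  shows "x * weighted_error x \<le>
    2 * c * (LBINT y:{0..x}. weighted_error y) + residual_const * c * \<bar>\<theta>\<bar> ^ 3"
proof -
  let ?bound = "2 * c * (LBINT y:{0..x}. weighted_error y) + residual_const * c * \<bar>\<theta>\<bar> ^ 3"
  have "x * norm (char_error \<theta> x) = norm (of_real x * char_error \<theta> x)"
    using assms by (simp add: norm_mult)
  also have "\<dots> \<le> norm (causal_conv (char_error \<theta>) (\<lambda>y. count_char \<theta> y + gauss_approx \<theta> y) x) +
      residual_const * \<bar>\<theta>\<bar> ^ 3 * norm (gauss_approx \<theta> x)"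
    unfolding char_error_convolution[OF assms]
    by (rule norm_triangle_le[OF add_left_mono[OF gauss_approx_residual[OF \<theta>_le_1 assms]]])
  also have "\<dots> \<le> exp (- \<rho> * x) * (2 * c * (LBINT y:{0..x}. weighted_error y)) +
      residual_const * \<bar>\<theta>\<bar> ^ 3 * (c * exp (- \<rho> * x))"
    using residual_const_pos assms
    by (intro add_mono norm_causal_conv_char_error_le mult_left_mono gauss_approx_decay) auto
  also have "\<dots> = exp (- \<rho> * x) * ?bound"
    by (simp add: algebra_simps)
  finally have "x * norm (char_error \<theta> x) * exp (\<rho> * x) \<le> exp (- \<rho> * x) * ?bound * exp (\<rho> * x)"
    by (rule mult_right_mono) simp
  also have "\<dots> = ?bound"
    by (simp add: exp_minus)
  finally show ?thesis
    by (simp only: mult.assoc)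
qed

lemma norm_char_error_le_of_decay:
  assumes "1 < x"
  shows "norm (char_error \<theta> x) \<le> residual_const * c * \<bar>\<theta>\<bar> ^ 3 * x powr (2 * c - 1) * exp (- \<rho> * x)"
proof -
  have "weighted_error x \<le> residual_const * c * \<bar>\<theta>\<bar> ^ 3 / 1 powr (2 * c) * x powr (2 * c - 1)"
    by (rule gronwall_averaged[where X = x and B = "2 * exp (\<rho> * x)"])
       (use c_pos assms in
         \<open>auto simp: char_error_eq_0 intro: weighted_error_recursion weighted_error_le\<close>)
  then have "weighted_error x * exp (- \<rho> * x) \<le>
      residual_const * c * \<bar>\<theta>\<bar> ^ 3 * x powr (2 * c - 1) * exp (- \<rho> * x)"
    by (intro mult_right_mono) auto
  then show ?thesis
    by (simp add: exp_minus mult.assoc)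
qed

end

lemma norm_char_error_le_linear:
  assumes "\<bar>\<theta>\<bar> \<le> 1" "1 < x"
  shows "norm (char_error \<theta> x) \<le> residual_const * \<bar>\<theta>\<bar> ^ 3 * x"
  using norm_char_error_le_of_decay[of \<theta> 1 0 x] assms norm_count_char_le_1 norm_gauss_approx_le_1
  by simp

subsection \<open>Exponential decay\<close>

definition small_angle :: real where
  "small_angle = 1 / (40 * residual_const + 1)"

lemma small_angle_pos: "0 < small_angle"
  and small_angle_le_1: "small_angle \<le> 1"
  and residual_small_angle_le: "40 * residual_const * small_angle \<le> 1"
  using residual_const_pos by (auto simp: small_angle_def)

lemma small_angle_squared_le_1: "\<bar>\<theta>\<bar> \<le> small_angle \<Longrightarrow> \<theta>\<^sup>2 \<le> 1"
  using small_angle_le_1 by (simp add: abs_square_le_1)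

lemma exp_minus_le_linear:
  fixes u :: real
  assumes "0 \<le> u" "u \<le> 1"
  shows "exp (- u) \<le> 1 - u / 2"
proof -
  have "exp (- u) \<le> 1 / (1 + u)"
    using assms exp_ge_add_one_self[of u] by (simp add: exp_minus inverse_eq_divide frac_le)
  also have "\<dots> \<le> 1 - u / 2"
  proof -
    have "0 \<le> u * (1 - u) / 2"
      using assms by simp
    also have "\<dots> = (1 - u / 2) * (1 + u) - 1"
      by (simp add: field_simps)
    finally show ?thesis
      using assms by (simp add: divide_le_eq)
  qed
  finally show ?thesis .
qed

lemma norm_count_char_le_middle:
  assumes \<theta>_small: "\<bar>\<theta>\<bar> \<le> small_angle" and x_range: "3 / 2 \<le> x" "x \<le> 2"
  shows "norm (count_char \<theta> x) \<le> 1 - \<theta>\<^sup>2 / 20"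
proof -
  have "norm (gauss_approx \<theta> x) \<le> exp (- (\<theta>\<^sup>2 / 5))"
    using mult_left_mono[OF dev_var_ge[OF x_range], of "\<theta>\<^sup>2"] by (simp add: norm_gauss_approx)
  also have "\<dots> \<le> 1 - \<theta>\<^sup>2 / 5 / 2"
    using small_angle_squared_le_1[OF \<theta>_small] by (intro exp_minus_le_linear) auto
  finally have gauss_approx_le: "norm (gauss_approx \<theta> x) \<le> 1 - \<theta>\<^sup>2 / 10"
    by simp
  have "norm (char_error \<theta> x) \<le> residual_const * \<bar>\<theta>\<bar> ^ 3 * x"
    using \<theta>_small x_range small_angle_le_1 by (intro norm_char_error_le_linear) auto
  also have "\<dots> \<le> residual_const * \<bar>\<theta>\<bar> ^ 3 * 2"
    using x_range residual_const_pos by (intro mult_left_mono) auto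
  also have "\<dots> = 40 * residual_const * \<bar>\<theta>\<bar> * \<theta>\<^sup>2 / 20"
    by (simp add: power3_eq_cube power2_eq_square)
  also have "\<dots> \<le> 40 * residual_const * small_angle * \<theta>\<^sup>2 / 20"
    using \<theta>_small residual_const_pos
    by (intro divide_right_mono mult_right_mono mult_left_mono) auto
  also have "\<dots> \<le> 1 * \<theta>\<^sup>2 / 20"
    using residual_small_angle_le by (intro divide_right_mono mult_right_mono) auto
  finally have "norm (char_error \<theta> x) \<le> \<theta>\<^sup>2 / 20"
    by simp
  then show ?thesis
    using gauss_approx_le norm_triangle_sub[of "count_char \<theta> x" "gauss_approx \<theta> x"]
    unfolding char_error_def by linarith
qed

text \<open>A supersolution of the convolution equation: the mass that is added where the modulus of
  \<open>count_char\<close> may be 1 is more than compensated on the interval from 3/2 to 2.\<close>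

definition super_bump :: "real \<Rightarrow> real \<Rightarrow> real" where
  "super_bump \<eta> x = (if x \<le> 3 / 2 then \<eta> else if x \<le> 2 then - 5 * \<eta> else 0)"

definition supersolution :: "real \<Rightarrow> real \<Rightarrow> real" where
  "supersolution \<eta> x = exp (- \<eta> * x / 2) * (1 + super_bump \<eta> x)"

lemma measurable_super_bump [measurable]: "super_bump \<eta> \<in> borel_measurable borel"
  unfolding super_bump_def[abs_def] by measurable

lemma measurable_supersolution [measurable]: "supersolution \<eta> \<in> borel_measurable borel"
  unfolding supersolution_def[abs_def] by measurable

context
  fixes \<eta> :: real
  assumes \<eta>_range: "0 \<le> \<eta>" "\<eta> \<le> 1 / 100"
begin

lemma rate_squared_le: "\<eta>\<^sup>2 \<le> \<eta> / 100"
  using mult_left_mono[OF \<eta>_range(2,1)] by (simp add: power2_eq_square)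

lemma super_bump_bounds: "- 5 * \<eta> \<le> super_bump \<eta> x" "super_bump \<eta> x \<le> \<eta>" "\<bar>super_bump \<eta> x\<bar> \<le> 5 * \<eta>"
  using \<eta>_range by (auto simp: super_bump_def)

lemma supersolution_nonneg: "0 \<le> supersolution \<eta> x"
  unfolding supersolution_def
  using super_bump_bounds(1)[of x] \<eta>_range by (intro mult_nonneg_nonneg) auto

lemma supersolution_le: "supersolution \<eta> x \<le> (1 + \<eta>) * exp (- \<eta> * x / 2)"
  unfolding supersolution_def mult.commute[of "1 + \<eta>"]
  using super_bump_bounds(2)[of x] by (intro mult_left_mono) auto

lemma supersolution_le_2:
  assumes "0 \<le> x"
  shows "supersolution \<eta> x \<le> 2"
proof -
  have "(1 + \<eta>) * exp (- \<eta> * x / 2) \<le> 2 * 1"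
    using \<eta>_range assms by (intro mult_mono) auto
  then show ?thesis using supersolution_le[of x] by linarith
qed

lemma integral_super_bump:
  assumes "2 < x"
  shows "(LBINT y:{0..x}. super_bump \<eta> y) = - \<eta>"
proof -
  have "(LBINT y:{0..x}. super_bump \<eta> y) =
      (LBINT y. \<eta> * indicator {0..3/2} y + (- 5 * \<eta>) * indicator {3/2<..2::real} y)"
    unfolding set_lebesgue_integral_def using assms
    by (intro Bochner_Integration.integral_cong) (auto simp: indicator_def super_bump_def)
  also have "\<dots> =
      (LBINT y. \<eta> * indicator {0..3/2::real} y) +
          (LBINT y. (- 5 * \<eta>) * indicator {3/2<..2::real} y)"
  proof (rule Bochner_Integration.integral_add)
    have "emeasure lborel {3/2<..2::real} < \<infinity>"
      by (subst emeasure_lborel_Ioc) (simp, simp only: infinity_ennreal_def ennreal_less_top)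
    then show "integrable lborel (\<lambda>y. (- 5 * \<eta>) * indicator {3/2<..2::real} y)"
      by (intro integrable_mult_right integrable_real_indicator) auto
  qed (auto simp: integrable_indicator_iff emeasure_lborel_Icc_eq)
  finally show ?thesis by simp
qed

lemma super_bump_mult_le: "super_bump \<eta> y * super_bump \<eta> z \<le> 25 * \<eta>\<^sup>2"
  using mult_mono[OF super_bump_bounds(3)[of y] super_bump_bounds(3)[of z]] \<eta>_range
    abs_ge_self[of "super_bump \<eta> y * super_bump \<eta> z"]
  by (simp add: abs_mult power2_eq_square)

lemma set_integrable_super_bump:
  "set_integrable lborel {0..x} (super_bump \<eta>)"
  "set_integrable lborel {0..x} (\<lambda>y. super_bump \<eta> (x - y))"
  "set_integrable lborel {0..x} (\<lambda>y. super_bump \<eta> y * super_bump \<eta> (x - y))"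
  using super_bump_bounds(3)
  by (intro set_integrable_Icc_bounded[where B = "5 * \<eta>"]
    set_integrable_causal_conv[where B = "5 * \<eta>"]; simp)+

lemma causal_conv_super_bump_le:
  assumes "2 < x"
  shows "causal_conv (super_bump \<eta>) (super_bump \<eta>) x \<le> 50 * \<eta>\<^sup>2"
proof -
  have "causal_conv (super_bump \<eta>) (super_bump \<eta>) x =
      (LBINT y:{0..2}. super_bump \<eta> y * super_bump \<eta> (x - y))"
    unfolding causal_conv_def set_lebesgue_integral_def using assms
    by (intro Bochner_Integration.integral_cong) (auto simp: indicator_def super_bump_def)
  also have "\<dots> \<le> (LBINT y:{0..2::real}. 25 * \<eta>\<^sup>2)"
  proof (rule set_integral_mono)
    show "set_integrable lborel {0..2} (\<lambda>y. super_bump \<eta> y * super_bump \<eta> (x - y))"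
      by (rule set_integrable_subset[OF set_integrable_super_bump(3)]) (use assms in auto)
    show "set_integrable lborel {0..2::real} (\<lambda>y. 25 * \<eta>\<^sup>2)"
      by (rule set_integrable_Icc_bounded[where B = "25 * \<eta>\<^sup>2"]) auto
  qed (rule super_bump_mult_le)
  also have "\<dots> = 50 * \<eta>\<^sup>2"
    by (simp add: set_integral_const)
  finally show ?thesis .
qed

lemma causal_conv_supersolution_le:
  assumes "2 < x"
  shows "causal_conv (supersolution \<eta>) (supersolution \<eta>) x \<le> x * supersolution \<eta> x"
proof -
  let ?e = "super_bump \<eta>"
  have "supersolution \<eta> y * supersolution \<eta> (x - y) =
      exp (- \<eta> * x / 2) * (1 + ?e y + ?e (x - y) + ?e y * ?e (x - y))" for y
  proof -
    have "exp (- \<eta> * y / 2) * exp (- \<eta> * (x - y) / 2) = exp (- \<eta> * x / 2)"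
      by (simp add: exp_add[symmetric] field_simps)
    moreover have "supersolution \<eta> y * supersolution \<eta> (x - y) =
        (exp (- \<eta> * y / 2) * exp (- \<eta> * (x - y) / 2)) * ((1 + ?e y) * (1 + ?e (x - y)))"
      by (simp only: supersolution_def mult_ac)
    ultimately show ?thesis
      by (simp only:) (simp add: algebra_simps)
  qed
  then have "causal_conv (supersolution \<eta>) (supersolution \<eta>) x =
      exp (- \<eta> * x / 2) * (LBINT y:{0..x}. 1 + ?e y + ?e (x - y) + ?e y * ?e (x - y))"
    by (simp only: causal_conv_def set_integral_mult_right)
  also have "(LBINT y:{0..x}. 1 + ?e y + ?e (x - y) + ?e y * ?e (x - y)) =
      (LBINT y:{0..x}. 1) + (LBINT y:{0..x}. ?e y) + (LBINT y:{0..x}. ?e (x - y)) +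
          causal_conv ?e ?e x"
    unfolding causal_conv_def
    using set_integrable_super_bump[of x] set_integrable_Icc_bounded[of "\<lambda>_. 1 :: real" 0 x 1]
    by simp
  also have "\<dots> = x - 2 * \<eta> + causal_conv ?e ?e x"
    using integral_super_bump[OF assms]
      set_integral_reflect_Icc[where f = ?e and c = x and a = 0 and b = x] assms
    by (simp add: set_integral_const)
  also have "\<dots> \<le> x"
    using causal_conv_super_bump_le[OF assms] rate_squared_le \<eta>_range by linarith
  finally have "causal_conv (supersolution \<eta>) (supersolution \<eta>) x \<le> exp (- \<eta> * x / 2) * x"
    by simp
  moreover have "supersolution \<eta> x = exp (- \<eta> * x / 2)"
    using assms by (simp add: supersolution_def super_bump_def)
  ultimately show ?thesis
    by (simp only: mult.commute)
qed

end

context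
  fixes \<theta> :: real
  assumes \<theta>_small: "\<bar>\<theta>\<bar> \<le> small_angle"
begin

lemma decay_rate_bounds: "0 \<le> \<theta>\<^sup>2 / 120" "\<theta>\<^sup>2 / 120 \<le> 1 / 100"
  using small_angle_squared_le_1[OF \<theta>_small] by auto

lemma norm_count_char_le_supersolution_initial:
  assumes "x \<le> 2"
  shows "norm (count_char \<theta> x) \<le> supersolution (\<theta>\<^sup>2 / 120) x"
proof -
  define \<eta> where "\<eta> = \<theta>\<^sup>2 / 120"
  have \<eta>_bounds: "0 \<le> \<eta>" "\<eta> \<le> 1 / 100" "\<eta>\<^sup>2 \<le> \<eta> / 100"
    unfolding \<eta>_def by (rule decay_rate_bounds rate_squared_le[OF decay_rate_bounds])+
  have exp_ge: "1 - \<eta> * r / 2 \<le> exp (- \<eta> * x / 2)" if "x \<le> r" for r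
    using exp_ge_add_one_self[of "- \<eta> * x / 2"] mult_left_mono[OF that \<eta>_bounds(1)] by simp
  show ?thesis
  proof (cases "x \<le> 3 / 2")
    case True
    have "norm (count_char \<theta> x) \<le> 1"
      by (rule norm_count_char_le_1)
    also have "\<dots> \<le> (1 - \<eta> * (3 / 2) / 2) * (1 + \<eta>)"
      using \<eta>_bounds by (simp add: field_simps power2_eq_square)
    also have "\<dots> \<le> exp (- \<eta> * x / 2) * (1 + \<eta>)"
      using exp_ge[OF True] \<eta>_bounds by (intro mult_right_mono) auto
    finally show ?thesis
      using True by (simp add: supersolution_def super_bump_def \<eta>_def)
  next
    case False
    have "norm (count_char \<theta> x) \<le> 1 - 6 * \<eta>"
      using norm_count_char_le_middle[OF \<theta>_small, of x] False assms by (simp add: \<eta>_def)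
    also have "\<dots> \<le> (1 - \<eta> * 2 / 2) * (1 - 5 * \<eta>)"
      using \<eta>_bounds by (simp add: algebra_simps)
    also have "\<dots> \<le> exp (- \<eta> * x / 2) * (1 - 5 * \<eta>)"
      using exp_ge[OF assms] \<eta>_bounds by (intro mult_right_mono) auto
    finally show ?thesis
      using False assms by (simp add: supersolution_def super_bump_def \<eta>_def)
  qed
qed

lemma norm_count_char_le_supersolution:
  assumes "0 \<le> x"
  shows "norm (count_char \<theta> x) \<le> supersolution (\<theta>\<^sup>2 / 120) x"
proof (rule causal_conv_comparison[where F = "\<lambda>x. norm (count_char \<theta> x)"
      and G = "supersolution (\<theta>\<^sup>2 / 120)" and ?x0.0 = 2 and K = 2])
  fix x :: real assume x_gt_2: "2 < x"
  then have "x * norm (count_char \<theta> x) = norm (causal_conv (count_char \<theta>) (count_char \<theta>) x)"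
    by (simp add: norm_mult flip: count_char_convolution)
  also have "\<dots> \<le> causal_conv (\<lambda>x. norm (count_char \<theta> x)) (\<lambda>x. norm (count_char \<theta> x)) x"
    by (rule norm_causal_conv_le[where B = 1]) (auto simp: norm_count_char_le_1)
  finally show "x * norm (count_char \<theta> x) \<le> \<dots>" .
  show "causal_conv (supersolution (\<theta>\<^sup>2 / 120)) (supersolution (\<theta>\<^sup>2 / 120)) x \<le>
      x * supersolution (\<theta>\<^sup>2 / 120) x"
    using decay_rate_bounds x_gt_2 by (rule causal_conv_supersolution_le)
qed (use assms decay_rate_bounds order_trans[OF norm_count_char_le_1 one_le_numeral] in
    \<open>auto intro: norm_count_char_le_supersolution_initial supersolution_nonneg supersolution_le_2\<close>)

lemma norm_count_char_decay:
  assumes "0 \<le> x"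
  shows "norm (count_char \<theta> x) \<le> (1 + \<theta>\<^sup>2 / 60) * exp (- (\<theta>\<^sup>2 / 240) * x)"
proof -
  have "norm (count_char \<theta> x) \<le> (1 + \<theta>\<^sup>2 / 120) * exp (- (\<theta>\<^sup>2 / 120) * x / 2)"
    using norm_count_char_le_supersolution[OF assms] supersolution_le[OF decay_rate_bounds, of x]
    by (rule order_trans)
  also have "\<dots> \<le> (1 + \<theta>\<^sup>2 / 60) * exp (- (\<theta>\<^sup>2 / 120) * x / 2)"
    by (intro mult_right_mono) auto
  finally show ?thesis by simp
qed

lemma norm_gauss_approx_decay:
  assumes "0 \<le> x"
  shows "norm (gauss_approx \<theta> x) \<le> (1 + \<theta>\<^sup>2 / 60) * exp (- (\<theta>\<^sup>2 / 240) * x)"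
proof (cases "x \<le> 2")
  case True
  define \<eta> where "\<eta> = \<theta>\<^sup>2 / 120"
  have \<eta>_bounds: "0 \<le> \<eta>" "\<eta> \<le> 1 / 100" "\<eta>\<^sup>2 \<le> \<eta> / 100"
    unfolding \<eta>_def by (rule decay_rate_bounds rate_squared_le[OF decay_rate_bounds])+
  have "norm (gauss_approx \<theta> x) \<le> 1"
    by (rule norm_gauss_approx_le_1)
  also have "1 \<le> (1 + 2 * \<eta>) * (1 - \<eta>)"
    using \<eta>_bounds by (simp add: algebra_simps power2_eq_square)
  also have "\<dots> \<le> (1 + 2 * \<eta>) * exp (- (\<eta> / 2) * x)"
    using exp_ge_add_one_self[of "- (\<eta> / 2) * x"] mult_left_mono[OF True \<eta>_bounds(1)] \<eta>_bounds
    by (intro mult_left_mono) auto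
  finally show ?thesis
    by (simp add: \<eta>_def)
next
  case False
  have "\<theta>\<^sup>2 / 240 * x \<le> \<theta>\<^sup>2 * (var_rate * x) / 2"
    using mult_left_mono[of "1 / 120" var_rate "\<theta>\<^sup>2 * x / 2"] var_rate_bounds assms
    by (simp add: mult_ac)
  then have "norm (gauss_approx \<theta> x) \<le> 1 * exp (- (\<theta>\<^sup>2 / 240) * x)"
    using False by (simp add: norm_gauss_approx dev_var_def)
  also have "\<dots> \<le> (1 + \<theta>\<^sup>2 / 60) * exp (- (\<theta>\<^sup>2 / 240) * x)"
    by (intro mult_right_mono) auto
  finally show ?thesis .
qed

lemma norm_char_error_le_powr:
  assumes "1 < x"
  shows "norm (char_error \<theta> x) \<le>
      2 * residual_const * \<bar>\<theta>\<bar> ^ 3 * x powr (1 + \<theta>\<^sup>2 / 30) * exp (- (\<theta>\<^sup>2 / 240) * x)"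
proof -
  have "norm (char_error \<theta> x) \<le>
      residual_const * (1 + \<theta>\<^sup>2 / 60) * \<bar>\<theta>\<bar> ^ 3 * x powr (2 * (1 + \<theta>\<^sup>2 / 60) - 1) *
          exp (- (\<theta>\<^sup>2 / 240) * x)"
    using \<theta>_small small_angle_le_1 assms
    by (intro norm_char_error_le_of_decay norm_count_char_decay norm_gauss_approx_decay)
       (auto intro: add_pos_nonneg)
  also have "\<dots> \<le>
      residual_const * 2 * \<bar>\<theta>\<bar> ^ 3 * x powr (2 * (1 + \<theta>\<^sup>2 / 60) - 1) * exp (- (\<theta>\<^sup>2 / 240) * x)"
    using small_angle_squared_le_1[OF \<theta>_small] residual_const_pos
    by (intro mult_right_mono mult_left_mono) auto
  finally show ?thesis
    by (simp add: algebra_simps)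
qed

end

lemma powr_le_mult_exp:
  fixes k p x :: real
  assumes "0 < x" "1 \<le> k" "0 \<le> p" "p \<le> 1"
  shows "x powr p \<le> k * exp (p * x / k)"
proof -
  have "x powr p = k powr p * (x / k) powr p"
    using assms by (simp flip: powr_mult)
  also have "\<dots> \<le> k powr 1 * exp (p * (x / k))"
  proof (rule mult_mono)
    have "ln (x / k) \<le> x / k"
      using assms ln_le_minus_one[of "x / k"] by simp
    then show "(x / k) powr p \<le> exp (p * (x / k))"
      using assms mult_left_mono[of "ln (x / k)" "x / k" p] by (simp add: powr_def)
    show "k powr p \<le> k powr 1"
      using assms by (intro powr_mono) auto
  qed auto
  finally show ?thesis
    using assms by simp
qed

lemma norm_count_char_diff_gaussian_le:
  assumes \<theta>_small: "\<bar>\<theta>\<bar> \<le> small_angle" and x_gt_2: "2 < x"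
  shows "norm (count_char \<theta> x - of_real (exp (- \<theta>\<^sup>2 * var_rate * x / 2))) \<le>
    32 * residual_const * \<bar>\<theta>\<bar> ^ 3 * x * exp (- \<theta>\<^sup>2 * x / 480)"
proof -
  have "x powr (1 + \<theta>\<^sup>2 / 30) * exp (- (\<theta>\<^sup>2 / 240) * x) =
      x * x powr (\<theta>\<^sup>2 / 30) * exp (- (\<theta>\<^sup>2 / 240) * x)"
    using x_gt_2 by (simp add: powr_add)
  also have "\<dots> \<le> x * (16 * exp (\<theta>\<^sup>2 / 30 * x / 16)) * exp (- (\<theta>\<^sup>2 / 240) * x)"
    using x_gt_2 small_angle_squared_le_1[OF \<theta>_small]
    by (intro mult_right_mono mult_left_mono powr_le_mult_exp) auto
  also have "\<dots> = 16 * x * exp (- \<theta>\<^sup>2 * x / 480)"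
    by (simp add: exp_add[symmetric])
  finally have powr_exp_le: "x powr (1 + \<theta>\<^sup>2 / 30) * exp (- (\<theta>\<^sup>2 / 240) * x) \<le>
      16 * x * exp (- \<theta>\<^sup>2 * x / 480)" .
  have "norm (char_error \<theta> x) \<le>
      2 * residual_const * \<bar>\<theta>\<bar> ^ 3 * (x powr (1 + \<theta>\<^sup>2 / 30) * exp (- (\<theta>\<^sup>2 / 240) * x))"
    using norm_char_error_le_powr[OF \<theta>_small, of x] x_gt_2 by (simp add: mult.assoc)
  also have "\<dots> \<le> 2 * residual_const * \<bar>\<theta>\<bar> ^ 3 * (16 * x * exp (- \<theta>\<^sup>2 * x / 480))"
    using residual_const_pos by (intro mult_left_mono powr_exp_le) auto
  finally show ?thesis
    by (simp add: char_error_def gauss_approx_eq_exp[OF x_gt_2])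
qed

section \<open>Esseen's smoothing inequality\<close>

lemma Fubini_dominated:
  fixes f :: "'a \<Rightarrow> 'b \<Rightarrow> real"
  assumes "sigma_finite_measure M1" "sigma_finite_measure M2"
    and [measurable]: "case_prod f \<in> borel_measurable (M1 \<Otimes>\<^sub>M M2)"
    and integrable_g: "integrable M1 g" and integrable_h: "integrable M2 h"
    and dominated: "\<And>x y. x \<in> space M1 \<Longrightarrow> y \<in> space M2 \<Longrightarrow> \<bar>f x y\<bar> \<le> g x * h y"
  shows "(\<integral>x. (\<integral>y. f x y \<partial>M2) \<partial>M1) = (\<integral>y. (\<integral>x. f x y \<partial>M1) \<partial>M2)"
proof -
  interpret M1: sigma_finite_measure M1 by fact
  interpret M2: sigma_finite_measure M2 by fact
  interpret P: pair_sigma_finite M1 M2 ..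
  have [measurable]: "g \<in> borel_measurable M1" "h \<in> borel_measurable M2"
    using integrable_g integrable_h by auto
  have "integrable (M1 \<Otimes>\<^sub>M M2) (\<lambda>z. g (fst z) * h (snd z))"
  proof (rule P.Fubini_integrable)
    have "(\<lambda>x. \<integral>y. norm (g (fst (x, y)) * h (snd (x, y))) \<partial>M2) = (\<lambda>x. \<bar>g x\<bar> * (\<integral>y. \<bar>h y\<bar> \<partial>M2))"
      by (simp add: abs_mult)
    then show "integrable M1 (\<lambda>x. \<integral>y. norm (g (fst (x, y)) * h (snd (x, y))) \<partial>M2)"
      using integrable_g by simp
    show "AE x in M1. integrable M2 (\<lambda>y. g (fst (x, y)) * h (snd (x, y)))"
      using integrable_h by simp
  qed measurable
  then have "integrable (M1 \<Otimes>\<^sub>M M2) (case_prod f)"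
    by (rule Bochner_Integration.integrable_bound)
       (auto simp: space_pair_measure intro!: AE_I2 order_trans[OF dominated abs_ge_self])
  then show ?thesis
    by (rule P.Fubini_integral[symmetric])
qed

lemma one_minus_cos_le: "1 - cos y \<le> y\<^sup>2 / 2" for y :: real
proof -
  have "1 - cos y = 2 * (sin (y / 2))\<^sup>2"
    using cos_double_sin[of "y / 2"] by simp
  also have "(sin (y / 2))\<^sup>2 \<le> (y / 2)\<^sup>2"
    by (rule abs_le_square_iff[THEN iffD1]) (rule abs_sin_x_le_abs_x)
  finally show ?thesis by (simp add: power2_eq_square)
qed

lemma abs_sin_diff_le: "\<bar>sin a - sin b\<bar> \<le> \<bar>a - b\<bar>" for a b :: real
proof -
  have "\<bar>sin a - sin b\<bar> = 2 * \<bar>sin ((a - b) / 2)\<bar> * \<bar>cos ((a + b) / 2)\<bar>"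
    by (simp add: sin_diff_sin abs_mult)
  also have "\<dots> \<le> 2 * \<bar>sin ((a - b) / 2)\<bar> * 1"
    by (intro mult_left_mono) auto
  also have "\<dots> \<le> 2 * \<bar>(a - b) / 2\<bar>"
    using abs_sin_x_le_abs_x[of "(a - b) / 2"] by linarith
  finally show ?thesis by simp
qed

subsection \<open>The Fejer kernel\<close>

definition fejer :: "real \<Rightarrow> real" where
  "fejer y = (1 - cos y) / y\<^sup>2"

lemma fejer_nonneg: "0 \<le> fejer y"
  by (simp add: fejer_def)

lemma fejer_minus: "fejer (- y) = fejer y"
  by (simp add: fejer_def)

lemma measurable_fejer [measurable]: "fejer \<in> borel_measurable borel"
  unfolding fejer_def[abs_def] by measurable

lemma fejer_le: "fejer y \<le> 3 * inverse (1 + y\<^sup>2)"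
proof (cases "y = 0")
  case False
  have "(1 - cos y) * y\<^sup>2 \<le> 2 * y\<^sup>2"
    using cos_ge_minus_one[of y] by (intro mult_right_mono) auto
  moreover have "1 - cos y \<le> y\<^sup>2"
    using one_minus_cos_le[of y] zero_le_power2[of y] by linarith
  ultimately have "(1 - cos y) * (1 + y\<^sup>2) \<le> 3 * y\<^sup>2"
    by (simp add: algebra_simps)
  moreover have "1 + y\<^sup>2 > 0" by (simp add: add_pos_nonneg)
  ultimately show ?thesis
    using False by (simp add: fejer_def field_simps)
qed (simp add: fejer_def)

lemma integrable_fejer: "integrable lborel fejer"
proof (rule Bochner_Integration.integrable_bound)
  show "integrable lborel (\<lambda>y. 3 * inverse (1 + y\<^sup>2) :: real)"
    using integrable_inverse_1_plus_square
    by (intro integrable_mult_right) (simp add: einterval_eq_UNIV set_integrable_def)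
qed (use fejer_le fejer_nonneg in \<open>auto simp: add_pos_nonneg intro!: AE_I2\<close>)

lemma integrable_bounded_mult_fejer:
  assumes [measurable]: "f \<in> borel_measurable borel" and "\<And>y. \<bar>f y\<bar> \<le> B"
  shows "integrable lborel (\<lambda>y. f y * fejer y)"
proof (rule Bochner_Integration.integrable_bound)
  show "integrable lborel (\<lambda>y. B * fejer y)"
    using integrable_fejer by simp
  show "AE y in lborel. norm (f y * fejer y) \<le> norm (B * fejer y)"
    using order_trans[OF assms(2) abs_ge_self]
    by (auto simp: abs_mult fejer_nonneg intro!: AE_I2 mult_right_mono)
qed measurable

lemma integral_fejer_pos: "0 < (LBINT y. fejer y)"
proof -
  define c where "c = (1 - cos 1) / (4::real)"
  have cos_1: "cos 1 < cos (0::real)"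
    using pi_gt3 by (intro cos_monotone_0_pi) auto
  have "c \<le> fejer y" if "y \<in> {1..2}" for y
  proof -
    have "cos y \<le> cos 1"
      using that pi_gt3 by (intro cos_monotone_0_pi_le) auto
    moreover have "y\<^sup>2 \<le> 2\<^sup>2" using that by (intro power_mono) auto
    ultimately show ?thesis
      unfolding c_def fejer_def using that cos_1 by (intro frac_le) auto
  qed
  then have "(LBINT y:{1..2::real}. c) \<le> (LBINT y. fejer y)"
    unfolding set_lebesgue_integral_def
    by (intro integral_mono' integrable_fejer) (auto simp: indicator_def fejer_nonneg)
  then show ?thesis
    using cos_1 by (simp add: set_integral_const c_def)
qed

lemma fejer_concentration:
  assumes "q < 1"
  obtains A where "0 < A" "q * (LBINT y. fejer y) \<le> (LBINT y:{-A..A}. fejer y)"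
proof -
  have "(\<lambda>k. LBINT y. indicator {- real k..real k} y *\<^sub>R fejer y) \<longlonglongrightarrow> (LBINT y. fejer y)"
  proof (rule integral_dominated_convergence[where w = fejer])
    show "AE y in lborel. (\<lambda>k. indicator {- real k..real k} y *\<^sub>R fejer y) \<longlonglongrightarrow> fejer y"
    proof (intro AE_I2 tendsto_eventually)
      fix y :: real
      have "\<forall>\<^sub>F k in sequentially. \<bar>y\<bar> \<le> real k" by real_asymp
      then show "\<forall>\<^sub>F k in sequentially. indicator {- real k..real k} y *\<^sub>R fejer y = fejer y"
        by eventually_elim (auto simp: indicator_def)
    qed
  qed (auto intro: integrable_fejer simp: fejer_nonneg indicator_def)
  moreover have "q * (LBINT y. fejer y) < (LBINT y. fejer y)"
    using integral_fejer_pos assms by simp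
  ultimately have "\<forall>\<^sub>F k in sequentially. q * (LBINT y. fejer y) <
      (LBINT y:{- real k..real k}. fejer y)"
    unfolding set_lebesgue_integral_def by (rule order_tendstoD)
  moreover have "\<forall>\<^sub>F k in sequentially. 0 < real k" by real_asymp
  ultimately have "\<forall>\<^sub>F k in sequentially. 0 < real k \<and> q * (LBINT y. fejer y) \<le>
      (LBINT y:{- real k..real k}. fejer y)"
    by eventually_elim simp
  then show ?thesis
    using that eventually_happens'[OF sequentially_bot] by blast
qed

lemma set_integral_fejer_le: "(LBINT y:A. fejer y) \<le> (LBINT y. fejer y)"
  unfolding set_lebesgue_integral_def
  by (intro integral_mono' integrable_fejer) (auto simp: indicator_def fejer_nonneg)

definition fejer_radius :: real where
  "fejer_radius = (SOME A. 0 < A \<and> 3 / 4 * (LBINT y. fejer y) \<le> (LBINT y:{-A..A}. fejer y))"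

lemma fejer_radius:
  shows fejer_radius_pos: "0 < fejer_radius"
    and fejer_radius_mass: "3 / 4 * (LBINT y. fejer y) \<le>
        (LBINT y:{-fejer_radius..fejer_radius}. fejer y)"
proof -
  have "\<exists>A. 0 < A \<and> 3 / 4 * (LBINT y. fejer y) \<le> (LBINT y:{-A..A}. fejer y)"
    using fejer_concentration[of "3 / 4"] by auto
  from someI_ex[OF this]
  show "0 < fejer_radius"
    "3 / 4 * (LBINT y. fejer y) \<le> (LBINT y:{-fejer_radius..fejer_radius}. fejer y)"
    unfolding fejer_radius_def by blast+
qed

lemma fejer_cosine_transform:
  assumes "y \<noteq> 0"
  shows "(LBINT \<theta>:{0..1}. (1 - \<theta>) * cos (\<theta> * y)) = fejer y"
proof -
  have "(LBINT \<theta>:{0..1}. (1 - \<theta>) * cos (\<theta> * y)) =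
     ((1 - 1) * sin (1 * y) / y - cos (1 * y) / y\<^sup>2) -
         ((1 - 0) * sin (0 * y) / y - cos (0 * y) / y\<^sup>2)"
    using assms
    by (intro set_integral_FTC_Icc)
       (auto intro!: derivative_eq_intros continuous_intros simp: field_simps power2_eq_square)
  then show ?thesis
    by (simp add: fejer_def diff_divide_distrib)
qed

definition fejer_dual :: "real \<Rightarrow> real \<Rightarrow> real \<Rightarrow> real" where
  "fejer_dual a b \<theta> = (1 - \<theta>) * ((sin (\<theta> * b) - sin (\<theta> * a)) / \<theta>)"

lemma measurable_fejer_dual [measurable (raw)]:
  assumes [measurable]: "f \<in> borel_measurable N" "g \<in> borel_measurable N" "h \<in> borel_measurable N"
  shows "(\<lambda>x. fejer_dual (f x) (g x) (h x)) \<in> borel_measurable N"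
  unfolding fejer_dual_def by measurable

lemma abs_fejer_dual_le:
  assumes "\<theta> \<in> {0..1}"
  shows "\<bar>fejer_dual a b \<theta>\<bar> \<le> \<bar>b - a\<bar>"
proof (cases "\<theta> = 0")
  case False
  then have "0 < \<theta>" using assms by simp
  have "\<bar>(sin (\<theta> * b) - sin (\<theta> * a)) / \<theta>\<bar> \<le> \<bar>\<theta> * b - \<theta> * a\<bar> / \<theta>"
    using \<open>0 < \<theta>\<close> abs_sin_diff_le by (auto intro!: divide_right_mono)
  also have "\<dots> = \<bar>b - a\<bar>"
    using \<open>0 < \<theta>\<close> by (simp add: abs_mult flip: right_diff_distrib)
  finally have "(1 - \<theta>) * \<bar>(sin (\<theta> * b) - sin (\<theta> * a)) / \<theta>\<bar> \<le> 1 * \<bar>b - a\<bar>"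
    using assms by (intro mult_mono) auto
  then show ?thesis
    using assms by (simp add: fejer_dual_def abs_mult)
qed (simp add: fejer_dual_def)

lemma set_integral_cos_scaled:
  fixes a b \<theta> :: real
  assumes "\<theta> \<noteq> 0" "a \<le> b"
  shows "(LBINT y:{a..b}. cos (\<theta> * y)) = (sin (\<theta> * b) - sin (\<theta> * a)) / \<theta>"
proof -
  have "(LBINT y:{a..b}. cos (\<theta> * y)) = sin (\<theta> * b) / \<theta> - sin (\<theta> * a) / \<theta>"
    using assms
    by (intro set_integral_FTC_Icc) (auto intro!: derivative_eq_intros continuous_intros)
  then show ?thesis
    by (simp add: diff_divide_distrib)
qed

lemma set_integral_fejer:
  assumes "a \<le> b"
  shows "(LBINT y:{a..b}. fejer y) = (LBINT \<theta>:{0..1}. fejer_dual a b \<theta>)"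
proof -
  have "(LBINT y:{a..b}. fejer y) = (LBINT y:{a..b}. LBINT \<theta>:{0..1}. (1 - \<theta>) * cos (\<theta> * y))"
  proof (rule set_lebesgue_integral_cong_AE)
    show "AE y\<in>{a..b} in lborel. fejer y = (LBINT \<theta>:{0..1}. (1 - \<theta>) * cos (\<theta> * y))"
      by (rule AE_mp[OF AE_lborel_singleton[of 0]]) (auto simp: fejer_cosine_transform)
  qed (auto simp: set_lebesgue_integral_def)
  also have "\<dots> =
      (LBINT y. LBINT \<theta>. indicator {a..b} y * (indicator {0..1} \<theta> * ((1 - \<theta>) * cos (\<theta> * y))))"
    by (simp add: set_lebesgue_integral_def)
  also have "\<dots> =
      (LBINT \<theta>. LBINT y. indicator {a..b} y * (indicator {0..1} \<theta> * ((1 - \<theta>) * cos (\<theta> * y))))"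
  proof (rule Fubini_dominated)
    show "integrable lborel (indicator {a..b} :: real \<Rightarrow> real)"
      "integrable lborel (indicator {0..1} :: real \<Rightarrow> real)"
      by (auto simp: integrable_indicator_iff emeasure_lborel_Icc_eq)
    show "\<bar>indicator {a..b} y * (indicator {0..1} \<theta> * ((1 - \<theta>) * cos (\<theta> * y)))\<bar>
        \<le> indicator {a..b} y * indicator {0..1} \<theta>" for y \<theta> :: real
      by (auto simp: indicator_def abs_mult intro!: mult_le_one)
  qed (auto intro: lborel.sigma_finite_measure_axioms)
  also have "\<dots> = (LBINT \<theta>:{0..1}. (1 - \<theta>) * (LBINT y:{a..b}. cos (\<theta> * y)))"
  proof -
    have "indicator {a..b} y * (indicator {0..1} \<theta> * ((1 - \<theta>) * cos (\<theta> * y))) =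
        indicator {0..1} \<theta> * (1 - \<theta>) * (indicator {a..b} y * cos (\<theta> * y))" for y \<theta> :: real
      by simp
    then show ?thesis
      by (simp only: integral_mult_right_zero set_lebesgue_integral_def real_scaleR_def mult.assoc)
  qed
  also have "\<dots> = (LBINT \<theta>:{0..1}. fejer_dual a b \<theta>)"
  proof (rule set_lebesgue_integral_cong_AE)
    show "AE \<theta>\<in>{0..1} in lborel. (1 - \<theta>) * (LBINT y:{a..b}. cos (\<theta> * y)) = fejer_dual a b \<theta>"
      by (rule AE_mp[OF AE_lborel_singleton[of 0]])
         (use assms in \<open>auto simp: set_integral_cos_scaled fejer_dual_def\<close>)
  qed (auto simp: set_lebesgue_integral_def)
  finally show ?thesis .
qed

subsection \<open>Smoothing of distribution functions\<close>

definition fejer_average :: "real \<Rightarrow> (real \<Rightarrow> real) \<Rightarrow> real \<Rightarrow> real" where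
  "fejer_average T h s = (LBINT y. h (s - y / T) * fejer y)"

definition fejer_dual_mean :: "real measure \<Rightarrow> real \<Rightarrow> real \<Rightarrow> real \<Rightarrow> real \<Rightarrow> real" where
  "fejer_dual_mean M T s' s \<theta> = (\<integral>x. fejer_dual (T * (s' - x)) (T * (s - x)) \<theta> \<partial>M)"

lemma fejer_average_diff:
  assumes [measurable]: "g \<in> borel_measurable borel" "h \<in> borel_measurable borel"
    and "\<And>r. \<bar>g r\<bar> \<le> B" "\<And>r. \<bar>h r\<bar> \<le> B"
  shows "fejer_average T (\<lambda>r. g r - h r) s = fejer_average T g s - fejer_average T h s"
proof -
  have "integrable lborel (\<lambda>y. g (s - y / T) * fejer y)"
    "integrable lborel (\<lambda>y. h (s - y / T) * fejer y)"
    by (rule integrable_bounded_mult_fejer[where B = B]; simp add: assms)+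
  then show ?thesis
    by (simp add: fejer_average_def left_diff_distrib)
qed

lemma fejer_average_reflect: "fejer_average T (\<lambda>r. h (- r)) s = fejer_average T h (- s)"
  unfolding fejer_average_def
  by (subst lborel_integral_real_affine[where c = "-1" and t = 0]) (simp_all add: fejer_minus)

context real_distribution
begin

lemma measurable_cdf [measurable]: "cdf M \<in> borel_measurable borel"
  by (rule borel_measurable_mono) (auto simp: mono_def cdf_nondecreasing)

lemma abs_cdf_le_1: "\<bar>cdf M x\<bar> \<le> 1"
  by (simp add: cdf_nonneg cdf_bounded_prob)

lemma expectation_sin_shift: "(\<integral>x. sin (c * (s - x)) \<partial>M) = Im (iexp (c * s) * cnj (char M c))"
proof -
  have "iexp (c * s) * cnj (char M c) = (\<integral>x. iexp (c * s) * cnj (iexp (c * x)) \<partial>M)"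
    unfolding char_def by (simp add: integral_cnj[symmetric])
  also have "\<dots> = (\<integral>x. iexp (c * (s - x)) \<partial>M)"
    by (intro Bochner_Integration.integral_cong refl)
       (simp add: exp_cnj exp_add[symmetric] algebra_simps)
  also have "Im \<dots> = (\<integral>x. Im (iexp (c * (s - x))) \<partial>M)"
    by (intro integral_Im[symmetric] integrable_iexp) auto
  finally show ?thesis
    by (simp add: Im_exp)
qed

lemma fejer_dual_mean_eq_char:
  "fejer_dual_mean M T s' s \<theta> =
    (1 - \<theta>) / \<theta> * Im ((iexp (\<theta> * T * s) - iexp (\<theta> * T * s')) * cnj (char M (\<theta> * T)))"
proof -
  have [measurable_cong]: "sets M = sets borel" by simp
  have "integrable M (\<lambda>x. sin (\<theta> * T * (r - x)))" for r
    by (rule integrable_const_bound[where B = 1]) auto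
  then have "fejer_dual_mean M T s' s \<theta> =
      (1 - \<theta>) / \<theta> * ((\<integral>x. sin (\<theta> * T * (s - x)) \<partial>M) - (\<integral>x. sin (\<theta> * T * (s' - x)) \<partial>M))"
    by (simp add: fejer_dual_mean_def fejer_dual_def mult.assoc[symmetric]
        Bochner_Integration.integral_diff)
  then show ?thesis
    by (simp add: expectation_sin_shift left_diff_distrib)
qed

lemma set_integrable_fejer_dual_mean: "set_integrable lborel {0..1} (fejer_dual_mean M T s' s)"
proof (rule set_integrable_Icc_bounded[where B = "\<bar>T * (s - s')\<bar>"])
  have [measurable_cong]: "sets M = sets borel" by simp
  show "fejer_dual_mean M T s' s \<in> borel_measurable borel"
    unfolding fejer_dual_mean_def[abs_def] by measurable
  fix \<theta> :: real assume "\<theta> \<in> {0..1}"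
  then have fejer_dual_le: "\<bar>fejer_dual (T * (s' - x)) (T * (s - x)) \<theta>\<bar> \<le> \<bar>T * (s - s')\<bar>" for x
    using abs_fejer_dual_le[of \<theta> "T * (s' - x)" "T * (s - x)"] by (simp add: algebra_simps)
  have "norm (fejer_dual_mean M T s' s \<theta>) \<le>
      (\<integral>x. norm (fejer_dual (T * (s' - x)) (T * (s - x)) \<theta>) \<partial>M)"
    unfolding fejer_dual_mean_def by (rule integral_norm_bound)
  also have "\<dots> \<le> \<bar>T * (s - s')\<bar>"
    using fejer_dual_le
    by (intro integral_le_const integrable_norm integrable_const_bound[where B = "\<bar>T * (s - s')\<bar>"])
      auto
  finally show "norm (fejer_dual_mean M T s' s \<theta>) \<le> \<bar>T * (s - s')\<bar>" .
qed

lemma integral_cdf_diff_kernel: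
  assumes "0 < T" "s' < s" and integrable_K: "integrable lborel K"
  shows "(LBINT y. (cdf M (s - y / T) - cdf M (s' - y / T)) * K y) =
    (\<integral>x. (LBINT y:{T * (s' - x)..T * (s - x)}. K y) \<partial>M)"
proof -
  have [measurable_cong]: "sets M = sets borel" by simp
  have [measurable]: "K \<in> borel_measurable borel" using integrable_K by simp
  let ?f = "\<lambda>y x. (if s' - y / T < x \<and> x \<le> s - y / T then 1 else 0) * K y"
  have inner_y: "(LBINT y. ?f y x) = (LBINT y:{T * (s' - x)..T * (s - x)}. K y)" for x
  proof -
    have "?f y x = indicator {T * (s' - x)<..T * (s - x)} y *\<^sub>R K y" for y
      using \<open>0 < T\<close> by (auto simp: indicator_def field_simps)
    then have "(LBINT y. ?f y x) = (LBINT y:{T * (s' - x)<..T * (s - x)}. K y)"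
      by (simp only: set_lebesgue_integral_def)
    also have "\<dots> = (LBINT y:{T * (s' - x)..T * (s - x)}. K y)"
      by (rule set_integral_discrete_difference[of "{T * (s' - x)}"]) auto
    finally show ?thesis .
  qed
  have inner_x: "(cdf M (s - y / T) - cdf M (s' - y / T)) * K y = (\<integral>x. ?f y x \<partial>M)" for y
  proof -
    have "?f y x = indicator {s' - y / T<..s - y / T} x * K y" for x
      by (simp add: indicator_def)
    then have "(\<integral>x. ?f y x \<partial>M) = prob {s' - y / T<..s - y / T} * K y"
      by (simp only: integral_mult_left_zero) simp
    also have "prob {s' - y / T<..s - y / T} = cdf M (s - y / T) - cdf M (s' - y / T)"
      using cdf_diff_eq[of "s' - y / T" "s - y / T"] \<open>s' < s\<close> by simp
    finally show ?thesis by (rule sym)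
  qed
  have "(LBINT y. \<integral>x. ?f y x \<partial>M) = (\<integral>x. (LBINT y. ?f y x) \<partial>M)"
    by (rule Fubini_dominated[where g = "\<lambda>y. \<bar>K y\<bar>" and h = "\<lambda>_. 1"])
       (auto intro: integrable_K sigma_finite_measure_axioms lborel.sigma_finite_measure_axioms)
  then show ?thesis
    by (simp only: inner_x inner_y)
qed

lemma fejer_average_cdf_diff:
  assumes "0 < T" "s' < s"
  shows "fejer_average T (cdf M) s - fejer_average T (cdf M) s' =
      (LBINT \<theta>:{0..1}. fejer_dual_mean M T s' s \<theta>)"
proof -
  have [measurable_cong]: "sets M = sets borel" by simp
  let ?f = "\<lambda>x \<theta>. indicator {0..1} \<theta> * fejer_dual (T * (s' - x)) (T * (s - x)) \<theta>"
  have "integrable lborel (\<lambda>y. cdf M (r - y / T) * fejer y)" for r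
    by (rule integrable_bounded_mult_fejer[OF _ abs_cdf_le_1]) measurable
  then have "fejer_average T (cdf M) s - fejer_average T (cdf M) s' =
      (LBINT y. (cdf M (s - y / T) - cdf M (s' - y / T)) * fejer y)"
    by (simp add: fejer_average_def left_diff_distrib)
  also have "\<dots> = (\<integral>x. (LBINT y:{T * (s' - x)..T * (s - x)}. fejer y) \<partial>M)"
    by (rule integral_cdf_diff_kernel[OF assms integrable_fejer])
  also have "\<dots> = (\<integral>x. (LBINT \<theta>. ?f x \<theta>) \<partial>M)"
  proof -
    have "T * (s' - x) \<le> T * (s - x)" for x
      using assms by (intro mult_left_mono) auto
    then show ?thesis
      by (simp only: set_integral_fejer) (simp only: set_lebesgue_integral_def real_scaleR_def)
  qed
  also have "\<dots> = (LBINT \<theta>. \<integral>x. ?f x \<theta> \<partial>M)"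
  proof (rule Fubini_dominated[where g = "\<lambda>_. T * (s - s')" and h = "indicator {0..1}"])
    show "integrable lborel (indicator {0..1} :: real \<Rightarrow> real)"
      by (auto simp: integrable_indicator_iff emeasure_lborel_Icc_eq)
    fix x \<theta> :: real
    have "\<bar>T * (s - x) - T * (s' - x)\<bar> = T * (s - s')"
      using assms by (simp flip: right_diff_distrib)
    then show "\<bar>?f x \<theta>\<bar> \<le> T * (s - s') * indicator {0..1} \<theta>"
      using abs_fejer_dual_le[of \<theta> "T * (s' - x)" "T * (s - x)"] by (auto simp: indicator_def)
  qed (auto intro: sigma_finite_measure_axioms lborel.sigma_finite_measure_axioms)
  finally show ?thesis
    by (simp add: set_lebesgue_integral_def fejer_dual_mean_def)
qed

lemma fejer_average_cdf_at_bot: "(\<lambda>k. fejer_average T (cdf M) (- real k)) \<longlonglongrightarrow> 0"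
proof -
  have "(\<lambda>k. LBINT y. cdf M (- real k - y / T) * fejer y) \<longlonglongrightarrow> (LBINT y::real. 0)"
  proof (rule integral_dominated_convergence[where w = fejer])
    show "AE y in lborel. (\<lambda>k. cdf M (- real k - y / T) * fejer y) \<longlonglongrightarrow> 0"
    proof (rule AE_I2)
      fix y :: real
      have "filterlim (\<lambda>k. - real k - y / T) at_bot sequentially"
        by real_asymp
      then show "(\<lambda>k. cdf M (- real k - y / T) * fejer y) \<longlonglongrightarrow> 0"
        by (intro tendsto_mult_left_zero filterlim_compose[OF cdf_lim_at_bot])
    qed
    show "AE y in lborel. norm (cdf M (- real k - y / T) * fejer y) \<le> fejer y" for k
      by (simp add: abs_mult fejer_nonneg abs_cdf_le_1 mult_left_le_one_le)
  qed (auto intro: integrable_fejer)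
  then show ?thesis
    by (simp add: fejer_average_def)
qed

end

subsection \<open>From smoothed to pointwise differences\<close>

lemma integral_kernel_ge:
  fixes f K :: "'a \<Rightarrow> real"
  assumes A_sets: "A \<in> sets M" and kernel: "integrable M K" "\<And>x. 0 \<le> K x"
    and integrable_fK: "integrable M (\<lambda>x. f x * K x)"
    and f_ge_on_A: "\<And>x. x \<in> A \<Longrightarrow> c \<le> f x" and f_ge: "\<And>x. - \<eta> \<le> f x"
  shows "(c + \<eta>) * (LINT x:A|M. K x) - \<eta> * (LINT x|M. K x) \<le> (LINT x|M. f x * K x)"
proof -
  have integrable_A: "integrable M (\<lambda>x. indicator A x * K x)"
    using integrable_mult_indicator[OF A_sets kernel(1)] by simp
  have "(c + \<eta>) * (LINT x:A|M. K x) - \<eta> * (LINT x|M. K x) =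
      (LINT x|M. (c + \<eta>) * (indicator A x * K x) - \<eta> * K x)"
    using integrable_A kernel by (simp add: set_lebesgue_integral_def)
  also have "\<dots> \<le> (LINT x|M. f x * K x)"
  proof (rule integral_mono)
    show "integrable M (\<lambda>x. (c + \<eta>) * (indicator A x * K x) - \<eta> * K x)"
      using integrable_A kernel by simp
    show "(c + \<eta>) * (indicator A x * K x) - \<eta> * K x \<le> f x * K x" for x
      using mult_right_mono[OF f_ge_on_A kernel(2), of x x]
        mult_right_mono[OF f_ge kernel(2), of x x]
      by (cases "x \<in> A") (auto simp: algebra_simps)
  qed (rule integrable_fK)
  finally show ?thesis .
qed

context
  fixes T m :: real
  assumes T_pos: "0 < T" and m_nonneg: "0 \<le> m"
begin

lemma fejer_average_ge:
  assumes [measurable]: "\<Delta> \<in> borel_measurable borel" and abs_\<Delta>_le: "\<And>r. \<bar>\<Delta> r\<bar> \<le> \<eta>"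
    and lipschitz_below: "\<And>u v. u \<le> v \<Longrightarrow> \<Delta> u - m * (v - u) \<le> \<Delta> v"
  shows "(3 / 4 * \<Delta> r - 2 * fejer_radius * m / T - \<eta> / 4) * (LBINT y. fejer y) \<le>
    fejer_average T \<Delta> (r + fejer_radius / T)"
proof -
  define W where "W = (LBINT y. fejer y)"
  define p where "p = (LBINT y:{-fejer_radius..fejer_radius}. fejer y)"
  define k where "k = m * (2 * fejer_radius / T)"
  have p_bounds: "3 / 4 * W \<le> p" "p \<le> W"
    unfolding W_def p_def by (rule fejer_radius_mass set_integral_fejer_le)+
  have "0 \<le> (\<Delta> r + \<eta>) * (p - 3 / 4 * W)" "0 \<le> k * (W - p)"
    using p_bounds abs_\<Delta>_le[of r] fejer_radius_pos T_pos m_nonneg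
    by (auto simp: k_def intro!: mult_nonneg_nonneg)
  then have "(3 / 4 * \<Delta> r - k - \<eta> / 4) * W \<le> (\<Delta> r - k + \<eta>) * p - \<eta> * W"
    by (simp add: algebra_simps)
  also have "\<dots> \<le> fejer_average T \<Delta> (r + fejer_radius / T)"
    unfolding W_def p_def fejer_average_def
  proof (rule integral_kernel_ge)
    show "integrable lborel (\<lambda>y. \<Delta> (r + fejer_radius / T - y / T) * fejer y)"
      by (rule integrable_bounded_mult_fejer[OF _ abs_\<Delta>_le]) measurable
    show "- \<eta> \<le> \<Delta> (r + fejer_radius / T - y / T)" for y
      using abs_\<Delta>_le[of "r + fejer_radius / T - y / T"] by linarith
    fix y assume y_in: "y \<in> {-fejer_radius..fejer_radius}"
    define u where "u = r + fejer_radius / T - y / T"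
    have "u - r = (fejer_radius - y) / T"
      by (simp add: u_def diff_divide_distrib)
    then have u_bounds: "0 \<le> u - r" "u - r \<le> 2 * fejer_radius / T"
      using y_in T_pos by (auto intro!: divide_right_mono)
    have "\<Delta> r - k \<le> \<Delta> r - m * (u - r)"
      using mult_left_mono[OF u_bounds(2) m_nonneg] by (simp add: k_def)
    also have "\<dots> \<le> \<Delta> u"
      using u_bounds by (intro lipschitz_below) simp
    finally show "\<Delta> r - k \<le> \<Delta> (r + fejer_radius / T - y / T)"
      by (simp add: u_def)
  qed (auto intro: integrable_fejer fejer_nonneg)
  finally show ?thesis
    by (simp add: W_def k_def mult_ac)
qed

lemma le_fejer_average_bound:
  assumes "\<Delta> \<in> borel_measurable borel" "\<And>r. \<bar>\<Delta> r\<bar> \<le> \<eta>"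
    and "\<And>u v. u \<le> v \<Longrightarrow> \<Delta> u - m * (v - u) \<le> \<Delta> v"
    and average: "\<And>r. fejer_average T \<Delta> r \<le> J"
  shows "\<Delta> r \<le> 4 / 3 * (J / (LBINT y. fejer y)) + 4 / 3 * (2 * fejer_radius * m / T) + \<eta> / 3"
proof -
  have "(3 / 4 * \<Delta> r - 2 * fejer_radius * m / T - \<eta> / 4) * (LBINT y. fejer y) \<le> J"
    using fejer_average_ge[OF assms(1-3)] average by (rule order_trans)
  then have "3 / 4 * \<Delta> r - 2 * fejer_radius * m / T - \<eta> / 4 \<le> J / (LBINT y. fejer y)"
    by (simp only: pos_le_divide_eq[OF integral_fejer_pos])
  then show ?thesis by linarith
qed

lemma abs_le_fejer_average_bound:
  assumes measurable_\<Delta> [measurable]: "\<Delta> \<in> borel_measurable borel" and abs_\<Delta>_le_B: "\<And>r. \<bar>\<Delta> r\<bar> \<le> B"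
    and lipschitz_below: "\<And>u v. u \<le> v \<Longrightarrow> \<Delta> u - m * (v - u) \<le> \<Delta> v"
    and average: "\<And>r. \<bar>fejer_average T \<Delta> r\<bar> \<le> J"
  shows "\<bar>\<Delta> r\<bar> \<le> 2 * J / (LBINT y. fejer y) + 4 * fejer_radius * m / T"
proof -
  define \<eta> where "\<eta> = (SUP r. \<bar>\<Delta> r\<bar>)"
  define b where "b = 4 / 3 * (J / (LBINT y. fejer y)) + 4 / 3 * (2 * fejer_radius * m / T) + \<eta> / 3"
  have abs_\<Delta>_le: "\<bar>\<Delta> r\<bar> \<le> \<eta>" for r
    unfolding \<eta>_def using abs_\<Delta>_le_B by (intro cSUP_upper bdd_aboveI[where M = B]) auto
  have "\<Delta> r \<le> b" for r
    unfolding b_def using average abs_le_iff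
    by (intro le_fejer_average_bound[OF measurable_\<Delta> abs_\<Delta>_le lipschitz_below]) auto
  moreover have "- \<Delta> r \<le> b" for r
  proof -
    have "- \<Delta> (- (- r)) \<le> b"
      unfolding b_def
    proof (rule le_fejer_average_bound[where \<Delta> = "\<lambda>u. - \<Delta> (- u)"])
      show "- \<Delta> (- u) - m * (v - u) \<le> - \<Delta> (- v)" if "u \<le> v" for u v
        using lipschitz_below[of "- v" "- u"] that by simp
      have "fejer_average T (\<lambda>u. - \<Delta> (- u)) s = - fejer_average T \<Delta> (- s)" for s
        using fejer_average_reflect[of T \<Delta> s] by (simp add: fejer_average_def)
      then show "fejer_average T (\<lambda>u. - \<Delta> (- u)) s \<le> J" for s
        using average[of "- s"] by simp
    qed (use abs_\<Delta>_le in auto)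
    then show ?thesis by simp
  qed
  ultimately have "(SUP r. \<bar>\<Delta> r\<bar>) \<le> b"
    by (intro cSUP_least) (auto simp: abs_le_iff)
  then have "\<eta> \<le> 2 * (J / (LBINT y. fejer y)) + 2 * (2 * fejer_radius * m / T)"
    unfolding b_def \<eta>_def[symmetric] by linarith
  then show ?thesis
    using abs_\<Delta>_le[of r] by simp
qed

end

subsection \<open>The smoothing inequality\<close>

definition esseen_const :: real where
  "esseen_const = 4 / (LBINT y. fejer y) + 4 * fejer_radius"

lemma esseen_const_pos: "0 < esseen_const"
  using integral_fejer_pos fejer_radius_pos by (simp add: esseen_const_def add_pos_pos)

lemma abs_cdf_diff_le_1:
  assumes "real_distribution \<mu>" "real_distribution \<nu>"
  shows "\<bar>cdf \<mu> x - cdf \<nu> x\<bar> \<le> 1"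
proof -
  interpret \<mu>: real_distribution \<mu> by fact
  interpret \<nu>: real_distribution \<nu> by fact
  show ?thesis
    using \<mu>.cdf_nonneg[of x] \<mu>.cdf_bounded_prob[of x] \<nu>.cdf_nonneg[of x] \<nu>.cdf_bounded_prob[of x]
    by linarith
qed

context
  fixes \<mu> \<nu> :: "real measure" and T :: real and e :: "real \<Rightarrow> real"
  assumes \<mu>_distr: "real_distribution \<mu>" and \<nu>_distr: "real_distribution \<nu>" and T_pos: "0 < T"
    and integrable_e: "set_integrable lborel {0..1} e"
    and e_nonneg: "\<And>\<theta>. \<theta> \<in> {0..1} \<Longrightarrow> 0 \<le> e \<theta>"
    and char_diff: "\<And>\<theta>. 0 < \<theta> \<Longrightarrow> \<theta> \<le> 1 \<Longrightarrow> cmod (char \<mu> (\<theta> * T) - char \<nu> (\<theta> * T)) \<le> \<theta> * e \<theta>"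
begin

interpretation \<mu>: real_distribution \<mu> by (rule \<mu>_distr)
interpretation \<nu>: real_distribution \<nu> by (rule \<nu>_distr)

lemma fejer_dual_mean_diff_le:
  assumes \<theta>_in: "\<theta> \<in> {0..1}"
  shows "\<bar>fejer_dual_mean \<mu> T s' s \<theta> - fejer_dual_mean \<nu> T s' s \<theta>\<bar> \<le> 2 * e \<theta>"
proof (cases "\<theta> = 0")
  case False
  then have "0 < \<theta>" "\<theta> \<le> 1" using \<theta>_in by auto
  let ?w = "(iexp (\<theta> * T * s) - iexp (\<theta> * T * s')) * cnj (char \<mu> (\<theta> * T) - char \<nu> (\<theta> * T))"
  have "\<bar>Im ?w\<bar> \<le>
      cmod (iexp (\<theta> * T * s) - iexp (\<theta> * T * s')) * cmod (char \<mu> (\<theta> * T) - char \<nu> (\<theta> * T))"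
    using abs_Im_le_cmod[of ?w] by (simp only: norm_mult complex_mod_cnj)
  also have "\<dots> \<le> 2 * (\<theta> * e \<theta>)"
    using norm_triangle_ineq4[of "iexp (\<theta> * T * s)" "iexp (\<theta> * T * s')"] \<open>0 < \<theta>\<close> \<open>\<theta> \<le> 1\<close>
    by (intro mult_mono char_diff) auto
  finally have Im_le: "\<bar>Im ?w\<bar> \<le> 2 * (\<theta> * e \<theta>)" .
  have "fejer_dual_mean \<mu> T s' s \<theta> - fejer_dual_mean \<nu> T s' s \<theta> = (1 - \<theta>) / \<theta> * Im ?w"
    unfolding \<mu>.fejer_dual_mean_eq_char \<nu>.fejer_dual_mean_eq_char
    by (simp only: right_diff_distrib complex_cnj_diff minus_complex.sel)
  also have "\<bar>\<dots>\<bar> \<le> 1 / \<theta> * (2 * (\<theta> * e \<theta>))"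
    unfolding abs_mult
    using Im_le \<open>0 < \<theta>\<close> \<open>\<theta> \<le> 1\<close> by (intro mult_mono) (auto simp: divide_right_mono)
  finally show ?thesis
    using \<open>0 < \<theta>\<close> by simp
qed (use e_nonneg[OF \<theta>_in] in \<open>simp add: fejer_dual_mean_def fejer_dual_def\<close>)

lemma fejer_average_cdf_increment_diff_le:
  assumes "s' < s"
  shows "\<bar>(fejer_average T (cdf \<mu>) s - fejer_average T (cdf \<mu>) s') -
    (fejer_average T (cdf \<nu>) s - fejer_average T (cdf \<nu>) s')\<bar> \<le> 2 * (LBINT \<theta>:{0..1}. e \<theta>)"
proof -
  have "(fejer_average T (cdf \<mu>) s - fejer_average T (cdf \<mu>) s') -
      (fejer_average T (cdf \<nu>) s - fejer_average T (cdf \<nu>) s') =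
      (LBINT \<theta>:{0..1}. fejer_dual_mean \<mu> T s' s \<theta> - fejer_dual_mean \<nu> T s' s \<theta>)"
    using \<mu>.set_integrable_fejer_dual_mean \<nu>.set_integrable_fejer_dual_mean
    by (simp add: \<mu>.fejer_average_cdf_diff \<nu>.fejer_average_cdf_diff T_pos assms)
  also have "\<bar>\<dots>\<bar> \<le> (LBINT \<theta>:{0..1}. 2 * e \<theta>)"
    unfolding real_norm_def[symmetric]
    by (rule norm_set_integral_le) (use integrable_e fejer_dual_mean_diff_le in auto)
  finally show ?thesis by simp
qed

lemma fejer_average_cdf_diff_le:
  "\<bar>fejer_average T (cdf \<mu>) s - fejer_average T (cdf \<nu>) s\<bar> \<le> 2 * (LBINT \<theta>:{0..1}. e \<theta>)"
proof (rule tendsto_upperbound)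
  have "(\<lambda>k. \<bar>(fejer_average T (cdf \<mu>) s - fejer_average T (cdf \<mu>) (- real k)) -
      (fejer_average T (cdf \<nu>) s - fejer_average T (cdf \<nu>) (- real k))\<bar>)
      \<longlonglongrightarrow> \<bar>(fejer_average T (cdf \<mu>) s - 0) - (fejer_average T (cdf \<nu>) s - 0)\<bar>"
    by (intro tendsto_intros \<mu>.fejer_average_cdf_at_bot \<nu>.fejer_average_cdf_at_bot)
  then show "(\<lambda>k. \<bar>(fejer_average T (cdf \<mu>) s - fejer_average T (cdf \<mu>) (- real k)) -
      (fejer_average T (cdf \<nu>) s - fejer_average T (cdf \<nu>) (- real k))\<bar>)
      \<longlonglongrightarrow> \<bar>fejer_average T (cdf \<mu>) s - fejer_average T (cdf \<nu>) s\<bar>"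
    by simp
  have "\<forall>\<^sub>F k in sequentially. - real k < s"
    by real_asymp
  then show "\<forall>\<^sub>F k in sequentially. 
      \<bar>(fejer_average T (cdf \<mu>) s - fejer_average T (cdf \<mu>) (- real k)) -
      (fejer_average T (cdf \<nu>) s - fejer_average T (cdf \<nu>) (- real k))\<bar> \<le> 2 * (LBINT \<theta>:{0..1}. e \<theta>)"
    by eventually_elim (rule fejer_average_cdf_increment_diff_le)
qed simp

lemma esseen_smoothing:
  assumes m_nonneg: "0 \<le> m" and lipschitz: "\<And>a b. a \<le> b \<Longrightarrow> cdf \<nu> b - cdf \<nu> a \<le> m * (b - a)"
  shows "\<bar>cdf \<mu> s - cdf \<nu> s\<bar> \<le> esseen_const * ((LBINT \<theta>:{0..1}. e \<theta>) + m / T)"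
proof -
  let ?J = "LBINT \<theta>:{0..1}. e \<theta>" and ?W = "LBINT y. fejer y"
  have "\<bar>cdf \<mu> s - cdf \<nu> s\<bar> \<le> 2 * (2 * ?J) / ?W + 4 * fejer_radius * m / T"
  proof (rule abs_le_fejer_average_bound[OF T_pos m_nonneg, where \<Delta> = "\<lambda>r. cdf \<mu> r - cdf \<nu> r"])
    show "cdf \<mu> u - cdf \<nu> u - m * (v - u) \<le> cdf \<mu> v - cdf \<nu> v" if "u \<le> v" for u v
      using \<mu>.cdf_nondecreasing[OF that] lipschitz[OF that] by linarith
    show "\<bar>cdf \<mu> r - cdf \<nu> r\<bar> \<le> 1" for r
      by (rule abs_cdf_diff_le_1[OF \<mu>_distr \<nu>_distr])
    show "\<bar>fejer_average T (\<lambda>r. cdf \<mu> r - cdf \<nu> r) r\<bar> \<le> 2 * ?J" for r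
      using fejer_average_cdf_diff_le
      by (subst fejer_average_diff[where B = 1]) (auto simp: \<mu>.abs_cdf_le_1 \<nu>.abs_cdf_le_1)
  qed measurable
  also have "\<dots> \<le> (4 / ?W + 4 * fejer_radius) * ?J + (4 / ?W + 4 * fejer_radius) * (m / T)"
  proof -
    have "0 \<le> 4 * fejer_radius * ?J" "0 \<le> 4 / ?W * (m / T)"
      using integral_fejer_pos fejer_radius_pos T_pos m_nonneg e_nonneg
      by (auto intro!: mult_nonneg_nonneg set_integral_nonneg)
    then show ?thesis
      by (simp add: algebra_simps)
  qed
  finally show ?thesis
    by (simp add: esseen_const_def distrib_left)
qed

end

section \<open>The standard normal distribution function\<close>

interpretation std_normal: real_distribution std_normal_distribution
  by (rule real_dist_normal_dist)

lemma Phi_eq_cdf: "Phi = cdf std_normal_distribution"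
  by (simp add: fun_eq_iff Phi_def cdf_def)

lemma Phi_mono: "a \<le> b \<Longrightarrow> Phi a \<le> Phi b"
  unfolding Phi_eq_cdf by (rule std_normal.cdf_nondecreasing)

lemma Phi_nonneg: "0 \<le> Phi a"
  unfolding Phi_eq_cdf by (rule std_normal.cdf_nonneg)

lemma Phi_le_1: "Phi a \<le> 1"
  unfolding Phi_eq_cdf by (rule std_normal.cdf_bounded_prob)

lemma Phi_diff_le:
  assumes "a \<le> b" "\<And>z. z \<in> {a..b} \<Longrightarrow> std_normal_density z \<le> m"
  shows "Phi b - Phi a \<le> m * (b - a)"
proof (cases "a = b")
  case False
  then have "a < b" using \<open>a \<le> b\<close> by simp
  have integrable: "set_integrable lborel {a<..b} std_normal_density"
    using integrable_mult_indicator[of "{a<..b}", OF _ integrable_normal_density[of 1 0]]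
    by (simp add: set_integrable_def)
  have "Phi b - Phi a = measure std_normal_distribution {a<..b}"
    unfolding Phi_eq_cdf using std_normal.cdf_diff_eq[OF \<open>a < b\<close>] by simp
  also have "\<dots> = (\<integral>z. indicator {a<..b} z \<partial>std_normal_distribution)"
    by simp
  also have "\<dots> = (LBINT z:{a<..b}. std_normal_density z)"
    unfolding set_lebesgue_integral_def by (subst integral_density) (auto simp: mult.commute)
  also have "\<dots> = (LBINT z:{a..b}. std_normal_density z)"
    by (rule set_integral_discrete_difference[of "{a}"]) auto
  also have "\<dots> \<le> (LBINT z:{a..b}. m)"
    using assms(2) normal_density_nonneg[of 0 1]
    by (intro set_integral_mono set_integrable_Icc_bounded[where B = m]
      set_integrable_Icc_bounded[where B = "\<bar>m\<bar>"]) auto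
  also have "\<dots> = m * (b - a)"
    using \<open>a \<le> b\<close> by (simp add: set_integral_const)
  finally show ?thesis .
qed simp

lemma abs_Phi_diff_le:
  assumes "\<And>z. z \<in> {min a b..max a b} \<Longrightarrow> std_normal_density z \<le> m"
  shows "\<bar>Phi b - Phi a\<bar> \<le> m * \<bar>b - a\<bar>"
proof (cases "a \<le> b")
  case True
  then show ?thesis
    using assms Phi_diff_le[of a b m] Phi_mono[of a b] by simp
next
  case False
  then show ?thesis
    using assms Phi_diff_le[of b a m] Phi_mono[of b a] by simp
qed

lemma std_normal_density_le_1: "std_normal_density z \<le> 1"
proof -
  have "1 \<le> sqrt (2 * pi)" using pi_gt3 by simp
  then have "1 / sqrt (2 * pi) * exp (- z\<^sup>2 / 2) \<le> 1 * 1"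
    by (intro mult_mono) (auto simp: divide_le_eq)
  then show ?thesis by (simp add: std_normal_density_def)
qed

lemma square_mult_std_normal_density_le_1: "z\<^sup>2 * std_normal_density z \<le> 1"
proof -
  have "z\<^sup>2 / 2 * exp (- z\<^sup>2 / 2) \<le> 1"
    using exp_ge_add_one_self[of "z\<^sup>2 / 2"] by (simp add: exp_minus field_simps)
  then have "z\<^sup>2 * exp (- z\<^sup>2 / 2) \<le> 2" by simp
  also have "2 \<le> sqrt (2 * pi)" using pi_gt3 by (intro real_le_rsqrt) simp
  finally show ?thesis by (simp add: std_normal_density_def field_simps)
qed

lemma Phi_lipschitz: "\<bar>Phi b - Phi a\<bar> \<le> \<bar>b - a\<bar>"
  using abs_Phi_diff_le[of a b 1] std_normal_density_le_1 by simp

lemma Phi_diff_le_inverse_square: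
  assumes "0 < r" "\<And>z. z \<in> {min a b..max a b} \<Longrightarrow> r \<le> z\<^sup>2"
  shows "\<bar>Phi b - Phi a\<bar> \<le> \<bar>b - a\<bar> / r"
proof -
  have "std_normal_density z \<le> 1 / r" if "z \<in> {min a b..max a b}" for z
  proof -
    have "r * std_normal_density z \<le> z\<^sup>2 * std_normal_density z"
      using assms(2)[OF that] by (intro mult_right_mono) auto
    also have "\<dots> \<le> 1" by (rule square_mult_std_normal_density_le_1)
    finally show ?thesis using \<open>0 < r\<close> by (simp add: field_simps)
  qed
  then show ?thesis
    using abs_Phi_diff_le[of a b "1 / r"] by simp
qed

lemma Phi_tail:
  assumes "0 < s"
  shows "1 - Phi s \<le> 1 / s\<^sup>2" "Phi (- s) \<le> 1 / s\<^sup>2"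
proof -
  have distributed_id: "distributed std_normal_distribution lborel (\<lambda>z. z) std_normal_density"
    by (auto simp: distributed_def distr_id2)
  have "measure std_normal_distribution
        {z \<in> space std_normal_distribution. s \<le> \<bar>z - std_normal.expectation (\<lambda>z. z)\<bar>}
      \<le> std_normal.variance (\<lambda>z. z) / s\<^sup>2"
    using integrable_std_normal_distribution_moment[of 2] assms
    by (intro std_normal.Chebyshev_inequality) auto
  then have chebyshev: "measure std_normal_distribution {z. s \<le> \<bar>z\<bar>} \<le> 1 / s\<^sup>2"
    using std_normal.standard_normal_distributed_expectation[OF distributed_id]
      std_normal.standard_normal_distributed_variance[OF distributed_id]
    by simp
  have "Phi (- s) \<le> measure std_normal_distribution {z. s \<le> \<bar>z\<bar>}"
    unfolding Phi_def by (intro std_normal.finite_measure_mono) auto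
  then show "Phi (- s) \<le> 1 / s\<^sup>2" using chebyshev by simp
  have "1 - Phi s = measure std_normal_distribution (space std_normal_distribution - {..s})"
    unfolding Phi_def by (subst std_normal.prob_compl) auto
  also have "\<dots> \<le> measure std_normal_distribution {z. s \<le> \<bar>z\<bar>}"
    by (intro std_normal.finite_measure_mono) auto
  finally show "1 - Phi s \<le> 1 / s\<^sup>2" using chebyshev by simp
qed

lemma Phi_approx_extend:
  assumes "mono F" and F_range: "\<And>s. 0 \<le> F s" "\<And>s. F s \<le> 1"
    and "0 < r" and central_approx: "\<And>s. \<bar>s\<bar> \<le> r \<Longrightarrow> \<bar>F s - Phi s\<bar> \<le> c"
  shows "\<bar>F s - Phi s\<bar> \<le> c + 1 / r\<^sup>2"
proof -
  have c_nonneg: "0 \<le> c" and at_r: "\<bar>F r - Phi r\<bar> \<le> c" and at_minus_r: "\<bar>F (- r) - Phi (- r)\<bar> \<le> c"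
    using central_approx[of r] central_approx[of "- r"] \<open>0 < r\<close> by auto
  consider "\<bar>s\<bar> \<le> r" | "r \<le> s" | "s \<le> - r" by linarith
  then show ?thesis
  proof cases
    case 1
    then show ?thesis
      using central_approx[of s] by (simp add: add_increasing2)
  next
    case 2
    then have "F r \<le> F s" "Phi r \<le> Phi s"
      using \<open>mono F\<close> by (auto simp: mono_def intro: Phi_mono)
    then show ?thesis
      using at_r c_nonneg F_range(2)[of s] Phi_le_1[of s] Phi_tail(1)[OF \<open>0 < r\<close>] by linarith
  next
    case 3
    then have "F s \<le> F (- r)" "Phi s \<le> Phi (- r)"
      using \<open>mono F\<close> by (auto simp: mono_def intro: Phi_mono)
    then show ?thesis
      using at_minus_r c_nonneg F_range(1)[of s] Phi_nonneg[of s] Phi_tail(2)[OF \<open>0 < r\<close>]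
      by linarith
  qed
qed

section \<open>A Berry--Esseen bound for the number of splits\<close>

definition count_pmf :: "real \<Rightarrow> nat pmf" where
  "count_pmf x = embed_pmf (\<lambda>k. split_prob k x)"

lemma pmf_count_pmf: "pmf (count_pmf x) k = split_prob k x"
  unfolding count_pmf_def
proof (rule pmf_embed_pmf)
  show "(\<integral>\<^sup>+ k. ennreal (split_prob k x) \<partial>count_space UNIV) = 1"
    using split_prob_sums_1[of x]
    by (simp add: nn_integral_count_space_nat suminf_ennreal2 split_prob_nonneg sums_iff)
qed (rule split_prob_nonneg)

lemma expectation_count_pmf:
  "(\<integral>k. iexp (\<theta> * (real k + 1 - 2 * x)) \<partial>measure_pmf (count_pmf x)) = count_char \<theta> x"
proof -
  let ?h = "\<lambda>k. iexp (\<theta> * (real k + 1 - 2 * x))"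
  have density: "measure_pmf (count_pmf x) =
      density (count_space UNIV) (\<lambda>k. ennreal (split_prob k x))"
    by (simp add: measure_pmf_eq_density pmf_count_pmf)
  have "integrable (measure_pmf (count_pmf x)) ?h"
    by (rule measure_pmf.integrable_const_bound[where B = 1]) auto
  then have "integrable (count_space UNIV) (\<lambda>k. split_prob k x *\<^sub>R ?h k)"
    unfolding density by (subst (asm) integrable_density) (auto simp: split_prob_nonneg)
  then have "(\<lambda>k. split_prob k x *\<^sub>R ?h k) sums (\<integral>k. split_prob k x *\<^sub>R ?h k \<partial>count_space UNIV)"
    by (rule sums_integral_count_space_nat)
  also have "(\<integral>k. split_prob k x *\<^sub>R ?h k \<partial>count_space UNIV) =
      (\<integral>k. ?h k \<partial>measure_pmf (count_pmf x))"
    unfolding density by (subst integral_density) (auto simp: split_prob_nonneg)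
  finally have expectation: "(\<lambda>k. split_prob k x *\<^sub>R ?h k) sums
      (\<integral>k. ?h k \<partial>measure_pmf (count_pmf x))" .
  have "(\<lambda>k. cis (\<theta> * (1 - 2 * x)) * (fps_nth (split_fps x) k *\<^sub>R cis \<theta> ^ k)) sums count_char \<theta> x"
    unfolding count_char_def by (intro sums_mult gen_fun_sums subprob_fps_split_fps) simp
  moreover have "cis (\<theta> * (1 - 2 * x)) * (fps_nth (split_fps x) k *\<^sub>R cis \<theta> ^ k) =
      split_prob k x *\<^sub>R ?h k" for k
  proof -
    have "cis (\<theta> * (1 - 2 * x)) * cis \<theta> ^ k = ?h k"
      by (simp add: Complex.DeMoivre cis_mult cis_conv_exp[symmetric] algebra_simps
          flip: of_real_mult of_real_add of_real_diff)
    then show ?thesis by simp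
  qed
  ultimately have "(\<lambda>k. split_prob k x *\<^sub>R ?h k) sums count_char \<theta> x"
    by (simp only:)
  with expectation show ?thesis
    by (rule sums_unique2)
qed

definition standardize :: "real \<Rightarrow> real \<Rightarrow> real" where
  "standardize x r = (r - 2 * x) / sqrt (var_rate * x)"

definition normalized_count :: "real \<Rightarrow> real measure" where
  "normalized_count x = distr (measure_pmf (count_pmf x)) borel (\<lambda>k. standardize x (real k + 1))"

lemma real_distribution_normalized_count: "real_distribution (normalized_count x)"
  unfolding normalized_count_def
  by (rule prob_space.real_distribution_distr[OF prob_space_measure_pmf]) simp

lemma cdf_normalized_count:
  assumes "0 < x"
  shows "cdf (normalized_count x) (standardize x (real n + 1)) = (\<Sum>k\<le>n. split_prob k x)"
proof -
  have "cdf (normalized_count x) (standardize x (real n + 1)) =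
      measure (measure_pmf (count_pmf x))
        {k. standardize x (real k + 1) \<le> standardize x (real n + 1)}"
    unfolding cdf_def normalized_count_def by (subst measure_distr) (auto simp: vimage_def)
  also have "{k. standardize x (real k + 1) \<le> standardize x (real n + 1)} = {..n}"
    using assms var_rate_pos by (auto simp: standardize_def divide_le_cancel mult_less_0_iff)
  finally show ?thesis
    by (simp add: measure_measure_pmf_finite pmf_count_pmf)
qed

lemma char_normalized_count:
  assumes "0 < x"
  shows "char (normalized_count x) (\<theta> * sqrt (var_rate * x)) = count_char \<theta> x"
proof -
  let ?a = "sqrt (var_rate * x)"
  have "char (normalized_count x) (\<theta> * ?a) =
      (\<integral>k. iexp (\<theta> * ?a * ((real k + 1 - 2 * x) / ?a)) \<partial>measure_pmf (count_pmf x))"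
    unfolding char_def normalized_count_def standardize_def by (subst integral_distr) auto
  also have "\<dots> = (\<integral>k. iexp (\<theta> * (real k + 1 - 2 * x)) \<partial>measure_pmf (count_pmf x))"
    using assms var_rate_pos
    by (intro Bochner_Integration.integral_cong refl arg_cong[where f = iexp]) simp
  finally show ?thesis
    by (simp only: expectation_count_pmf)
qed

lemma mult_exp_minus_le: "u * exp (- u) \<le> 2 * exp (- u / 2)" for u :: real
proof -
  have "u / 2 \<le> exp (u / 2)" using exp_ge_add_one_self[of "u / 2"] by linarith
  then have "u * exp (- u) \<le> (2 * exp (u / 2)) * exp (- u)" by (intro mult_right_mono) auto
  also have "\<dots> = 2 * exp (- u / 2)" by (simp add: mult.assoc exp_add[symmetric])
  finally show ?thesis .
qed

lemma char_normalized_count_diff_le: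
  assumes \<theta>_small: "\<bar>\<theta>\<bar> \<le> small_angle" and x_gt_2: "2 < x"
  shows "cmod (char (normalized_count x) (\<theta> * sqrt (var_rate * x)) -
      char std_normal_distribution (\<theta> * sqrt (var_rate * x))) \<le>
    30720 * residual_const * \<bar>\<theta>\<bar> * exp (- (\<theta>\<^sup>2 * x / 480) / 2)"
proof -
  have "char std_normal_distribution (\<theta> * sqrt (var_rate * x)) =
      of_real (exp (- \<theta>\<^sup>2 * var_rate * x / 2))"
    using x_gt_2 var_rate_pos by (simp add: char_std_normal_distribution power_mult_distrib mult_ac)
  then have "cmod (char (normalized_count x) (\<theta> * sqrt (var_rate * x)) -
        char std_normal_distribution (\<theta> * sqrt (var_rate * x))) \<le>
      32 * residual_const * \<bar>\<theta>\<bar> ^ 3 * x * exp (- \<theta>\<^sup>2 * x / 480)"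
    using norm_count_char_diff_gaussian_le[OF \<theta>_small x_gt_2] x_gt_2
    by (simp add: char_normalized_count)
  also have "\<dots> = 15360 * residual_const * \<bar>\<theta>\<bar> * ((\<theta>\<^sup>2 * x / 480) * exp (- (\<theta>\<^sup>2 * x / 480)))"
    by (simp add: power3_eq_cube power2_eq_square abs_mult_self_eq)
  also have "\<dots> \<le> 15360 * residual_const * \<bar>\<theta>\<bar> * (2 * exp (- (\<theta>\<^sup>2 * x / 480) / 2))"
    using residual_const_pos by (intro mult_left_mono mult_exp_minus_le) auto
  finally show ?thesis
    by simp
qed

lemma set_integral_gaussian_le:
  assumes "0 < c"
  shows "set_integrable lborel {a..b} (\<lambda>\<theta>. exp (- c * \<theta>\<^sup>2 / 2))"
    and "(LBINT \<theta>:{a..b}. exp (- c * \<theta>\<^sup>2 / 2)) \<le> sqrt (2 * pi / c)"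
proof -
  define \<sigma> where "\<sigma> = 1 / sqrt c"
  have \<sigma>_eq: "\<sigma> > 0" "\<sigma>\<^sup>2 = 1 / c" using assms by (auto simp: \<sigma>_def power_divide)
  have density: "exp (- c * \<theta>\<^sup>2 / 2) = sqrt (2 * pi / c) * normal_density 0 \<sigma> \<theta>" for \<theta>
    using assms \<sigma>_eq by (simp add: normal_density_def)
  show "set_integrable lborel {a..b} (\<lambda>\<theta>. exp (- c * \<theta>\<^sup>2 / 2))"
    by (rule set_integrable_Icc_bounded[where B = 1]) (use assms in auto)
  have "(LBINT \<theta>:{a..b}. exp (- c * \<theta>\<^sup>2 / 2)) \<le> (LBINT \<theta>. sqrt (2 * pi / c) * normal_density 0 \<sigma> \<theta>)"
    unfolding set_lebesgue_integral_def density
    by (rule integral_mono') (use assms \<sigma>_eq in \<open>auto simp: indicator_def\<close>)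
  also have "\<dots> = sqrt (2 * pi / c)"
    using \<sigma>_eq by (simp add: integral_normal_density)
  finally show "(LBINT \<theta>:{a..b}. exp (- c * \<theta>\<^sup>2 / 2)) \<le> sqrt (2 * pi / c)" .
qed

definition char_bound :: "real \<Rightarrow> real \<Rightarrow> real" where
  "char_bound x \<theta> =
      30720 * residual_const * small_angle * exp (- (small_angle\<^sup>2 / 480 * x) * \<theta>\<^sup>2 / 2)"

definition char_bound_const :: real where
  "char_bound_const =
     30720 * residual_const * small_angle * sqrt (2 * pi / (small_angle\<^sup>2 / 480))"

lemma char_bound_nonneg: "0 \<le> char_bound x \<theta>"
  using residual_const_pos small_angle_pos by (simp add: char_bound_def)

lemma char_normalized_count_diff_le_char_bound:
  assumes \<theta>_range: "0 < \<theta>" "\<theta> \<le> 1" and x_gt_2: "2 < x"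
  shows "cmod (char (normalized_count x) (\<theta> * (sqrt (var_rate * x) * small_angle)) -
    char std_normal_distribution (\<theta> * (sqrt (var_rate * x) * small_angle))) \<le> \<theta> * char_bound x \<theta>"
proof -
  have "\<bar>\<theta> * small_angle\<bar> \<le> small_angle"
    using \<theta>_range small_angle_pos mult_right_mono[of \<theta> 1 small_angle] by (simp add: abs_mult)
  from char_normalized_count_diff_le[OF this x_gt_2] show ?thesis
    using \<theta>_range small_angle_pos by (simp add: char_bound_def abs_mult power_mult_distrib mult_ac)
qed

lemma set_integral_char_bound_le:
  assumes "0 < x"
  shows "set_integrable lborel {0..1} (char_bound x)"
    and "(LBINT \<theta>:{0..1}. char_bound x \<theta>) \<le> char_bound_const / sqrt x"
proof -
  have rate_pos: "0 < small_angle\<^sup>2 / 480 * x"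
    using assms small_angle_pos by simp
  show "set_integrable lborel {0..1} (char_bound x)"
    unfolding char_bound_def[abs_def] using set_integral_gaussian_le(1)[OF rate_pos] by simp
  have "(LBINT \<theta>:{0..1}. char_bound x \<theta>) \<le>
      30720 * residual_const * small_angle * sqrt (2 * pi / (small_angle\<^sup>2 / 480 * x))"
    unfolding char_bound_def set_integral_mult_right using residual_const_pos small_angle_pos
    by (intro mult_left_mono set_integral_gaussian_le(2)[OF rate_pos]) auto
  then show "(LBINT \<theta>:{0..1}. char_bound x \<theta>) \<le> char_bound_const / sqrt x"
    by (simp add: char_bound_const_def real_sqrt_divide real_sqrt_mult)
qed

definition split_count_const :: real where
  "split_count_const = esseen_const * (char_bound_const + 1 / (sqrt var_rate * small_angle))"

lemma split_count_const_pos: "0 < split_count_const"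
  using esseen_const_pos residual_const_pos small_angle_pos var_rate_pos
  by (simp add: split_count_const_def char_bound_const_def add_pos_pos)

lemma split_count_berry_esseen:
  assumes x_gt_2: "2 < x"
  shows "\<bar>(\<Sum>k\<le>n. split_prob k x) - Phi (standardize x (real n + 1))\<bar> \<le> split_count_const / sqrt x"
proof -
  define T where "T = sqrt (var_rate * x) * small_angle"
  let ?s = "standardize x (real n + 1)"
  have "\<bar>cdf (normalized_count x) ?s - cdf std_normal_distribution ?s\<bar> \<le>
      esseen_const * ((LBINT \<theta>:{0..1}. char_bound x \<theta>) + 1 / T)"
  proof (rule esseen_smoothing[OF real_distribution_normalized_count real_dist_normal_dist])
    show "cmod (char (normalized_count x) (\<theta> * T) - char std_normal_distribution (\<theta> * T)) \<le>
        \<theta> * char_bound x \<theta>"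
      if "0 < \<theta>" "\<theta> \<le> 1" for \<theta>
      unfolding T_def by (rule char_normalized_count_diff_le_char_bound[OF that x_gt_2])
    show "cdf std_normal_distribution b - cdf std_normal_distribution a \<le> 1 * (b - a)"
      if "a \<le> b" for a b
      unfolding Phi_eq_cdf[symmetric] using that std_normal_density_le_1 by (rule Phi_diff_le)
  qed (use x_gt_2 var_rate_pos small_angle_pos set_integral_char_bound_le(1)[of x] in
    \<open>auto simp: T_def char_bound_nonneg\<close>)
  also have "\<dots> \<le> esseen_const *
      (char_bound_const / sqrt x + 1 / (sqrt var_rate * small_angle) / sqrt x)"
    using esseen_const_pos x_gt_2 set_integral_char_bound_le(2)[of x]
    by (intro mult_left_mono add_mono) (auto simp: T_def real_sqrt_mult mult_ac)
  also have "\<dots> = split_count_const / sqrt x"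
    unfolding split_count_const_def
    by (simp only: add_divide_distrib[symmetric] times_divide_eq_right)
  finally show ?thesis
    using x_gt_2 by (simp add: Phi_eq_cdf cdf_normalized_count)
qed

section \<open>From the number of splits to the largest interval\<close>

lemma inverse_sqrt_diff_le:
  fixes \<tau> :: real
  assumes "\<bar>\<tau>\<bar> \<le> 1 / 2"
  shows "\<bar>1 / sqrt (1 + \<tau>) - 1\<bar> \<le> 2 * \<bar>\<tau>\<bar>"
proof -
  define r where "r = sqrt (1 + \<tau>)"
  have r_squared: "r * r = 1 + \<tau>" using assms by (simp add: r_def)
  have r_ge: "1 / 2 \<le> r"
    unfolding r_def using assms by (intro real_le_rsqrt) (simp add: power2_eq_square)
  have "1 / r - 1 = (1 - r * r) / (r * (1 + r))"
    using r_ge by (simp add: divide_simps) (simp add: algebra_simps)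
  also have "\<dots> = - \<tau> / (r * (1 + r))" by (simp add: r_squared)
  finally have "\<bar>1 / r - 1\<bar> = \<bar>\<tau>\<bar> / (r * (1 + r))"
    using r_ge by (simp add: abs_divide abs_mult)
  also have "\<dots> \<le> \<bar>\<tau>\<bar> / (1 / 2 * 1)"
    using r_ge by (intro divide_left_mono mult_mono mult_pos_pos) auto
  finally show ?thesis by (simp add: r_def)
qed

lemma square_ge_between:
  fixes a b r z :: real
  assumes "0 \<le> a * b" "r \<le> a\<^sup>2" "r \<le> b\<^sup>2" "z \<in> {min a b..max a b}"
  shows "r \<le> z\<^sup>2"
proof -
  consider "0 \<le> min a b" | "max a b \<le> 0"
    using assms(1) by (auto simp: zero_le_mult_iff)
  then show ?thesis
  proof cases
    case 1
    then have "(min a b)\<^sup>2 \<le> z\<^sup>2"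
      using assms(4) by (intro power_mono) auto
    moreover have "r \<le> (min a b)\<^sup>2"
      using assms(2,3) by (simp add: min_def)
    ultimately show ?thesis by linarith
  next
    case 2
    then have "(- max a b)\<^sup>2 \<le> (- z)\<^sup>2"
      using assms(4) by (intro power_mono) auto
    moreover have "r \<le> (- max a b)\<^sup>2"
      using assms(2,3) by (simp add: max_def)
    ultimately show ?thesis by simp
  qed
qed

lemma Phi_rescale:
  assumes "\<bar>\<tau>\<bar> \<le> 1 / 2"
  shows "\<bar>Phi (s / sqrt (1 + \<tau>)) - Phi s\<bar> * \<bar>s\<bar> \<le> 3 * \<bar>\<tau>\<bar>"
proof (cases "s = 0")
  case False
  define q where "q = s / sqrt (1 + \<tau>)"
  have one_plus_\<tau>_bounds: "0 < 1 + \<tau>" "1 + \<tau> \<le> 3 / 2"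
    using assms by (auto simp: abs_le_iff)
  have "s\<^sup>2 / (3 / 2) \<le> s\<^sup>2 / (1 + \<tau>)"
    using one_plus_\<tau>_bounds by (intro divide_left_mono) auto
  then have q_squared: "2 / 3 * s\<^sup>2 \<le> q\<^sup>2"
    using one_plus_\<tau>_bounds by (simp add: q_def power_divide)
  have same_sign: "0 \<le> s * q"
    using one_plus_\<tau>_bounds by (simp add: q_def)
  have "2 / 3 * s\<^sup>2 \<le> z\<^sup>2" if "z \<in> {min s q..max s q}" for z
    using square_ge_between[OF same_sign _ q_squared that] by simp
  then have "\<bar>Phi q - Phi s\<bar> \<le> \<bar>q - s\<bar> / (2 / 3 * s\<^sup>2)"
    using False by (intro Phi_diff_le_inverse_square) auto
  also have "\<bar>q - s\<bar> = \<bar>s\<bar> * \<bar>1 / sqrt (1 + \<tau>) - 1\<bar>"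
    unfolding abs_mult[symmetric] by (simp add: q_def algebra_simps)
  also have "\<dots> / (2 / 3 * s\<^sup>2) \<le> \<bar>s\<bar> * (2 * \<bar>\<tau>\<bar>) / (2 / 3 * s\<^sup>2)"
    using inverse_sqrt_diff_le[OF assms] by (intro divide_right_mono mult_left_mono) auto
  also have "\<dots> = 3 * \<bar>\<tau>\<bar> / \<bar>s\<bar>"
    using False by (simp add: power2_eq_square field_simps)
  finally show ?thesis
    using False by (simp add: q_def field_simps)
qed simp

definition limit_sd :: real where
  "limit_sd = sqrt (16 * ln 2 - 10)"

lemma limit_variance_eq: "16 * ln 2 - 10 = 2 * var_rate"
  by (simp add: var_rate_def)

lemma limit_sd_pos: "0 < limit_sd"
  using var_rate_pos by (simp add: limit_sd_def limit_variance_eq)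

lemma limit_sd_squared: "limit_sd\<^sup>2 = 2 * var_rate"
  using var_rate_pos by (simp add: limit_sd_def limit_variance_eq)

definition relative_shift :: "nat \<Rightarrow> real \<Rightarrow> real" where
  "relative_shift n s = s * limit_sd / (2 * sqrt (real n))"

lemma normalized_le_iff:
  assumes "1 \<le> n"
  shows "sqrt (real n ^ 3 / (16 * ln 2 - 10)) * (m - 2 / real n) \<le> s \<longleftrightarrow>
    m \<le> 2 / real n * (1 + relative_shift n s)"
proof -
  have n_pos: "0 < real n" using assms by simp
  define k where "k = real n * sqrt (real n) / limit_sd"
  have k_pos: "0 < k" using n_pos limit_sd_pos by (simp add: k_def)
  have "sqrt (real n ^ 3) = real n * sqrt (real n)"
    using n_pos by (simp add: power3_eq_cube real_sqrt_mult)
  then have "sqrt (real n ^ 3 / (16 * ln 2 - 10)) * (m - 2 / real n) \<le> s \<longleftrightarrow> k * (m - 2 / real n) \<le> s"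
    by (simp add: k_def limit_sd_def real_sqrt_divide)
  also have "\<dots> \<longleftrightarrow> m - 2 / real n \<le> s / k"
    using k_pos by (simp add: pos_le_divide_eq mult.commute)
  also have "s / k = 2 / real n * relative_shift n s"
    using n_pos limit_sd_pos by (simp add: k_def relative_shift_def)
  also have "m - 2 / real n \<le> 2 / real n * relative_shift n s \<longleftrightarrow>
      m \<le> 2 / real n * (1 + relative_shift n s)"
    unfolding distrib_left mult_1_right by linarith
  finally show ?thesis .
qed

lemma abs_relative_shift_le:
  assumes "1 \<le> n" "\<bar>s\<bar> \<le> sqrt (real n) / limit_sd"
  shows "\<bar>relative_shift n s\<bar> \<le> 1 / 2"
proof -
  have "\<bar>s\<bar> * limit_sd \<le> sqrt (real n)"
    using assms(2) limit_sd_pos by (simp add: pos_le_divide_eq)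
  then show ?thesis
    using assms(1) limit_sd_pos by (simp add: relative_shift_def abs_mult divide_le_eq)
qed

text \<open>The interval length, in units of the threshold \<open>2 / n * (1 + relative_shift n s)\<close>, to which the
  splitting recursion is applied.\<close>

definition scaled_length :: "nat \<Rightarrow> real \<Rightarrow> real" where
  "scaled_length n s = real n / (2 * (1 + relative_shift n s))"

lemma scaled_length_ge:
  assumes "\<bar>relative_shift n s\<bar> \<le> 1 / 2"
  shows "real n / 3 \<le> scaled_length n s"
  unfolding scaled_length_def using assms by (intro divide_left_mono) (auto simp: abs_le_iff)

lemma standardized_scaled_length:
  assumes "1 \<le> n" "\<bar>relative_shift n s\<bar> \<le> 1 / 2"
  shows "standardize (scaled_length n s) (real n) = s / sqrt (1 + relative_shift n s)"
proof -
  define r where "r = sqrt (real n)"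
  define w where "w = sqrt (1 + relative_shift n s)"
  have r_square: "0 < r" "real n = r * r"
    using assms(1) by (auto simp: r_def)
  have w_square: "0 < w" "1 + relative_shift n s = w * w"
    using assms(2) by (auto simp: w_def abs_le_iff)
  have "0 < 1 + relative_shift n s"
    using assms(2) by (simp add: abs_le_iff)
  then have "real n - 2 * scaled_length n s = real n * relative_shift n s / (w * w)"
    unfolding w_square(2)[symmetric] by (simp add: scaled_length_def field_simps)
  also have "\<dots> = s * (limit_sd / 2 * r) / (w * w)"
    using r_square by (simp add: relative_shift_def r_def[symmetric])
  finally have numerator: "real n - 2 * scaled_length n s = s * (limit_sd / 2 * r) / (w * w)" .
  have "var_rate * scaled_length n s = (limit_sd / 2 * r / w)\<^sup>2"
    using r_square w_square
    by (simp add: scaled_length_def power_divide power_mult_distrib limit_sd_squared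
        power2_eq_square[of r] power2_eq_square[of w])
  then have denominator: "sqrt (var_rate * scaled_length n s) = limit_sd / 2 * r / w"
    using r_square w_square limit_sd_pos by simp
  show ?thesis
    unfolding standardize_def numerator denominator w_def[symmetric]
    using r_square(1) w_square(1) limit_sd_pos by (simp add: field_simps)
qed

lemma sqrt_var_scaled_length_ge:
  assumes "\<bar>relative_shift n s\<bar> \<le> 1 / 2"
  shows "sqrt (real n) / 3 \<le> sqrt (var_rate * scaled_length n s)"
proof -
  have "1 / 3 * (real n / 3) \<le> var_rate * scaled_length n s"
    using var_rate_bounds scaled_length_ge[OF assms] by (intro mult_mono) auto
  then have "sqrt (real n / 9) \<le> sqrt (var_rate * scaled_length n s)"
    by simp
  then show ?thesis
    by (simp add: real_sqrt_divide)
qed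

lemma Phi_standardize_diff_le:
  assumes "1 \<le> n" and shift: "\<bar>relative_shift n s\<bar> \<le> 1 / 2"
  shows "\<bar>Phi (standardize (scaled_length n s) (real n + 1)) - Phi s\<bar> \<le>
      (3 + 3 * limit_sd / 2) / sqrt (real n)"
proof -
  let ?q = "s / sqrt (1 + relative_shift n s)" and ?d = "sqrt (var_rate * scaled_length n s)"
  have d_bounds: "sqrt (real n) / 3 \<le> ?d" "0 < sqrt (real n) / 3"
    using sqrt_var_scaled_length_ge[OF shift] assms(1) by auto
  then have "0 < ?d" by (rule less_le_trans[rotated])
  have "standardize (scaled_length n s) (real n + 1) = ?q + 1 / ?d"
    unfolding standardized_scaled_length[OF assms, symmetric] standardize_def
    by (simp add: add_divide_distrib[symmetric])
  then have "\<bar>Phi (standardize (scaled_length n s) (real n + 1)) - Phi ?q\<bar> \<le> 1 / ?d"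
    using Phi_lipschitz[of "standardize (scaled_length n s) (real n + 1)" ?q] \<open>0 < ?d\<close> by simp
  also have "\<dots> \<le> 1 / (sqrt (real n) / 3)"
    using d_bounds \<open>0 < ?d\<close> by (intro divide_left_mono mult_pos_pos) auto
  finally have "\<bar>Phi (standardize (scaled_length n s) (real n + 1)) - Phi ?q\<bar> \<le> 3 / sqrt (real n)"
    by simp
  moreover have "\<bar>Phi ?q - Phi s\<bar> \<le> 3 * limit_sd / 2 / sqrt (real n)"
  proof (cases "s = 0")
    case False
    have "\<bar>Phi ?q - Phi s\<bar> * \<bar>s\<bar> \<le> 3 * \<bar>relative_shift n s\<bar>"
      by (rule Phi_rescale[OF shift])
    also have "\<dots> = 3 * limit_sd / 2 / sqrt (real n) * \<bar>s\<bar>"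
      using limit_sd_pos by (simp add: relative_shift_def abs_mult)
    finally show ?thesis
      by (rule mult_right_le_imp_le) (use False in simp)
  qed (use limit_sd_pos in simp)
  ultimately show ?thesis
    unfolding add_divide_distrib by linarith
qed

context kakutani_process
begin

definition normalized_max_cdf :: "nat \<Rightarrow> real \<Rightarrow> real" where
  "normalized_max_cdf n s = prob {\<omega> \<in> space M.
     sqrt (real n ^ 3 / (16 * ln 2 - 10)) * (max_length n \<omega> - 2 / real n) \<le> s}"

lemma normalized_max_cdf_bounds: "0 \<le> normalized_max_cdf n s" "normalized_max_cdf n s \<le> 1"
  by (simp_all add: normalized_max_cdf_def)

lemma mono_normalized_max_cdf: "mono (normalized_max_cdf n)"
  unfolding normalized_max_cdf_def by (intro monoI finite_measure_mono) auto

lemma normalized_max_cdf_eq_sum_split_prob: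
  assumes "1 \<le> n" "\<bar>relative_shift n s\<bar> \<le> 1 / 2"
  shows "normalized_max_cdf n s = (\<Sum>k\<le>n. split_prob k (scaled_length n s))"
proof -
  have "0 < 2 / real n * (1 + relative_shift n s)"
    using assms by (intro mult_pos_pos) (auto simp: abs_le_iff)
  then show ?thesis
    using prob_max_length_le[of "2 / real n * (1 + relative_shift n s)" n] assms(1)
    by (simp add: normalized_max_cdf_def normalized_le_iff scaled_length_def)
qed

definition central_const :: real where
  "central_const = split_count_const * 2 + (3 + 3 * limit_sd / 2)"

lemma central_const_pos: "0 < central_const"
  using split_count_const_pos limit_sd_pos by (simp add: central_const_def add_pos_pos)

lemma normalized_max_cdf_central:
  assumes n_ge_7: "7 \<le> n" and s_central: "\<bar>s\<bar> \<le> sqrt (real n) / limit_sd"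
  shows "\<bar>normalized_max_cdf n s - Phi s\<bar> \<le> central_const / sqrt (real n)"
proof -
  let ?x = "scaled_length n s"
  have "1 \<le> n" using n_ge_7 by simp
  have shift: "\<bar>relative_shift n s\<bar> \<le> 1 / 2"
    using \<open>1 \<le> n\<close> s_central by (rule abs_relative_shift_le)
  have x_ge: "real n / 3 \<le> ?x"
    by (rule scaled_length_ge[OF shift])
  then have "2 < ?x"
    using n_ge_7 by simp
  have "\<bar>normalized_max_cdf n s - Phi (standardize ?x (real n + 1))\<bar> \<le> split_count_const / sqrt ?x"
    unfolding normalized_max_cdf_eq_sum_split_prob[OF \<open>1 \<le> n\<close> shift]
    by (rule split_count_berry_esseen[OF \<open>2 < ?x\<close>])
  also have "\<dots> \<le> split_count_const / (sqrt (real n) / 2)"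
  proof (rule divide_left_mono)
    have "sqrt (real n) \<le> sqrt (4 * ?x)"
      using x_ge by simp
    then show "sqrt (real n) / 2 \<le> sqrt ?x"
      by (simp add: real_sqrt_mult)
  qed (use split_count_const_pos n_ge_7 \<open>2 < ?x\<close> in auto)
  finally show ?thesis
    using Phi_standardize_diff_le[OF \<open>1 \<le> n\<close> shift]
    unfolding central_const_def add_divide_distrib by simp
qed

lemma normalized_max_berry_esseen:
  assumes "1 \<le> n"
  shows "\<bar>normalized_max_cdf n s - Phi s\<bar> \<le> (central_const + limit_sd\<^sup>2 + 3) / sqrt (real n)"
proof (cases "7 \<le> n")
  case True
  have sqrt_n_pos: "0 < sqrt (real n)" using assms by simp
  have "\<bar>normalized_max_cdf n s - Phi s\<bar> \<le>
      central_const / sqrt (real n) + 1 / (sqrt (real n) / limit_sd)\<^sup>2"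
    using sqrt_n_pos limit_sd_pos normalized_max_cdf_central[OF True]
    by (intro Phi_approx_extend mono_normalized_max_cdf normalized_max_cdf_bounds) auto
  also have "1 / (sqrt (real n) / limit_sd)\<^sup>2 = limit_sd\<^sup>2 / real n"
    by (simp add: power_divide)
  also have "limit_sd\<^sup>2 / real n \<le> limit_sd\<^sup>2 / sqrt (real n)"
    using assms by (intro divide_left_mono real_le_lsqrt) (auto simp: power2_eq_square)
  also have "central_const / sqrt (real n) + limit_sd\<^sup>2 / sqrt (real n) \<le>
      (central_const + limit_sd\<^sup>2 + 3) / sqrt (real n)"
    using sqrt_n_pos by (simp add: add_divide_distrib[symmetric] divide_right_mono)
  finally show ?thesis by simp
next
  case False
  then have "sqrt (real n) \<le> sqrt (3\<^sup>2)" by (intro real_sqrt_le_mono) auto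
  also have "\<dots> \<le> central_const + limit_sd\<^sup>2 + 3" using central_const_pos by simp
  finally have "1 \<le> (central_const + limit_sd\<^sup>2 + 3) / sqrt (real n)"
    using assms by (simp add: le_divide_eq)
  then show ?thesis
    using normalized_max_cdf_bounds[of n s] Phi_nonneg[of s] Phi_le_1[of s] by linarith
qed

end

theorem theorem1p2:
  fixes M :: "'a measure" and U :: "nat \<Rightarrow> 'a \<Rightarrow> real"
  assumes "prob_space M"
    and "prob_space.indep_vars M (\<lambda>_. borel) U {1..}"
    and "\<And>i. i \<ge> 1 \<Longrightarrow> distributed M lborel (U i) (indicator {0..1})"
  shows "\<exists>C::real. C \<ge> 0 \<and> (\<forall>n::nat. n \<ge> 1 \<longrightarrow>
           (SUP x::real. \<bar>measure M {\<omega> \<in> space M.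
               sqrt (real n ^ 3 / (16 * ln 2 - 10)) * (kakutani_max (\<lambda>i. U i \<omega>) n - 2 / real n) \<le> x}
             - Phi x\<bar>) \<le> C / sqrt (real n))"
proof -
  interpret prob_space M by fact
  interpret kakutani_process M U
    using assms(2,3) by unfold_locales
  define C where "C = central_const + limit_sd\<^sup>2 + 3"
  have "0 \<le> C"
    using central_const_pos by (simp add: C_def)
  moreover have "(SUP s. \<bar>normalized_max_cdf n s - Phi s\<bar>) \<le> C / sqrt (real n)" if "1 \<le> n" for n
    unfolding C_def using normalized_max_berry_esseen[OF that] by (intro cSUP_least) auto
  ultimately show ?thesis
    unfolding normalized_max_cdf_def max_length_def by blast
qed

end
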